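(* Let $G$ be a finitely generated nilpotent group whose centralized isoperimetric function satisfies $\delta^{\mathrm{cent}}(n)=\Omega(n^k)$ for some real $k\ge 2$. Then for every finite presentation of $G$, the averaged Dehn function $\delta^{\mathrm{avg}}$ of that presentation satisfies $\delta^{\mathrm{avg}}(n)=\Omega(n^{k/2})$.
   Context: Let $G=\langle e_1,\dots,e_d\mid r_1,\dots,r_s\rangle$ be a finite presentation of a group with identity $e$; let $F$ be the free group on $e_1,\dots,e_d$ and $R\trianglelefteq F$ the normal closure of $r_1,\dots,r_s$, so $G=F/R$. Let $B(n)$ be the ball of radius $n$ about the identity in $F$ (word metric for $e_1,\dots,e_d$). Filling area: for $w\in R$ (or a word in the $e_i^{\pm1}$ representing the identity of $G$, regarded as an element of $R\subset F$), $\delta(w)$ is the minimal $k$ such that $w=\prod_{i=1}^k g_i^{-1}r_{a_i}^{\pm1}g_i$ in $F$ for some $g_i\in F$ and indices $a_i\in\{1,\dots,s\}$. Centralized isoperimetric function: the subgroup $R/[R,F]$ is central in $F/[R,F]$ and generated by the images of $r_1,\dots,r_s$. For $w\in R$, $\delta^{\mathrm{cent}}(w)$ is the minimal value of $\sum_{i=1}^s|b_i|$ over integers $b_1,\dots,b_s$ with $w\in \prod_{i=1}^s r_i^{b_i}\,[R,F]$, and $\delta^{\mathrm{cent}}(n)=\max_{w\in R\cap B(n)}\delta^{\mathrm{cent}}(w)$. For $k>1$, the polynomial asymptotics of order $n^k$ of $\delta^{\mathrm{cent}}$ do not depend on the choice of finite presentation of $G$. Averaged Dehn function: a lazy word of length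 $n$ is a sequence $(a_1,\dots,a_n)$ of letters $a_j\in\{e_1,e_1^{-1},\dots,e_d,e_d^{-1},e\}$ (an alphabet of $2d+1$ letters, $e$ standing for the identity); it is read as the product $a_1a_2\cdots a_n$ in $F$ or in $G$. Let $\overline{\rho}_n$ be the uniform probability measure on the (nonempty) set of lazy words of length $n$ with $a_1\cdots a_n=e$ in $G$; equivalently, it is the law of the $n$-step random walk from $e$, with each step uniformly distributed over the $2d+1$ letters, conditioned to return to $e$ at time $n$. Then $\delta^{\mathrm{avg}}(n)=\sum_w \delta(w)\,\overline{\rho}_n(w)$. $f(n)=\Omega(g(n))$ means that there are $m>0$ and $n_0$ with $m\,g(n)\le f(n)$ for all $n>n_0$. *)

theory Defs
  imports
    "HOL-Algebra.Algebra"
    "HOL-Library.Landau_Symbols"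
    "HOL-Probability.Probability_Mass_Function"
begin

section \<open>Free groups of finite rank\<close>

text \<open>
  The letter \<open>(i, True)\<close> is the generator $e_i$ and \<open>(i, False)\<close> is $e_i^{-1}$; generators are
  numbered from \<open>0\<close>.
\<close>

type_synonym letter = "nat \<times> bool"
type_synonym gen_word = "letter list"

definition inv_letter :: "letter \<Rightarrow> letter" where
  "inv_letter x = (fst x, \<not> snd x)"

definition letters :: "nat \<Rightarrow> letter set" where
  "letters d = {..<d} \<times> UNIV"

fun reduced_word :: "gen_word \<Rightarrow> bool" where
  "reduced_word (x # y # w) \<longleftrightarrow> y \<noteq> inv_letter x \<and> reduced_word (y # w)"
| "reduced_word _ \<longleftrightarrow> True"

fun cons_reduce :: "letter \<Rightarrow> gen_word \<Rightarrow> gen_word" where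
  "cons_reduce x [] = [x]"
| "cons_reduce x (y # w) = (if y = inv_letter x then w else x # y # w)"

definition reduce :: "gen_word \<Rightarrow> gen_word" where
  "reduce w = foldr cons_reduce w []"

definition free_group :: "nat \<Rightarrow> gen_word monoid" where
  "free_group d =
    \<lparr>carrier = {w \<in> lists (letters d). reduced_word w}, monoid.mult = (\<lambda>u v. reduce (u @ v)), one = []\<rparr>"

lemma inv_letter_inv_letter [simp]: "inv_letter (inv_letter x) = x"
  by (simp add: inv_letter_def)

lemma inv_letter_in_letters [simp]: "inv_letter x \<in> letters d \<longleftrightarrow> x \<in> letters d"
  by (cases x) (auto simp: inv_letter_def letters_def)

lemma reduced_ConsD: "reduced_word (x # w) \<Longrightarrow> reduced_word w"
  by (cases w) auto

lemma reduced_cons_reduce: "reduced_word w \<Longrightarrow> reduced_word (cons_reduce x w)"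
  by (cases w) (auto dest: reduced_ConsD)

lemma reduced_reduce: "reduced_word (reduce w)"
  unfolding reduce_def by (induction w) (auto intro: reduced_cons_reduce)

lemma cons_reduce_cancel: "reduced_word w \<Longrightarrow> cons_reduce (inv_letter x) (cons_reduce x w) = w"
  by (cases w rule: reduced_word.cases) auto

lemma cons_reduce_eq_Cons: "reduced_word (x # w) \<Longrightarrow> cons_reduce x w = x # w"
  by (cases w) auto

lemma reduce_reduced: "reduced_word w \<Longrightarrow> reduce w = w"
  unfolding reduce_def
proof (induction w)
  case (Cons x w)
  then show ?case
    using reduced_ConsD[of x w] cons_reduce_eq_Cons[of x w] by simp
qed simp

lemma foldr_cons_reduce: "reduced_word w \<Longrightarrow> reduced_word (foldr cons_reduce u w)"
  by (induction u) (auto intro: reduced_cons_reduce)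

lemma foldr_cons_reduce_cons_reduce:
  assumes "reduced_word w"
  shows "foldr cons_reduce (cons_reduce x u) w = cons_reduce x (foldr cons_reduce u w)"
proof (cases u)
  case (Cons y v)
  then show ?thesis
    using cons_reduce_cancel[OF foldr_cons_reduce[OF assms], of y v] by auto
qed simp

lemma foldr_cons_reduce_reduce:
  "reduced_word w \<Longrightarrow> foldr cons_reduce (reduce u) w = foldr cons_reduce u w"
  by (induction u) (simp_all add: reduce_def foldr_cons_reduce_cons_reduce)

lemma reduce_append: "reduce (u @ v) = foldr cons_reduce u (reduce v)"
  by (simp add: reduce_def)

lemma reduce_reduce_append_left: "reduce (reduce u @ v) = reduce (u @ v)"
  by (simp add: reduce_append foldr_cons_reduce_reduce reduced_reduce)

lemma reduce_reduce_append_right: "reduce (u @ reduce v) = reduce (u @ v)"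
  by (simp add: reduce_append reduce_reduced reduced_reduce)

lemma cons_reduce_lists:
  "x \<in> letters d \<Longrightarrow> w \<in> lists (letters d) \<Longrightarrow> cons_reduce x w \<in> lists (letters d)"
  by (cases w) auto

lemma reduce_lists: "w \<in> lists (letters d) \<Longrightarrow> reduce w \<in> lists (letters d)"
  unfolding reduce_def
proof (induction w)
  case (Cons x w)
  then show ?case
    using cons_reduce_lists[of x d] by (simp del: in_lists_conv_set)
qed simp

lemma reduce_inv_append: "reduce (map inv_letter (rev w) @ w) = []"
proof (induction w rule: rev_induct)
  case (snoc x w)
  have "reduce (map inv_letter (rev (w @ [x])) @ w @ [x]) =
      reduce ([inv_letter x] @ (map inv_letter (rev w) @ w) @ [x])"
    by simp
  also have "\<dots> = reduce ([inv_letter x] @ reduce (reduce (map inv_letter (rev w) @ w) @ [x]))"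
    by (simp only: reduce_reduce_append_left reduce_reduce_append_right)
  also have "\<dots> = []"
    by (simp add: snoc.IH) (simp add: reduce_def)
  finally show ?case .
qed (simp add: reduce_def)

theorem group_free_group: "group (free_group d)"
proof (rule groupI)
  show "\<exists>y\<in>carrier (free_group d). y \<otimes>\<^bsub>free_group d\<^esub> x = \<one>\<^bsub>free_group d\<^esub>"
    if "x \<in> carrier (free_group d)" for x
  proof
    from that have "map inv_letter (rev x) \<in> lists (letters d)"
      by (auto simp: free_group_def)
    then show "reduce (map inv_letter (rev x)) \<in> carrier (free_group d)"
      using reduce_lists reduced_reduce by (simp add: free_group_def del: in_lists_conv_set)
    show "reduce (map inv_letter (rev x)) \<otimes>\<^bsub>free_group d\<^esub> x = \<one>\<^bsub>free_group d\<^esub>"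
      by (simp add: free_group_def reduce_reduce_append_left reduce_inv_append)
  qed
qed (use reduce_lists in \<open>auto simp: free_group_def reduced_reduce reduce_reduced
      reduce_reduce_append_left reduce_reduce_append_right simp del: in_lists_conv_set
      intro: append_in_lists_conv[THEN iffD2]\<close>)

definition product_list :: "('a, 'b) monoid_scheme \<Rightarrow> 'a list \<Rightarrow> 'a" where
  "product_list G xs = foldr (monoid.mult G) xs \<one>\<^bsub>G\<^esub>"

definition free_ball :: "nat \<Rightarrow> nat \<Rightarrow> gen_word set" where
  "free_ball d n =
    {product_list (free_group d) (map (\<lambda>x. [x]) w) | w. w \<in> lists (letters d) \<and> length w \<le> n}"


section \<open>Normal closures, commutator subgroups, nilpotent groups\<close>

definition normal_closure :: "('a, 'b) monoid_scheme \<Rightarrow> 'a set \<Rightarrow> 'a set" where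
  "normal_closure G S = \<Inter>{N. N \<lhd> G \<and> S \<subseteq> N}"

definition commutator_subgroup :: "('a, 'b) monoid_scheme \<Rightarrow> 'a set \<Rightarrow> 'a set \<Rightarrow> 'a set" where
  "commutator_subgroup G H K =
    generate G {h \<otimes>\<^bsub>G\<^esub> k \<otimes>\<^bsub>G\<^esub> inv\<^bsub>G\<^esub> h \<otimes>\<^bsub>G\<^esub> inv\<^bsub>G\<^esub> k | h k. h \<in> H \<and> k \<in> K}"

primrec lower_central :: "('a, 'b) monoid_scheme \<Rightarrow> nat \<Rightarrow> 'a set" where
  "lower_central G 0 = carrier G"
| "lower_central G (Suc n) = commutator_subgroup G (lower_central G n) (carrier G)"

definition nilpotent_group :: "('a, 'b) monoid_scheme \<Rightarrow> bool" where
  "nilpotent_group G \<longleftrightarrow> group G \<and> (\<exists>n. lower_central G n = {\<one>\<^bsub>G\<^esub>})"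

definition finitely_generated_group :: "('a, 'b) monoid_scheme \<Rightarrow> bool" where
  "finitely_generated_group G \<longleftrightarrow>
    group G \<and> (\<exists>S. finite S \<and> S \<subseteq> carrier G \<and> generate G S = carrier G)"


section \<open>Finite presentations\<close>

text \<open>
  A finite presentation is given by the number \<open>d\<close> of generators and the list \<open>rs\<close> of relators,
  which are elements of \<open>free_group d\<close>.
\<close>

definition relation_subgroup :: "nat \<Rightarrow> gen_word list \<Rightarrow> gen_word set" where
  "relation_subgroup d rs = normal_closure (free_group d) (set rs)"

definition presented_group :: "nat \<Rightarrow> gen_word list \<Rightarrow> gen_word set monoid" where
  "presented_group d rs = free_group d Mod relation_subgroup d rs"

definition finite_presentation :: "('a, 'b) monoid_scheme \<Rightarrow> nat \<Rightarrow> gen_word list \<Rightarrow> bool" where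
  "finite_presentation G d rs \<longleftrightarrow>
    set rs \<subseteq> carrier (free_group d) \<and> presented_group d rs \<cong> G"


section \<open>Filling area and the averaged Dehn function\<close>

definition relator_conjugates :: "nat \<Rightarrow> gen_word list \<Rightarrow> gen_word set" where
  "relator_conjugates d rs =
    {inv\<^bsub>free_group d\<^esub> g \<otimes>\<^bsub>free_group d\<^esub> r \<otimes>\<^bsub>free_group d\<^esub> g | g r.
      g \<in> carrier (free_group d) \<and> (r \<in> set rs \<or> r \<in> m_inv (free_group d) ` set rs)}"

text \<open>
  The minima below exist for \<open>w \<in> relation_subgroup d rs\<close>, the only arguments to which the
  functions are applied.
\<close>

definition filling_area :: "nat \<Rightarrow> gen_word list \<Rightarrow> gen_word \<Rightarrow> nat" where
  "filling_area d rs w =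
    (LEAST k. \<exists>cs \<in> lists (relator_conjugates d rs).
      length cs = k \<and> w = product_list (free_group d) cs)"

text \<open>In lazy words, \<open>None\<close> is the letter for the identity.\<close>

definition lazy_words :: "nat \<Rightarrow> nat \<Rightarrow> letter option list set" where
  "lazy_words d n = {w \<in> lists (insert None (Some ` letters d)). length w = n}"

definition lazy_value :: "nat \<Rightarrow> letter option list \<Rightarrow> gen_word" where
  "lazy_value d w =
    product_list (free_group d) (map (case_option \<one>\<^bsub>free_group d\<^esub> (\<lambda>x. [x])) w)"

definition null_lazy_words :: "nat \<Rightarrow> gen_word list \<Rightarrow> nat \<Rightarrow> letter option list set" where
  "null_lazy_words d rs n =
    {w \<in> lazy_words d n.
      relation_subgroup d rs #>\<^bsub>free_group d\<^esub> lazy_value d w = \<one>\<^bsub>presented_group d rs\<^esub>}"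

definition averaged_dehn :: "nat \<Rightarrow> gen_word list \<Rightarrow> nat \<Rightarrow> real" where
  "averaged_dehn d rs n =
    (\<Sum>w \<in> null_lazy_words d rs n.
      real (filling_area d rs (lazy_value d w)) * pmf (pmf_of_set (null_lazy_words d rs n)) w)"


section \<open>The centralized isoperimetric function\<close>

definition centralized_area :: "nat \<Rightarrow> gen_word list \<Rightarrow> gen_word \<Rightarrow> nat" where
  "centralized_area d rs w =
    (LEAST m. \<exists>b :: nat \<Rightarrow> int.
      m = (\<Sum>i<length rs. nat \<bar>b i\<bar>) \<and>
      w \<in> product_list (free_group d)
            (map (\<lambda>i. (rs ! i) [^]\<^bsub>free_group d\<^esub> b i) [0..<length rs])
          <#\<^bsub>free_group d\<^esub>
          commutator_subgroup (free_group d) (relation_subgroup d rs) (carrier (free_group d)))"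

definition centralized_isoperimetric :: "nat \<Rightarrow> gen_word list \<Rightarrow> nat \<Rightarrow> nat" where
  "centralized_isoperimetric d rs n =
    Max (centralized_area d rs ` (relation_subgroup d rs \<inter> free_ball d n))"

end

theory Submission
  imports Defs
begin

text \<open>
  Centralized filling is computed, up to bounded error, by finitely many homomorphisms \<open>\<lambda>\<close> from
  \<open>R\<close> to the integers that vanish on \<open>[R, F]\<close>, and each of these bounds the filling area from below.
  Choose a loop \<open>w\<close> of length at most \<open>\<eta> \<sqrt>n\<close> on which some \<open>\<lambda>\<close> has size of order \<open>n ^ (k / 2)\<close>,
  put \<open>\<theta> = \<pi> / \<lambda> w\<close>, and twist the lazy random walk operator on the square-summable functions on
  \<open>G\<close> by the character \<open>exp (\<i> \<theta> \<lambda>)\<close> of \<open>R\<close>. The holonomy \<open>-1\<close> along every translate of \<open>w\<close>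
  gives the twisted operator a spectral gap of order \<open>1 / (\<eta>\<^sup>2 n)\<close>. Hence, for small \<open>\<eta>\<close>, the sum of
  \<open>cos (\<theta> \<lambda> u)\<close> over the null words \<open>u\<close> of length \<open>n\<close> is at most half their number; as
  \<open>1 - cos x \<le> \<bar>x\<bar>\<close>, the mean of \<open>\<bar>\<lambda> u\<bar>\<close> is of the order of \<open>\<bar>\<lambda> w\<bar>\<close>.

  Absorbing the loss from comparing return sums at different times requires the return
  probability to be doubling. This follows from volume doubling by a pseudo-Poincare inequality and
  a tent function as test function. Volume doubling of nilpotent groups, in turn, comes from collecting
  commutators and Gordan's lemma.
\<close>

section \<open>Commutators and filtrations of nilpotent groups\<close>

text \<open>The plain return probability decays as well, so a gap of the twisted operator alone
  decides nothing: the twisted sum has to be compared with the number of null words of the same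
  length. The gap acts only from index \<open>j\<close> to index \<open>m = n div 2\<close>, and at
  index \<open>j\<close> nothing better than the plain walk is available. Hence the need for
  \<open>ret j <= C * ret m\<close>, and hence the dependence of \<open>\<eta>\<close> on that
  \<open>C\<close>. Spectral theory is replaced by convexity and log-convexity of the squared norms
  of the iterates, so finitely supported functions suffice.

  The growth hypothesis concerns one presentation and the conclusion another. Loops go over by a
  lift \<open>\<phi>\<close> and functionals come back by a lift \<open>\<psi>\<close>; the defect
  of \<open>\<psi> o \<phi>\<close> changes a functional by a homomorphism of the free group, which
  is linear in the length and is dominated because \<open>k >= 2\<close>.

  The factors of the central series and \<open>R / [R, F]\<close> may have torsion. Therefore the
  collection works with words that are not unique, cut into blocks by Gordan's lemma, and the
  functionals see the quotient only up to bounded error.\<close>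

definition commut :: "('a, 'b) monoid_scheme \<Rightarrow> 'a \<Rightarrow> 'a \<Rightarrow> 'a" where
  "commut G x y = x \<otimes>\<^bsub>G\<^esub> y \<otimes>\<^bsub>G\<^esub> inv\<^bsub>G\<^esub> x \<otimes>\<^bsub>G\<^esub> inv\<^bsub>G\<^esub> y"

context group
begin

lemma mult_inv_cancel:
  assumes "x \<in> carrier G" "y \<in> carrier G"
  shows "x \<otimes> (inv x \<otimes> y) = y" "inv x \<otimes> (x \<otimes> y) = y"
  using assms by (simp_all flip: m_assoc)

text \<open>A normal form for group words: brackets to the right, inverses on single letters,
  neighbouring inverses cancelled. It settles identities that hold in every group.\<close>

lemmas word_simps = m_assoc inv_mult_group mult_inv_cancel

lemma commut_closed [simp]: "x \<in> carrier G \<Longrightarrow> y \<in> carrier G \<Longrightarrow> commut G x y \<in> carrier G"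
  by (simp add: commut_def)

lemma inv_commut: "x \<in> carrier G \<Longrightarrow> y \<in> carrier G \<Longrightarrow> inv (commut G x y) = commut G y x"
  by (simp add: commut_def word_simps)

lemma commut_subgroup_eq:
  "commutator_subgroup G H K = generate G {commut G h k | h k. h \<in> H \<and> k \<in> K}"
  by (simp add: commutator_subgroup_def commut_def)

text \<open>Free cancellation. If two of the three factors lie in a normal subgroup, so does the
  third; this drives the induction in \<open>commut_lower_central\<close>.\<close>

lemma Hall_Witt:
  assumes "x \<in> carrier G" "y \<in> carrier G" "z \<in> carrier G"
  shows "commut G (commut G x y) (y \<otimes> z \<otimes> inv y) \<otimes> commut G (commut G y z) (z \<otimes> x \<otimes> inv z)
    \<otimes> commut G (commut G z x) (x \<otimes> y \<otimes> inv x) = \<one>"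
  using assms by (simp add: commut_def word_simps)

lemma product_list_append:
  assumes "set xs \<subseteq> carrier G" "set ys \<subseteq> carrier G"
  shows "product_list G (xs @ ys) = product_list G xs \<otimes> product_list G ys"
proof -
  have "product_list G ys \<in> carrier G" if "set ys \<subseteq> carrier G" for ys
    using that by (induction ys) (auto simp: product_list_def)
  with assms show ?thesis by (induction xs) (auto simp: product_list_def m_assoc)
qed

end
lemma product_list_simps [simp]:
  "product_list G [] = \<one>\<^bsub>G\<^esub>" "product_list G (x # xs) = x \<otimes>\<^bsub>G\<^esub> product_list G xs"
  by (simp_all add: product_list_def)

context group
begin

lemma product_list_closed [simp]: "set xs \<subseteq> carrier G \<Longrightarrow> product_list G xs \<in> carrier G"
  by (induction xs) auto

lemma product_list_rev_inv:
  "set xs \<subseteq> carrier G \<Longrightarrow> product_list G (rev (map (m_inv G) xs)) = inv (product_list G xs)"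
proof (induction xs)
  case (Cons x xs)
  then have "set (map (m_inv G) xs) \<subseteq> carrier G" by auto
  with Cons show ?case by (simp add: product_list_append inv_mult_group)
qed simp

lemma product_list_subgroup:
  "subgroup H G \<Longrightarrow> set xs \<subseteq> H \<Longrightarrow> product_list G xs \<in> H"
  by (induction xs) (auto simp: subgroup.one_closed subgroup.m_closed)

lemma normal_conj:
  "N \<lhd> G \<Longrightarrow> x \<in> carrier G \<Longrightarrow> h \<in> N \<Longrightarrow> x \<otimes> h \<otimes> inv x \<in> N"
  "N \<lhd> G \<Longrightarrow> x \<in> carrier G \<Longrightarrow> h \<in> N \<Longrightarrow> inv x \<otimes> h \<otimes> x \<in> N"
  using normal.inv_op_closed1 normal.inv_op_closed2 by fastforce+

lemma normal_commut:
  assumes N: "N \<lhd> G" and "x \<in> carrier G" "h \<in> N"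
  shows "commut G x h \<in> N" "commut G h x \<in> N"
proof -
  have h: "h \<in> carrier G" using assms by (meson normal_imp_subgroup subgroup.mem_carrier)
  have *: "inv h \<in> N" using N assms(3) by (simp add: normal_imp_subgroup subgroup.m_inv_closed)
  show "commut G x h \<in> N"
    unfolding commut_def using normal_conj(1)[OF assms] *
    by (simp add: N normal_imp_subgroup subgroup.m_closed)
  then have "inv (commut G x h) \<in> N"
    using N by (simp add: normal_imp_subgroup subgroup.m_inv_closed)
  then show "commut G h x \<in> N" using assms h by (simp add: inv_commut)
qed

lemma commut_conj:
  assumes "g \<in> carrier G" "x \<in> carrier G" "y \<in> carrier G"
  shows "g \<otimes> commut G x y \<otimes> inv g = commut G (g \<otimes> x \<otimes> inv g) (g \<otimes> y \<otimes> inv g)"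
  using assms by (simp add: commut_def word_simps)

lemma normal_commutator_subgroup:
  assumes "H \<lhd> G"
  shows "commutator_subgroup G H (carrier G) \<lhd> G" "commutator_subgroup G H (carrier G) \<subseteq> H"
proof -
  have sub: "H \<subseteq> carrier G" using assms normal_imp_subgroup subgroup.subset by blast
  let ?S = "{commut G h k | h k. h \<in> H \<and> k \<in> carrier G}"
  have "?S \<subseteq> H" using normal_commut(2)[OF assms] by blast
  then show "commutator_subgroup G H (carrier G) \<subseteq> H"
    unfolding commut_subgroup_eq
    by (rule generate_subgroup_incl) (simp add: assms normal_imp_subgroup)
  show "commutator_subgroup G H (carrier G) \<lhd> G"
    unfolding commut_subgroup_eq
  proof (rule normal_generateI)
    show "?S \<subseteq> carrier G" using sub by auto
    fix h g assume "h \<in> ?S" and g: "g \<in> carrier G"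
    then obtain a k where a: "h = commut G a k" "a \<in> H" "k \<in> carrier G" by blast
    then have "g \<otimes> h \<otimes> inv g = commut G (g \<otimes> a \<otimes> inv g) (g \<otimes> k \<otimes> inv g)"
      using commut_conj g sub by blast
    then show "g \<otimes> h \<otimes> inv g \<in> ?S"
      using a g normal_conj(1)[OF assms g] by blast
  qed
qed

lemma normal_carrier: "carrier G \<lhd> G"
  by (simp add: normal_invI subgroup_self)

lemma normal_lower_central: "lower_central G n \<lhd> G"
  by (induction n) (simp_all add: normal_carrier normal_commutator_subgroup)

lemma lower_central_decr: "lower_central G (Suc n) \<subseteq> lower_central G n"
  using normal_commutator_subgroup(2)[OF normal_lower_central[of n]] by simp

lemma normal_subset: "N \<lhd> G \<Longrightarrow> N \<subseteq> carrier G"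
  using normal_imp_subgroup subgroup.subset by blast

section \<open>Commutator identities and the lower central series\<close>

lemma commut_inv_right:
  assumes "x \<in> carrier G" "y \<in> carrier G"
  shows "commut G x (inv y) = inv y \<otimes> inv (commut G x y) \<otimes> y"
  using assms by (simp add: commut_def word_simps)

lemma commut_mult_right:
  assumes "x \<in> carrier G" "y \<in> carrier G" "z \<in> carrier G"
  shows "commut G x (y \<otimes> z) = commut G x y \<otimes> (y \<otimes> commut G x z \<otimes> inv y)"
  using assms by (simp add: commut_def word_simps)

lemma commut_mult_left:
  assumes "x \<in> carrier G" "y \<in> carrier G" "z \<in> carrier G"
  shows "commut G (x \<otimes> y) z = (x \<otimes> commut G y z \<otimes> inv x) \<otimes> commut G x z"
  using assms by (simp add: commut_def word_simps)

text \<open>The commutator of \<open>x\<close> with a product or an inverse is a product of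
  conjugates of the single commutators or their inverses, and a normal subgroup absorbs conjugation.
  So it is enough to test generators.\<close>

lemma commut_generate_normal:
  assumes N: "N \<lhd> G" and x: "x \<in> carrier G" and S: "S \<subseteq> carrier G"
    and comm: "\<And>s. s \<in> S \<Longrightarrow> commut G x s \<in> N" and y: "y \<in> generate G S"
  shows "commut G x y \<in> N"
  using y
proof (induction rule: generate.induct)
  case one
  have "commut G x \<one> = \<one>" using x by (simp add: commut_def)
  then show ?case using N by (simp add: normal_imp_subgroup subgroup.one_closed)
next
  case (incl h) then show ?case using comm by blast
next
  case (inv h)
  then have "h \<in> carrier G" "inv (commut G x h) \<in> N"
    using S comm N by (auto simp: normal_imp_subgroup subgroup.m_inv_closed)
  then show ?case using commut_inv_right[OF x] normal_conj(2)[OF N] by simp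
next
  case (eng h1 h2)
  then have "h1 \<in> carrier G" "h2 \<in> carrier G" using generate_in_carrier S by blast+
  then show ?case using commut_mult_right[OF x] normal_conj(1)[OF N] eng N
    by (simp add: normal_imp_subgroup subgroup.m_closed)
qed

text \<open>The three subgroups argument, by induction on \<open>j\<close>. Since
  \<open>lower_central G 0\<close> is the whole group, indices are one below the usual ones, hence
  the \<open>Suc\<close>.\<close>

theorem commut_lower_central:
  "x \<in> lower_central G i \<Longrightarrow> y \<in> lower_central G j \<Longrightarrow> commut G x y \<in> lower_central G (Suc (i + j))"
proof (induction j arbitrary: i x y)
  case 0
  then show ?case
    by (auto simp: commut_subgroup_eq intro!: generate.incl)
next
  case (Suc j)
  let ?L = "lower_central G"
  let ?N = "?L (Suc (i + Suc j))"
  have carr: "?L n \<subseteq> carrier G" for n using normal_lower_central normal_subset by blast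
  have N: "?N \<lhd> G" by (rule normal_lower_central)
  show ?case
  proof (rule commut_generate_normal[OF N])
    show "x \<in> carrier G" using carr Suc.prems by blast
    show "{commut G h k | h k. h \<in> ?L j \<and> k \<in> carrier G} \<subseteq> carrier G" using carr by fastforce
    show "y \<in> generate G {commut G h k | h k. h \<in> ?L j \<and> k \<in> carrier G}"
      using Suc.prems by (simp add: commut_subgroup_eq)
    fix s assume "s \<in> {commut G h k | h k. h \<in> ?L j \<and> k \<in> carrier G}"
    then obtain h k where s: "s = commut G h k" and h: "h \<in> ?L j" and k: "k \<in> carrier G" by blast
    have hc: "h \<in> carrier G" and xc: "x \<in> carrier G" using carr h Suc.prems by blast+
    \<comment> \<open>Conjugating \<open>x\<close> by \<open>k\<close> beforehand makes
      \<open>x\<close> itself appear in the middle factor of the Hall-Witt identity, next to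
      \<open>s = [h, k]\<close>.\<close>
    define z where "z = inv k \<otimes> x \<otimes> k"
    have z: "z \<in> ?L i" unfolding z_def
      using normal_conj(2)[OF normal_lower_central k] Suc.prems by blast
    then have zc: "z \<in> carrier G" using carr by blast
    have kz: "k \<otimes> z \<otimes> inv k = x" using k xc by (simp add: z_def word_simps)
    let ?A = "commut G (commut G z h) (h \<otimes> k \<otimes> inv h)"
    let ?C = "commut G (commut G k z) (z \<otimes> h \<otimes> inv z)"
    have "commut G z h \<in> ?L (Suc (i + j))" using Suc.IH z h by blast
    then have A: "?A \<in> ?N" using hc k by (auto simp: commut_subgroup_eq intro!: generate.incl)
    have "commut G z k \<in> ?L (Suc i)" using z k by (auto simp: commut_subgroup_eq intro!: generate.incl)
    then have "commut G k z \<in> ?L (Suc i)"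
      using inv_commut[of z k] zc k normal_imp_subgroup[OF normal_lower_central] subgroup.m_inv_closed
      by fastforce
    moreover have "z \<otimes> h \<otimes> inv z \<in> ?L j"
      using normal_conj(1)[OF normal_lower_central zc h] .
    ultimately have "?C \<in> ?L (Suc (Suc i + j))" by (rule Suc.IH)
    then have C: "?C \<in> ?N" by simp
    have AC: "?A \<in> carrier G" "?C \<in> carrier G" "commut G s x \<in> carrier G"
      using hc k zc xc s by simp_all
    have "?A \<otimes> commut G s x \<otimes> ?C = \<one>"
      using Hall_Witt[OF zc hc k] by (simp add: kz s)
    then have "inv ?A \<otimes> (?A \<otimes> commut G s x \<otimes> ?C) \<otimes> inv ?C = inv ?A \<otimes> inv ?C"
      using AC by simp
    then have "commut G s x = inv ?A \<otimes> inv ?C"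
      using AC by (simp add: word_simps del: commut_closed)
    moreover have "inv ?A \<otimes> inv ?C \<in> ?N"
      using A C N by (simp add: normal_imp_subgroup subgroup.m_closed subgroup.m_inv_closed)
    ultimately show "commut G x s \<in> ?N"
      using inv_commut[of s x] hc k xc s normal_imp_subgroup[OF N] subgroup.m_inv_closed by fastforce
  qed
qed

end

text \<open>Equality of the left cosets of \<open>x\<close> and \<open>y\<close>. A relation on
  \<open>G\<close> is preferred to the quotient group because word lengths refer to the
  representatives.\<close>

definition coset_eq :: "('a, 'b) monoid_scheme \<Rightarrow> 'a set \<Rightarrow> 'a \<Rightarrow> 'a \<Rightarrow> bool" where
  "coset_eq G N x y \<longleftrightarrow> x \<in> carrier G \<and> y \<in> carrier G \<and> inv\<^bsub>G\<^esub> x \<otimes>\<^bsub>G\<^esub> y \<in> N"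

section \<open>Calculus of congruences modulo a normal subgroup\<close>

context group
begin

lemma coset_eq_refl: "N \<lhd> G \<Longrightarrow> x \<in> carrier G \<Longrightarrow> coset_eq G N x x"
  by (simp add: coset_eq_def normal_imp_subgroup subgroup.one_closed)

lemma coset_eq_sym: "N \<lhd> G \<Longrightarrow> coset_eq G N x y \<Longrightarrow> coset_eq G N y x"
  unfolding coset_eq_def
  using subgroup.m_inv_closed[of N G "inv x \<otimes> y"] by (auto simp: normal_imp_subgroup inv_mult_group)

lemma coset_eq_trans:
  assumes "coset_eq G N x y" "coset_eq G N y z" "N \<lhd> G"
  shows "coset_eq G N x z"
  using assms subgroup.m_closed[of N G "inv x \<otimes> y" "inv y \<otimes> z"]
  by (auto simp: coset_eq_def normal_imp_subgroup word_simps)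

lemma coset_eq_mult:
  assumes N: "N \<lhd> G" and "coset_eq G N x x'" "coset_eq G N y y'"
  shows "coset_eq G N (x \<otimes> y) (x' \<otimes> y')"
proof -
  note c = assms(2,3)[unfolded coset_eq_def]
  have "inv y \<otimes> (inv x \<otimes> x') \<otimes> y \<in> N" using normal_conj(2)[OF N] c by blast
  then have "(inv y \<otimes> (inv x \<otimes> x') \<otimes> y) \<otimes> (inv y \<otimes> y') \<in> N"
    using N c by (simp add: normal_imp_subgroup subgroup.m_closed)
  then show ?thesis using c by (simp add: coset_eq_def word_simps)
qed

lemma coset_eq_inv:
  assumes N: "N \<lhd> G" and "coset_eq G N x y"
  shows "coset_eq G N (inv x) (inv y)"
proof -
  have "x \<otimes> (inv y \<otimes> x) \<otimes> inv x \<in> N"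
    using coset_eq_sym[OF assms] normal_conj(1)[OF N] assms(2) by (auto simp: coset_eq_def)
  then show ?thesis using assms(2) by (simp add: coset_eq_def word_simps)
qed

lemma coset_eq_pow:
  fixes n :: nat
  assumes N: "N \<lhd> G" and "coset_eq G N x y"
  shows "coset_eq G N (x [^] n) (y [^] n)"
proof (induction n)
  case 0 then show ?case using coset_eq_refl[OF N one_closed] by simp
next
  case (Suc n) then show ?case using coset_eq_mult[OF N _ assms(2)] by simp
qed

lemma coset_eq_int_pow:
  fixes n :: int
  assumes N: "N \<lhd> G" and "coset_eq G N x y"
  shows "coset_eq G N (x [^] n) (y [^] n)"
  using coset_eq_pow[OF assms] coset_eq_inv[OF N coset_eq_pow[OF assms]]
  by (cases n rule: int_cases2) (use assms in \<open>auto simp: int_pow_int int_pow_neg_int coset_eq_def\<close>)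

lemma coset_eq_commute:
  assumes N: "N \<lhd> G" and "commut G x y \<in> N" "x \<in> carrier G" "y \<in> carrier G"
  shows "coset_eq G N (x \<otimes> y) (y \<otimes> x)"
proof -
  have "inv (commut G x y) \<in> N" using assms by (simp add: normal_imp_subgroup subgroup.m_inv_closed)
  then have "inv (y \<otimes> x) \<otimes> inv (commut G x y) \<otimes> (y \<otimes> x) \<in> N"
    using assms normal_conj(2)[OF N] by simp
  then show ?thesis using assms by (simp add: coset_eq_def commut_def word_simps)
qed

lemma coset_eq_memD: "N \<lhd> G \<Longrightarrow> coset_eq G N x y \<Longrightarrow> x \<in> M \<Longrightarrow> N \<subseteq> M \<Longrightarrow> subgroup M G \<Longrightarrow> y \<in> M"
  using subgroup.m_closed[of M G x "inv x \<otimes> y"] by (auto simp: coset_eq_def word_simps)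

lemma subgroup_nat_pow_closed: "subgroup H G \<Longrightarrow> x \<in> H \<Longrightarrow> x [^] (n::nat) \<in> H"
  by (induction n) (auto simp: subgroup.one_closed subgroup.m_closed)

lemma coset_eq_right:
  assumes "N \<lhd> G" "x \<in> carrier G" "z \<in> N"
  shows "coset_eq G N (x \<otimes> z) x" "coset_eq G N x (x \<otimes> z)"
proof -
  have "z \<in> carrier G" using assms normal_subset by blast
  with assms show *: "coset_eq G N x (x \<otimes> z)" by (simp add: coset_eq_def word_simps)
  then show "coset_eq G N (x \<otimes> z) x" using coset_eq_sym assms by blast
qed

lemma coset_eq_conj:
  assumes N: "N \<lhd> G" and "commut G x y \<in> N" "x \<in> carrier G" "y \<in> carrier G"
  shows "coset_eq G N (x \<otimes> y \<otimes> inv x) y"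
proof -
  have "coset_eq G N (x \<otimes> y \<otimes> inv x) (y \<otimes> x \<otimes> inv x)"
    using coset_eq_mult[OF N coset_eq_commute[OF assms] coset_eq_refl[OF N]] assms by simp
  then show ?thesis using assms by (simp add: word_simps)
qed

definition word_ball :: "'a set \<Rightarrow> nat \<Rightarrow> 'a set" where
  "word_ball S n = {product_list G xs | xs. set xs \<subseteq> S \<and> length xs \<le> n}"

text \<open>Every \<open>g t\<close> is central modulo \<open>N\<close> and can be moved to the
  right past the remaining \<open>f\<close> factors. It serves both to split exponents in the
  covering and to add exponent vectors of relators.\<close>

lemma product_list_mult_central:
  assumes N: "N \<lhd> G" and f: "\<And>t. t \<in> set ts \<Longrightarrow> f t \<in> carrier G" and g: "\<And>t. t \<in> set ts \<Longrightarrow> g t \<in> carrier G"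
    and cen: "\<And>t y. t \<in> set ts \<Longrightarrow> y \<in> carrier G \<Longrightarrow> commut G (g t) y \<in> N"
  shows "coset_eq G N (product_list G (map (\<lambda>t. f t \<otimes> g t) ts))
    (product_list G (map f ts) \<otimes> product_list G (map g ts))"
  using f g cen
proof (induction ts)
  case Nil then show ?case using coset_eq_refl[OF N] by simp
next
  case (Cons t ts)
  have c: "f t \<in> carrier G" "g t \<in> carrier G" using Cons.prems by auto
  have "set (map f ts) \<subseteq> carrier G" "set (map g ts) \<subseteq> carrier G" using Cons.prems by auto
  then have p: "product_list G (map f ts) \<in> carrier G" "product_list G (map g ts) \<in> carrier G" by auto
  have com: "coset_eq G N (g t \<otimes> product_list G (map f ts)) (product_list G (map f ts) \<otimes> g t)"
    by (rule coset_eq_commute[OF N]) (use Cons.prems c p in auto)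
  have "coset_eq G N (f t \<otimes> g t \<otimes> product_list G (map (\<lambda>t. f t \<otimes> g t) ts))
     (f t \<otimes> g t \<otimes> (product_list G (map f ts) \<otimes> product_list G (map g ts)))"
    by (rule coset_eq_mult[OF N coset_eq_refl[OF N] Cons.IH]) (use Cons.prems c in auto)
  moreover have "f t \<otimes> g t \<otimes> (product_list G (map f ts) \<otimes> product_list G (map g ts))
     = f t \<otimes> (g t \<otimes> product_list G (map f ts)) \<otimes> product_list G (map g ts)"
    using c p by (simp add: m_assoc)
  moreover have "coset_eq G N (f t \<otimes> (g t \<otimes> product_list G (map f ts)) \<otimes> product_list G (map g ts))
      (f t \<otimes> (product_list G (map f ts) \<otimes> g t) \<otimes> product_list G (map g ts))"
    by (rule coset_eq_mult[OF N coset_eq_mult[OF N coset_eq_refl[OF N] com] coset_eq_refl[OF N]]) (use c p in simp_all)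
  moreover have "f t \<otimes> (product_list G (map f ts) \<otimes> g t) \<otimes> product_list G (map g ts)
     = product_list G (map f (t # ts)) \<otimes> product_list G (map g (t # ts))"
    using c p by (simp add: m_assoc)
  ultimately show ?case using coset_eq_trans[OF _ _ N] by simp
qed

end

text \<open>Models the lower central series with \<open>\<Gamma> 1\<close> the whole group, so that
  weights add under commutators. The symmetric generating set \<open>S\<close> fixes the word
  metric.\<close>

locale nilpotent_filtration = group G for G :: "('a, 'b) monoid_scheme" (structure) +
  fixes \<Gamma> :: "nat \<Rightarrow> 'a set" and c :: nat and S :: "'a set"
  assumes normal_filt: "\<Gamma> i \<lhd> G"
    and filt_1: "\<Gamma> (Suc 0) = carrier G"
    and filt_decr: "\<Gamma> (Suc i) \<subseteq> \<Gamma> i"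
    and filt_commut: "x \<in> \<Gamma> i \<Longrightarrow> y \<in> \<Gamma> j \<Longrightarrow> commut G x y \<in> \<Gamma> (i + j)"
    and filt_top: "\<Gamma> (Suc c) = {\<one>}"
    and filt_gen: "0 < i \<Longrightarrow> \<Gamma> (Suc i) = generate G {commut G h k | h k. h \<in> \<Gamma> i \<and> k \<in> carrier G}"
    and fin_S: "finite S" and S_carr: "S \<subseteq> carrier G"
    and S_inv: "x \<in> S \<Longrightarrow> inv x \<in> S"
    and S_gen: "generate G S = carrier G"
begin

section \<open>Word balls and the distortion of powers in the filtration\<close>

abbreviation "B \<equiv> word_ball S"

lemma filt_subgroup: "subgroup (\<Gamma> i) G" using normal_filt normal_imp_subgroup by blast
lemma filt_carr: "\<Gamma> i \<subseteq> carrier G" using normal_filt normal_subset by blast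
lemma filt_in_carr: "x \<in> \<Gamma> i \<Longrightarrow> x \<in> carrier G" using filt_carr by blast
lemma filt_mono: "i \<le> j \<Longrightarrow> \<Gamma> j \<subseteq> \<Gamma> i" using filt_decr lift_Suc_antimono_le by blast

lemmas filt_refl = coset_eq_refl[OF normal_filt]
lemmas filt_sym = coset_eq_sym[OF normal_filt]
lemmas filt_mult = coset_eq_mult[OF normal_filt]

lemma filt_trans [trans]:
  "coset_eq G (\<Gamma> i) x y \<Longrightarrow> coset_eq G (\<Gamma> i) y z \<Longrightarrow> coset_eq G (\<Gamma> i) x z"
  using coset_eq_trans normal_filt by blast

lemma filt_gt_c: "c < i \<Longrightarrow> x \<in> \<Gamma> i \<Longrightarrow> x = \<one>"
  using filt_mono[of "Suc c" i] filt_top by auto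

lemma ball_carr: "x \<in> B n \<Longrightarrow> x \<in> carrier G"
  using product_list_closed S_carr by (fastforce simp: word_ball_def)

lemma ball_mono: "m \<le> n \<Longrightarrow> B m \<subseteq> B n"
  unfolding word_ball_def using le_trans by blast

lemma ball_one: "\<one> \<in> B n"
  unfolding word_ball_def by (rule CollectI, rule exI[of _ "[]"]) auto

lemma ball_mult: "x \<in> B m \<Longrightarrow> y \<in> B n \<Longrightarrow> x \<otimes> y \<in> B (m + n)"
proof -
  assume "x \<in> B m" "y \<in> B n"
  then obtain xs ys where "x = product_list G xs" "set xs \<subseteq> S" "length xs \<le> m"
    "y = product_list G ys" "set ys \<subseteq> S" "length ys \<le> n" unfolding word_ball_def by blast
  moreover from this have "product_list G (xs @ ys) = x \<otimes> y"
    using S_carr product_list_append[of xs ys] by (metis subset_trans)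
  ultimately show ?thesis unfolding word_ball_def by (intro CollectI exI[of _ "xs @ ys"]) auto
qed

lemma ball_inv: "x \<in> B m \<Longrightarrow> inv x \<in> B m"
proof -
  assume "x \<in> B m"
  then obtain xs where xs: "x = product_list G xs" "set xs \<subseteq> S" "length xs \<le> m"
    unfolding word_ball_def by blast
  then have "set xs \<subseteq> carrier G" using S_carr by auto
  then have "inv x = product_list G (rev (map (m_inv G) xs))" using xs product_list_rev_inv by simp
  then show ?thesis unfolding word_ball_def
    using xs S_inv by (intro CollectI exI[of _ "rev (map (m_inv G) xs)"]) auto
qed

lemma ball_pow: "x \<in> B m \<Longrightarrow> x [^] (n::nat) \<in> B (n * m)"
proof (induction n)
  case (Suc n)
  then show ?case using ball_mult[of "x [^] n" "n * m" x m] by (simp add: add.commute)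
qed (simp add: ball_one)

lemma ball_commut: "x \<in> B m \<Longrightarrow> y \<in> B n \<Longrightarrow> commut G x y \<in> B (2 * m + 2 * n)"
proof -
  assume x: "x \<in> B m" and y: "y \<in> B n"
  have "x \<otimes> y \<otimes> inv x \<otimes> inv y \<in> B (m + n + m + n)"
    by (intro ball_mult ball_inv x y)
  then show ?thesis by (simp add: commut_def mult_2 add_ac)
qed

lemma finite_ball: "finite (B n)"
proof -
  have "B n = product_list G ` {xs. set xs \<subseteq> S \<and> length xs \<le> n}"
    by (auto simp: word_ball_def)
  then show ?thesis using finite_lists_length_le[OF fin_S] by simp
qed

lemma in_some_ball: "x \<in> carrier G \<Longrightarrow> \<exists>n. x \<in> B n"
proof -
  assume "x \<in> carrier G"
  then have "x \<in> generate G S" using S_gen by simp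
  then show ?thesis
  proof (induction rule: generate.induct)
    case one then show ?case using ball_one by blast
  next
    case (incl h)
    then have "h \<in> B 1" unfolding word_ball_def using S_carr
      by (intro CollectI exI[of _ "[h]"]) auto
    then show ?case by blast
  next
    case (inv h)
    then have "h \<in> B 1" unfolding word_ball_def using S_carr
      by (intro CollectI exI[of _ "[h]"]) auto
    then show ?case using ball_inv by blast
  next
    case (eng h1 h2) then show ?case using ball_mult by blast
  qed
qed

lemma filt_conj:
  assumes "0 < i" "x \<in> \<Gamma> i" "g \<in> carrier G"
  shows "coset_eq G (\<Gamma> (Suc i)) (g \<otimes> x \<otimes> inv g) x"
  using coset_eq_conj[OF normal_filt, of g x "Suc i"] filt_commut[of g 1 x i] assms filt_1 filt_in_carr
  by simp

lemma filt_central: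
  assumes "x \<in> \<Gamma> i" "g \<in> carrier G"
  shows "coset_eq G (\<Gamma> (Suc i)) (g \<otimes> x) (x \<otimes> g)"
  using coset_eq_commute[OF normal_filt, of g x "Suc i"] filt_commut[of g 1 x i] assms filt_1 filt_in_carr
  by simp

text \<open>Writing \<open>y = x z\<close> with \<open>z\<close> in \<open>\<Gamma> i\<close>, the
  commutator with \<open>k\<close> changes by a conjugate of \<open>[z, k]\<close>, which lies one
  level deeper.\<close>

lemma commut_coset_eq:
  assumes "coset_eq G (\<Gamma> i) x y" "k \<in> carrier G"
  shows "coset_eq G (\<Gamma> (Suc i)) (commut G x k) (commut G y k)"
proof -
  let ?z = "inv x \<otimes> y"
  have z: "?z \<in> \<Gamma> i" "x \<in> carrier G" "y \<in> carrier G" using assms by (auto simp: coset_eq_def)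
  have "commut G ?z k \<in> \<Gamma> (Suc i)" using filt_commut[of ?z i k 1] z assms filt_1 by simp
  then have w: "x \<otimes> commut G ?z k \<otimes> inv x \<in> \<Gamma> (Suc i)" using normal_conj(1)[OF normal_filt] z by simp
  have "commut G y k = commut G (x \<otimes> ?z) k" using z by (simp add: word_simps)
  also have "\<dots> = (x \<otimes> commut G ?z k \<otimes> inv x) \<otimes> commut G x k"
    using commut_mult_left z assms by simp
  finally have *: "commut G y k = (x \<otimes> commut G ?z k \<otimes> inv x) \<otimes> commut G x k" .
  have "inv (commut G x k) \<otimes> (x \<otimes> commut G ?z k \<otimes> inv x) \<otimes> commut G x k \<in> \<Gamma> (Suc i)"
    using normal_conj(2)[OF normal_filt _ w] z assms by simp
  then show ?thesis using z assms unfolding coset_eq_def * by (simp add: m_assoc)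
qed

text \<open>Half of the bilinearity of the commutator: modulo \<open>\<Gamma> (i + 2)\<close>
  conjugation acts trivially on \<open>\<Gamma> (i + 1)\<close>, so the commutator identities become
  additive in each argument.\<close>

lemma commut_pow_left:
  assumes "0 < i" "h \<in> \<Gamma> i" "k \<in> carrier G"
  shows "coset_eq G (\<Gamma> (Suc (Suc i))) (commut G h k [^] (a::nat)) (commut G (h [^] a) k)"
proof (induction a)
  case 0
  have "commut G \<one> k = \<one>" using assms by (simp add: commut_def)
  then show ?case using filt_refl by simp
next
  case (Suc a)
  let ?N = "\<Gamma> (Suc (Suc i))"
  have h: "h \<in> carrier G" "commut G h k \<in> \<Gamma> (Suc i)"
    using assms filt_commut[of h i k 1] filt_1 filt_in_carr by auto
  have "coset_eq G ?N (h [^] a \<otimes> commut G h k \<otimes> inv (h [^] a)) (commut G h k)"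
    using filt_conj[of "Suc i"] h by simp
  then have "coset_eq G ?N (commut G h k \<otimes> commut G h k [^] a)
     (h [^] a \<otimes> commut G h k \<otimes> inv (h [^] a) \<otimes> commut G (h [^] a) k)"
    by (rule filt_mult[OF filt_sym Suc])
  also have "h [^] a \<otimes> commut G h k \<otimes> inv (h [^] a) \<otimes> commut G (h [^] a) k = commut G (h [^] a \<otimes> h) k"
    using commut_mult_left h assms by simp
  finally show ?case using h assms nat_pow_Suc2[of "commut G h k"] by simp
qed

lemma commut_pow_right:
  assumes "0 < i" "h \<in> \<Gamma> i" "k \<in> carrier G"
  shows "coset_eq G (\<Gamma> (Suc (Suc i))) (commut G h k [^] (a::nat)) (commut G h (k [^] a))"
proof (induction a)
  case 0
  have "commut G h \<one> = \<one>" using assms filt_in_carr by (simp add: commut_def)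
  then show ?case using filt_refl by simp
next
  case (Suc a)
  let ?N = "\<Gamma> (Suc (Suc i))"
  have h: "h \<in> carrier G" "commut G h (k [^] a) \<in> \<Gamma> (Suc i)" "commut G h k \<in> carrier G"
    using assms filt_commut[of h i "k [^] a" 1] filt_1 filt_in_carr by auto
  have "coset_eq G ?N (k \<otimes> commut G h (k [^] a) \<otimes> inv k) (commut G h (k [^] a))"
    using filt_conj[of "Suc i"] h assms by simp
  then have "coset_eq G ?N (commut G h k [^] a) (k \<otimes> commut G h (k [^] a) \<otimes> inv k)"
    by (rule filt_trans[OF Suc filt_sym])
  then have "coset_eq G ?N (commut G h k \<otimes> commut G h k [^] a)
     (commut G h k \<otimes> (k \<otimes> commut G h (k [^] a) \<otimes> inv k))"
    by (rule filt_mult[OF filt_refl[OF h(3)]])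
  also have "(commut G h k \<otimes> (k \<otimes> commut G h (k [^] a) \<otimes> inv k)) = commut G h (k \<otimes> k [^] a)"
    using commut_mult_right h assms by simp
  finally show ?case using h assms by (simp only: nat_pow_Suc2)
qed

text \<open>The commutator identity \<open>[h, k] ^ (q * n + r) = [h ^ q, k ^ n] [h, k ^ r]\<close> modulo the next term
  turns a power of size \<open>n ^ (i + 1)\<close> into words of length \<open>O(n)\<close>.\<close>
lemma power_distortion:
  assumes "0 < i" "t \<in> \<Gamma> i"
  shows "\<exists>K. \<forall>n>0. \<forall>a\<le>n ^ i. \<exists>b\<in>B (K * n). coset_eq G (\<Gamma> (Suc i)) (t [^] (a::nat)) b"
  using assms
proof (induction i arbitrary: t rule: nat_induct_non_zero)
  case 1
  obtain m where m: "t \<in> B m" using in_some_ball filt_in_carr 1 by blast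
  have "t [^] a \<in> B (m * n) \<and> coset_eq G (\<Gamma> (Suc 1)) (t [^] a) (t [^] a)" if "a \<le> n ^ 1" for a n :: nat
  proof -
    have "a * m \<le> m * n" using that by simp
    then have "t [^] a \<in> B (m * n)" using ball_pow[OF m, of a] ball_mono[of "a * m" "m * n"] by blast
    then show ?thesis using filt_refl[OF ball_carr] by blast
  qed
  then show ?case by blast
next
  case (Suc i)
  let ?N = "\<Gamma> (Suc (Suc i))"
  let ?P = "\<lambda>t K. \<forall>n>0. \<forall>a\<le>n ^ Suc i. \<exists>b\<in>B (K * n). coset_eq G ?N (t [^] (a::nat)) b"
  have commut_case: "\<exists>K. ?P (commut G h k) K" if h: "h \<in> \<Gamma> i" and k: "k \<in> carrier G" for h k
  proof -
    obtain K where K: "\<And>n a. 0 < n \<Longrightarrow> a \<le> n ^ i \<Longrightarrow> \<exists>b\<in>B (K * n). coset_eq G (\<Gamma> (Suc i)) (h [^] (a::nat)) b"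
      using Suc.IH[OF h] by blast
    obtain m where m: "h \<in> B m" using in_some_ball[OF filt_in_carr[OF h]] by blast
    obtain l where l: "k \<in> B l" using in_some_ball[OF k] by blast
    have hc: "h \<in> carrier G" using h filt_in_carr by blast
    let ?t = "commut G h k"
    have tc: "?t \<in> carrier G" using hc k by simp
    have "\<exists>b\<in>B ((2*K + 2*l + 2*m + 2*l) * n). coset_eq G ?N (?t [^] a) b"
      if n: "0 < n" and a: "a \<le> n ^ Suc i" for n a :: nat
    proof -
      define q r where "q = a div n" and "r = a mod n"
      have qr: "a = q * n + r" "r < n" "q \<le> n ^ i"
        using n div_le_mono[OF a, of n] by (simp_all add: q_def r_def)
      obtain b where b: "b \<in> B (K * n)" "coset_eq G (\<Gamma> (Suc i)) (h [^] q) b" using K[OF n qr(3)] by blast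
      have bG: "b \<in> \<Gamma> i"
        by (rule coset_eq_memD[OF normal_filt b(2) _ filt_decr filt_subgroup])
          (rule subgroup_nat_pow_closed[OF filt_subgroup h])
      have "coset_eq G ?N (?t [^] q) (commut G (h [^] q) k)"
        using commut_pow_left Suc.hyps h k by blast
      also have "coset_eq G ?N \<dots> (commut G b k)" using commut_coset_eq[OF b(2) k] .
      finally have "coset_eq G ?N (?t [^] q) (commut G b k)" .
      from coset_eq_pow[OF normal_filt this]
      have "coset_eq G ?N ((?t [^] q) [^] n) (commut G b k [^] n)" .
      also have "coset_eq G ?N \<dots> (commut G b (k [^] n))"
        using commut_pow_right Suc.hyps bG k by blast
      finally have 1: "coset_eq G ?N ((?t [^] q) [^] n) (commut G b (k [^] n))" .
      have 2: "coset_eq G ?N (?t [^] r) (commut G h (k [^] r))"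
        using commut_pow_right Suc.hyps h k by blast
      have "(?t [^] q) [^] n \<otimes> ?t [^] r = ?t [^] a"
        using tc by (simp add: qr(1) nat_pow_pow nat_pow_mult)
      then have eq: "coset_eq G ?N (?t [^] a) (commut G b (k [^] n) \<otimes> commut G h (k [^] r))"
        using filt_mult[OF 1 2] by simp
      have "commut G b (k [^] n) \<otimes> commut G h (k [^] r) \<in> B (2 * (K * n) + 2 * (n * l) + (2 * m + 2 * (r * l)))"
        by (intro ball_mult ball_commut b m ball_pow l)
      moreover have "2 * (K * n) + 2 * (n * l) + (2 * m + 2 * (r * l)) \<le> (2*K + 2*l + 2*m + 2*l) * n"
      proof -
        have "m \<le> m * n" "r * l \<le> n * l" using n qr by simp_all
        then have "2 * (K * n) + 2 * (n * l) + (2 * m + 2 * (r * l))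
            \<le> 2 * (K * n) + 2 * (n * l) + (2 * (m * n) + 2 * (n * l))" by linarith
        also have "\<dots> = (2*K + 2*l + 2*m + 2*l) * n" by (simp add: algebra_simps)
        finally show ?thesis .
      qed
      ultimately have "commut G b (k [^] n) \<otimes> commut G h (k [^] r) \<in> B ((2*K + 2*l + 2*m + 2*l) * n)"
        using ball_mono by blast
      then show ?thesis using eq by blast
    qed
    then show ?thesis by blast
  qed
  have "t \<in> generate G {commut G h k | h k. h \<in> \<Gamma> i \<and> k \<in> carrier G}"
    using filt_gen Suc by simp
  \<comment> \<open>Membership in \<open>\<Gamma> (i + 1)\<close> is carried along the generation
    because the product step moves factors past each other modulo the next term.\<close>
  then have "t \<in> \<Gamma> (Suc i) \<and> (\<exists>K. ?P t K)"
  proof (induction rule: generate.induct)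
    case one
    have "?P \<one> 0" using ball_one filt_refl[OF one_closed] by (auto intro!: bexI[of _ \<one>])
    then show ?case using subgroup.one_closed[OF filt_subgroup] by iprover
  next
    case (incl x)
    then obtain h k where "x = commut G h k" "h \<in> \<Gamma> i" "k \<in> carrier G" by blast
    then show ?case using commut_case[of h k] filt_commut[of h i k 1] filt_1 by simp
  next
    case (inv x)
    then obtain h k where hk: "x = commut G h k" "h \<in> \<Gamma> i" "k \<in> carrier G" by blast
    then have x: "x \<in> \<Gamma> (Suc i)" using filt_commut[of h i k 1] filt_1 by simp
    then have xc: "x \<in> carrier G" using filt_in_carr by blast
    obtain K where K: "?P x K" using commut_case[of h k] hk by blast
    have "?P (inv x) K"
    proof (intro allI impI)
      fix n a :: nat assume "0 < n" "a \<le> n ^ Suc i"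
      then obtain b where b: "b \<in> B (K * n)" "coset_eq G ?N (x [^] a) b" using K by blast
      have "coset_eq G ?N (inv x [^] a) (inv b)"
        using coset_eq_inv[OF normal_filt b(2)] by (simp only: nat_pow_inv[OF xc])
      then show "\<exists>b\<in>B (K * n). coset_eq G ?N (inv x [^] a) b" using ball_inv[OF b(1)] by blast
    qed
    then show ?case using subgroup.m_inv_closed[OF filt_subgroup x] by iprover
  next
    case (eng x y)
    obtain K where K: "?P x K" using eng by blast
    obtain L where L: "?P y L" using eng by blast
    have c: "x \<in> carrier G" "y \<in> carrier G" using eng filt_in_carr by blast+
    have pow: "coset_eq G ?N ((x \<otimes> y) [^] a) (x [^] a \<otimes> y [^] a)" for a :: nat
    proof (induction a)
      case 0 then show ?case using filt_refl by simp
    next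
      case (Suc a)
      have "coset_eq G ?N ((x \<otimes> y) [^] a \<otimes> (x \<otimes> y)) (x [^] a \<otimes> y [^] a \<otimes> (x \<otimes> y))"
        by (rule filt_mult[OF Suc filt_refl]) (use c in simp)
      also have "x [^] a \<otimes> y [^] a \<otimes> (x \<otimes> y) = x [^] a \<otimes> (y [^] a \<otimes> x) \<otimes> y" using c by (simp add: m_assoc)
      also have "coset_eq G ?N \<dots> (x [^] a \<otimes> (x \<otimes> y [^] a) \<otimes> y)"
        by (rule filt_mult[OF filt_mult[OF filt_refl filt_central] filt_refl]) (use c eng in simp_all)
      also have "x [^] a \<otimes> (x \<otimes> y [^] a) \<otimes> y = x [^] Suc a \<otimes> y [^] Suc a" using c by (simp add: m_assoc)
      finally show ?case by simp
    qed
    have "?P (x \<otimes> y) (K + L)"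
    proof (intro allI impI)
      fix n a :: nat assume "0 < n" "a \<le> n ^ Suc i"
      then obtain b b' where b: "b \<in> B (K * n)" "coset_eq G ?N (x [^] a) b"
        "b' \<in> B (L * n)" "coset_eq G ?N (y [^] a) b'" using K[rule_format, of n a] L[rule_format, of n a] by auto
      have "coset_eq G ?N ((x \<otimes> y) [^] a) (b \<otimes> b')"
        by (rule filt_trans[OF pow filt_mult[OF b(2,4)]])
      moreover have "b \<otimes> b' \<in> B ((K + L) * n)" using ball_mult[OF b(1,3)] by (simp add: distrib_right)
      ultimately show "\<exists>b\<in>B ((K + L) * n). coset_eq G ?N ((x \<otimes> y) [^] a) b" by blast
    qed
    moreover have "x \<otimes> y \<in> \<Gamma> (Suc i)" by (rule subgroup.m_closed[OF filt_subgroup]) (use eng in simp_all)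
    ultimately show ?case by iprover
  qed
  then show ?case by blast
qed

lemma power_distortion_int:
  assumes "0 < i" "t \<in> \<Gamma> i"
  shows "\<exists>K. \<forall>n>0. \<forall>a::int. \<bar>a\<bar> \<le> int (n ^ i) \<longrightarrow> (\<exists>b\<in>B (K * n). coset_eq G (\<Gamma> (Suc i)) (t [^] a) b)"
proof -
  obtain K where K: "\<And>n a. 0 < n \<Longrightarrow> a \<le> n ^ i \<Longrightarrow> \<exists>b\<in>B (K * n). coset_eq G (\<Gamma> (Suc i)) (t [^] (a::nat)) b"
    using power_distortion[OF assms] by blast
  have tc: "t \<in> carrier G" using assms filt_in_carr by blast
  have "\<exists>b\<in>B (K * n). coset_eq G (\<Gamma> (Suc i)) (t [^] a) b" if n: "0 < n" and a: "\<bar>a\<bar> \<le> int (n ^ i)" for n and a :: int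
  proof -
    from a have "nat \<bar>a\<bar> \<le> n ^ i" by (metis nat_int nat_mono)
    from K[OF n this] obtain b where b: "b \<in> B (K * n)" "coset_eq G (\<Gamma> (Suc i)) (t [^] nat \<bar>a\<bar>) b" by blast
    show ?thesis
    proof (cases "0 \<le> a")
      case True
      then have "t [^] a = t [^] nat \<bar>a\<bar>" using int_pow_int[of G t "nat a"] by simp
      then show ?thesis using b by auto
    next
      case False
      then have "t [^] a = inv (t [^] nat \<bar>a\<bar>)"
        using int_pow_neg_int[OF tc, of "nat \<bar>a\<bar>"] by simp
      then show ?thesis using ball_inv[OF b(1)] coset_eq_inv[OF normal_filt b(2)] by metis
    qed
  qed
  then show ?thesis by blast
qed

end

section \<open>Commutator collection\<close>

text \<open>Base, weight and exponent of a letter. The weight is recorded and not computed: the base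
  lies in \<open>\<Gamma>\<close> of that index but may lie deeper, and all counts refer to the
  recorded value.\<close>

type_synonym 'a wletter = "'a \<times> nat \<times> int"

definition letter_val :: "('a, 'b) monoid_scheme \<Rightarrow> 'a wletter \<Rightarrow> 'a" where
  "letter_val G x = fst x [^]\<^bsub>G\<^esub> snd (snd x)"

abbreviation weight :: "'a wletter \<Rightarrow> nat" where "weight x \<equiv> fst (snd x)"

abbreviation word_val :: "('a, 'b) monoid_scheme \<Rightarrow> 'a wletter list \<Rightarrow> 'a" where
  "word_val G xs \<equiv> product_list G (map (letter_val G) xs)"

text \<open>The inverses are placed so that conjugating the \<open>q\<close>-th term
  \<open>y_q\<close> by \<open>t\<close> gives \<open>y_q y_(q+1)\<close>; conjugation by
  \<open>t ^ e\<close> then follows Pascal's triangle.\<close>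

primrec iter_commut :: "('a, 'b) monoid_scheme \<Rightarrow> 'a \<Rightarrow> 'a \<Rightarrow> nat \<Rightarrow> 'a" where
  "iter_commut G t y 0 = y"
| "iter_commut G t y (Suc q) = commut G (inv\<^bsub>G\<^esub> (iter_commut G t y q)) (inv\<^bsub>G\<^esub> t)"

text \<open>The entries of \<open>expos e\<close> are the exponents \<open>q\<close> of the iterated commutators
  \<open>[y, t, \<dots>, t]\<close> that multiply up to the conjugate of \<open>y\<close> by \<open>t ^ e\<close>; each \<open>q\<close> occurs
  \<open>e choose q\<close> times.\<close>
primrec expos :: "nat \<Rightarrow> nat list" where
  "expos 0 = [0]"
| "expos (Suc e) = concat (map (\<lambda>q. [q, Suc q]) (expos e))"

lemma expos_Cons: "\<exists>V. expos e = 0 # V \<and> 0 \<notin> set V"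
  by (induction e) auto

lemma count_list_expos_Suc:
  "count_list (expos (Suc e)) q = count_list (expos e) q + (if q = 0 then 0 else count_list (expos e) (q - 1))"
proof -
  have "count_list (concat (map (\<lambda>q. [q, Suc q]) xs)) q = count_list xs q + (if q = 0 then 0 else count_list xs (q - 1))"
    for xs by (induction xs) auto
  then show ?thesis by simp
qed

text \<open>A binomial coefficient is at most a power. With \<open>e\<close> of order
  \<open>n ^ i\<close> this allows \<open>n ^ (i * q)\<close> letters whose weight is raised by
  \<open>i * q\<close>, exactly the rate that weighted words can afford.\<close>

lemma count_list_expos: "count_list (expos e) q \<le> e ^ q"
proof (induction e arbitrary: q)
  case 0 then show ?case by simp
next
  case (Suc e)
  show ?case
  proof (cases q)
    case 0 then show ?thesis using Suc[of 0] count_list_expos_Suc[of e 0] by simp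
  next
    case (Suc p)
    have "count_list (expos (Suc e)) q = count_list (expos e) q + count_list (expos e) p"
      using count_list_expos_Suc[of e q] Suc by simp
    also have "\<dots> \<le> e ^ q + e ^ p" by (intro add_mono Suc.IH)
    also have "\<dots> = Suc e * e ^ p" using Suc by simp
    also have "\<dots> \<le> Suc e * Suc e ^ p" by (intro mult_le_mono2 power_mono) auto
    finally show ?thesis using Suc by simp
  qed
qed

context group
begin

lemma iter_commut_closed [simp]: "t \<in> carrier G \<Longrightarrow> y \<in> carrier G \<Longrightarrow> iter_commut G t y q \<in> carrier G"
  by (induction q) auto

lemma conj_iter_commut:
  assumes "t \<in> carrier G" "y \<in> carrier G"
  shows "inv t \<otimes> iter_commut G t y q \<otimes> t = iter_commut G t y q \<otimes> iter_commut G t y (Suc q)"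
  using assms by (simp add: commut_def word_simps)

lemma conj_nat_pow_eq:
  assumes "t \<in> carrier G" "y \<in> carrier G"
  shows "inv (t [^] (e::nat)) \<otimes> y \<otimes> t [^] e = product_list G (map (iter_commut G t y) (expos e))"
proof (induction e)
  case 0 then show ?case using assms by simp
next
  case (Suc e)
  have *: "inv t \<otimes> product_list G (map (iter_commut G t y) xs) \<otimes> t
     = product_list G (map (iter_commut G t y) (concat (map (\<lambda>q. [q, Suc q]) xs)))" for xs
  proof (induction xs)
    case Nil then show ?case using assms by simp
  next
    case (Cons q xs)
    let ?p = "\<lambda>xs. product_list G (map (iter_commut G t y) xs)"
    have c: "?p xs \<in> carrier G" for xs using assms by (intro product_list_closed) auto
    have "inv t \<otimes> ?p (q # xs) \<otimes> t = (inv t \<otimes> iter_commut G t y q \<otimes> t) \<otimes> (inv t \<otimes> ?p xs \<otimes> t)"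
      using c assms by (simp add: word_simps)
    also have "\<dots> = iter_commut G t y q \<otimes> (iter_commut G t y (Suc q) \<otimes> ?p (concat (map (\<lambda>q. [q, Suc q]) xs)))"
      unfolding Cons conj_iter_commut[OF assms] using c assms by (simp add: m_assoc del: iter_commut.simps)
    finally show ?case by simp
  qed
  have "inv (t [^] Suc e) \<otimes> y \<otimes> t [^] Suc e = inv t \<otimes> (inv (t [^] e) \<otimes> y \<otimes> t [^] e) \<otimes> t"
    using assms by (simp add: word_simps)
  also have "\<dots> = product_list G (map (iter_commut G t y) (expos (Suc e)))"
    unfolding Suc * by simp
  finally show ?case .
qed

lemma product_list_filter:
  assumes "\<And>x. x \<in> set xs \<Longrightarrow> f x \<in> carrier G" "\<And>x. x \<in> set xs \<Longrightarrow> \<not> P x \<Longrightarrow> f x = \<one>"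
  shows "product_list G (map f (filter P xs)) = product_list G (map f xs)"
  using assms
proof (induction xs)
  case (Cons x xs)
  then have "product_list G (map f xs) \<in> carrier G" by (intro product_list_closed) auto
  with Cons show ?case by auto
qed simp

end

section \<open>Exponent sums, letter counts and the collection of one letter\<close>

definition signed_count :: "nat \<Rightarrow> 'a \<Rightarrow> 'a wletter list \<Rightarrow> int" where
  "signed_count i t xs = sum_list (map (\<lambda>x. if fst x = t \<and> weight x = i then snd (snd x) else 0) xs)"

lemma signed_count_simps [simp]:
  "signed_count i t [] = 0"
  "signed_count i t (x # xs) = (if fst x = t \<and> weight x = i then snd (snd x) else 0) + signed_count i t xs"
  "signed_count i t (xs @ ys) = signed_count i t xs + signed_count i t ys"
  by (simp_all add: signed_count_def)

definition count_weight :: "nat \<Rightarrow> 'a wletter list \<Rightarrow> nat" where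
  "count_weight m xs = length (filter (\<lambda>x. weight x = m) xs)"

lemma count_weight_simps [simp]:
  "count_weight m [] = 0"
  "count_weight m (x # xs) = (if weight x = m then 1 else 0) + count_weight m xs"
  "count_weight m (xs @ ys) = count_weight m xs + count_weight m ys"
  by (simp_all add: count_weight_def)

lemma sum_list_by_weight:
  "sum_list (map (\<lambda>x. if weight x \<le> m then f (weight x) else (0::nat)) xs) = (\<Sum>l\<le>m. count_weight l xs * f l)"
proof (induction xs)
  case (Cons x xs)
  have "(\<Sum>l\<le>m. count_weight l (x # xs) * f l) =
    (\<Sum>l\<le>m. (if l = weight x then f l else 0)) + (\<Sum>l\<le>m. count_weight l xs * f l)"
    unfolding sum.distrib[symmetric] by (intro sum.cong) (auto simp: algebra_simps)
  then show ?case using Cons by simp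
qed simp

lemma length_filter_mono: "(\<And>x. P x \<Longrightarrow> Q x) \<Longrightarrow> length (filter P xs) \<le> length (filter Q xs)"
  by (induction xs) (auto simp: le_SucI)

context nilpotent_filtration
begin

text \<open>A word for the conjugate of the letter \<open>x\<close> by \<open>t ^ e\<close>. Terms
  of weight above \<open>c\<close> are trivial and dropped, a negative \<open>e\<close> is served by
  the inverse of \<open>t\<close>, and the entry \<open>q = 0\<close> is kept as \<open>x\<close>
  itself so that its base and exponent survive.\<close>

definition conj_word :: "nat \<Rightarrow> 'a \<Rightarrow> 'a wletter \<Rightarrow> int \<Rightarrow> 'a wletter list" where
  "conj_word i t x e =
    map (\<lambda>q. if q = 0 then x else (iter_commut G (if 0 \<le> e then t else inv t) (letter_val G x) q, weight x + q * i, 1))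
      (filter (\<lambda>q. weight x + q * i \<le> c) (expos (nat \<bar>e\<bar>)))"

text \<open>Moves every occurrence of \<open>t\<close> to the front, using
  \<open>x t^e = t^e (t^-e x t^e)\<close> with \<open>e\<close> the sum of the exponents of
  \<open>t\<close> to the right of \<open>x\<close>; the powers of \<open>t\<close> themselves are
  left out of the result.\<close>

primrec collect :: "nat \<Rightarrow> 'a \<Rightarrow> 'a wletter list \<Rightarrow> 'a wletter list" where
  "collect i t [] = []"
| "collect i t (x # xs) =
    (if fst x = t \<and> weight x = i then collect i t xs
     else conj_word i t x (signed_count i t xs) @ collect i t xs)"

lemma iter_commut_filt:
  "t \<in> \<Gamma> i \<Longrightarrow> y \<in> \<Gamma> l \<Longrightarrow> iter_commut G t y q \<in> \<Gamma> (l + q * i)"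
proof (induction q)
  case (Suc q)
  have "commut G (inv (iter_commut G t y q)) (inv t) \<in> \<Gamma> ((l + q * i) + i)"
    by (intro filt_commut subgroup.m_inv_closed[OF filt_subgroup]) (use Suc in auto)
  then show ?case by (simp add: add_ac)
qed simp

lemma letter_val_filt: "fst x \<in> \<Gamma> (weight x) \<Longrightarrow> letter_val G x \<in> \<Gamma> (weight x)"
  unfolding letter_val_def by (rule subgroup_int_pow_closed[OF filt_subgroup])

lemma letter_val_carr: "fst x \<in> \<Gamma> (weight x) \<Longrightarrow> letter_val G x \<in> carrier G"
  using letter_val_filt filt_in_carr by blast

lemma word_val_carr: "\<forall>x\<in>set xs. fst x \<in> \<Gamma> (weight x) \<Longrightarrow> word_val G xs \<in> carrier G"
  by (intro product_list_closed) (auto simp: letter_val_carr)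

lemma word_val_conj_word:
  assumes x: "fst x \<in> \<Gamma> (weight x)" "weight x \<le> c" and t: "t \<in> \<Gamma> i"
  shows "word_val G (conj_word i t x e) = inv (t [^] e) \<otimes> letter_val G x \<otimes> t [^] e"
proof -
  define s where "s = (if 0 \<le> e then t else inv t)"
  have s: "s \<in> \<Gamma> i" using t subgroup.m_inv_closed[OF filt_subgroup] by (simp add: s_def)
  have sc: "s \<in> carrier G" and tc: "t \<in> carrier G" using s t filt_in_carr by blast+
  have v: "letter_val G x \<in> \<Gamma> (weight x)" using letter_val_filt x by blast
  then have vc: "letter_val G x \<in> carrier G" using filt_in_carr by blast
  have pow: "t [^] e = s [^] nat \<bar>e\<bar>"
  proof (cases "0 \<le> e")
    case True then show ?thesis using int_pow_int[of G t "nat e"] by (simp add: s_def)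
  next
    case False
    then have "t [^] e = inv (t [^] nat \<bar>e\<bar>)" using int_pow_neg_int[OF tc, of "nat \<bar>e\<bar>"] by simp
    then show ?thesis using False tc int_pow_inv by (simp add: s_def nat_pow_inv)
  qed
  let ?f = "iter_commut G s (letter_val G x)"
  have "word_val G (conj_word i t x e) = product_list G (map ?f (filter (\<lambda>q. weight x + q * i \<le> c) (expos (nat \<bar>e\<bar>))))"
    unfolding conj_word_def s_def[symmetric] map_map
    by (intro arg_cong[of _ _ "product_list G"] map_cong)
      (use sc vc in \<open>auto simp: letter_val_def\<close>)
  also have "\<dots> = product_list G (map ?f (expos (nat \<bar>e\<bar>)))"
  proof (rule product_list_filter)
    fix q show "?f q \<in> carrier G" using sc vc by simp
    assume "\<not> weight x + q * i \<le> c"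
    then show "?f q = \<one>" by (intro filt_gt_c[OF _ iter_commut_filt[OF s v]]) simp
  qed
  also have "\<dots> = inv (t [^] e) \<otimes> letter_val G x \<otimes> t [^] e"
    unfolding pow by (rule conj_nat_pow_eq[OF sc vc, symmetric])
  finally show ?thesis .
qed

lemma conj_word_filt:
  assumes "fst x \<in> \<Gamma> (weight x)" "t \<in> \<Gamma> i" "y \<in> set (conj_word i t x e)"
  shows "fst y \<in> \<Gamma> (weight y)"
proof -
  have "inv t \<in> \<Gamma> i" using assms subgroup.m_inv_closed[OF filt_subgroup] by blast
  then show ?thesis
    using assms iter_commut_filt[OF _ letter_val_filt[OF assms(1)]] by (auto simp: conj_word_def split: if_splits)
qed

lemma collect_filt:
  "\<forall>x\<in>set xs. fst x \<in> \<Gamma> (weight x) \<Longrightarrow> t \<in> \<Gamma> i \<Longrightarrow> \<forall>y\<in>set (collect i t xs). fst y \<in> \<Gamma> (weight y)"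
proof (induction xs)
  case (Cons x xs)
  then show ?case using conj_word_filt[of x t i] by auto
qed simp

lemma word_val_collect:
  assumes "t \<in> \<Gamma> i" "\<forall>x\<in>set xs. fst x \<in> \<Gamma> (weight x) \<and> weight x \<le> c"
  shows "word_val G xs = t [^] signed_count i t xs \<otimes> word_val G (collect i t xs)"
  using assms(2)
proof (induction xs)
  case Nil then show ?case by simp
next
  case (Cons x xs)
  have tc: "t \<in> carrier G" using assms filt_in_carr by blast
  have xc: "letter_val G x \<in> carrier G" using Cons letter_val_carr by simp
  have W: "word_val G (collect i t xs) \<in> carrier G"
    by (rule word_val_carr[OF collect_filt[OF _ assms(1)]]) (use Cons in simp)
  have IH: "word_val G xs = t [^] signed_count i t xs \<otimes> word_val G (collect i t xs)" using Cons by simp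
  show ?case
  proof (cases "fst x = t \<and> weight x = i")
    case True
    then have "letter_val G x = t [^] snd (snd x)" by (simp add: letter_val_def)
    then show ?thesis using True IH tc W by (simp add: int_pow_mult m_assoc)
  next
    case False
    let ?e = "signed_count i t xs"
    have C: "\<forall>y\<in>set (conj_word i t x ?e). fst y \<in> \<Gamma> (weight y)"
      using conj_word_filt[of x t i] Cons assms by simp
    have D: "\<forall>y\<in>set (collect i t xs). fst y \<in> \<Gamma> (weight y)"
      by (rule collect_filt[OF _ assms(1)]) (use Cons in simp)
    have "word_val G (conj_word i t x ?e @ collect i t xs)
       = word_val G (conj_word i t x ?e) \<otimes> word_val G (collect i t xs)"
      unfolding map_append by (rule product_list_append; unfold set_map;
        intro image_subsetI letter_val_carr) (use C D in blast)+
    also have "word_val G (conj_word i t x ?e) = inv (t [^] ?e) \<otimes> letter_val G x \<otimes> t [^] ?e"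
      using word_val_conj_word Cons assms by simp
    finally have eq: "word_val G (conj_word i t x ?e @ collect i t xs) =
        inv (t [^] ?e) \<otimes> letter_val G x \<otimes> t [^] ?e \<otimes> word_val G (collect i t xs)" .
    have sc: "signed_count i t (x # xs) = ?e" "collect i t (x # xs) = conj_word i t x ?e @ collect i t xs"
      using False by auto
    have "word_val G (x # xs) = letter_val G x \<otimes> (t [^] ?e \<otimes> word_val G (collect i t xs))"
      using IH by simp
    also have "\<dots> = t [^] ?e \<otimes> (inv (t [^] ?e) \<otimes> letter_val G x \<otimes> t [^] ?e \<otimes> word_val G (collect i t xs))"
      using tc xc W by (simp add: word_simps)
    finally show ?thesis unfolding sc eq .
  qed
qed

lemma conj_word_Cons:
  assumes "weight x \<le> c"
  shows "\<exists>V. conj_word i t x e = x # V \<and> (\<forall>y\<in>set V. weight x + i \<le> weight y \<and> weight y \<le> c \<and> snd (snd y) = 1 \<and>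
     (\<exists>q\<in>{1..}. weight y = weight x + q * i \<and> (\<exists>s\<in>{t, inv t}. fst y = iter_commut G s (letter_val G x) q)))"
proof -
  obtain V where V: "expos (nat \<bar>e\<bar>) = 0 # V" "0 \<notin> set V" using expos_Cons by blast
  show ?thesis unfolding conj_word_def V(1)
    using assms V(2) by (auto simp: Suc_le_eq)
qed

lemma signed_count_ge: "\<forall>y\<in>set V. weight y \<noteq> i \<Longrightarrow> signed_count i t V = 0"
  by (induction V) auto

text \<open>Letters created by conjugation weigh at least \<open>2 * i > i\<close>, so they do not
  disturb the exponents of the other letters of weight \<open>i\<close>.\<close>

lemma signed_count_collect:
  assumes "0 < i" "s \<noteq> t" "\<forall>x\<in>set xs. i \<le> weight x \<and> weight x \<le> c"
  shows "signed_count i s (collect i t xs) = signed_count i s xs"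
  using assms(3)
proof (induction xs)
  case (Cons x xs)
  show ?case
  proof (cases "fst x = t \<and> weight x = i")
    case True then show ?thesis using Cons assms by auto
  next
    case False
    obtain V where V: "conj_word i t x (signed_count i t xs) = x # V" "\<forall>y\<in>set V. weight x + i \<le> weight y"
      using conj_word_Cons[of x i t "signed_count i t xs"] Cons by auto
    then have "signed_count i s V = 0" using assms Cons by (intro signed_count_ge) force
    then show ?thesis using Cons V False assms(2) by auto
  qed
qed simp

text \<open>A letter of weight \<open>m\<close> can come only from the entries \<open>q\<close> with
  \<open>q * i = m - weight x\<close>, and their number is a binomial coefficient.\<close>

lemma count_weight_conj_word:
  assumes "0 < i"
  shows "count_weight m (conj_word i t x e) \<le>
    (if weight x \<le> m then (if m \<le> c then nat \<bar>e\<bar> ^ ((m - weight x) div i) else 0) else 0)"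
proof -
  let ?l = "weight x"
  have "count_weight m (conj_word i t x e) = length (filter (\<lambda>q. ?l + q * i = m \<and> ?l + q * i \<le> c) (expos (nat \<bar>e\<bar>)))"
    unfolding count_weight_def conj_word_def filter_map length_map filter_filter
    by (intro arg_cong[of _ _ length] filter_cong) auto
  moreover have "length (filter (\<lambda>q. ?l + q * i = m \<and> ?l + q * i \<le> c) (expos (nat \<bar>e\<bar>))) \<le>
     (if ?l \<le> m then (if m \<le> c then count_list (expos (nat \<bar>e\<bar>)) ((m - ?l) div i) else 0) else 0)"
  proof (cases "?l \<le> m \<and> m \<le> c")
    case True
    then show ?thesis unfolding count_list_eq_length_filter
      using assms by (auto intro!: length_filter_mono)
  next
    case False
    then have "filter (\<lambda>q. ?l + q * i = m \<and> ?l + q * i \<le> c) (expos (nat \<bar>e\<bar>)) = []"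
      by (auto simp: filter_empty_conv)
    then show ?thesis by simp
  qed
  ultimately have "count_weight m (conj_word i t x e) \<le>
     (if ?l \<le> m then (if m \<le> c then count_list (expos (nat \<bar>e\<bar>)) ((m - ?l) div i) else 0) else 0)"
    by simp
  also have "\<dots> \<le> (if ?l \<le> m then (if m \<le> c then nat \<bar>e\<bar> ^ ((m - ?l) div i) else 0) else 0)"
    using count_list_expos by simp
  finally show ?thesis .
qed

lemma abs_signed_count:
  "\<forall>x\<in>set xs. \<bar>snd (snd x)\<bar> \<le> 1 \<Longrightarrow> \<bar>signed_count i t xs\<bar> \<le> int (count_weight i xs)"
  by (induction xs) auto

lemma count_weight_collect:
  assumes "0 < i" "\<forall>x\<in>set xs. \<bar>snd (snd x)\<bar> \<le> 1" "count_weight i xs \<le> E"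
  shows "count_weight m (collect i t xs) \<le>
    sum_list (map (\<lambda>x. if weight x \<le> m then (if m \<le> c then E ^ ((m - weight x) div i) else 0) else 0) xs)"
  using assms(2,3)
proof (induction xs)
  case (Cons x xs)
  have "\<bar>signed_count i t xs\<bar> \<le> int E" using abs_signed_count[of xs i t] Cons by simp
  then have "nat \<bar>signed_count i t xs\<bar> \<le> E" by simp
  then have "nat \<bar>signed_count i t xs\<bar> ^ d \<le> E ^ d" for d by (intro power_mono) auto
  then have "count_weight m (conj_word i t x (signed_count i t xs)) \<le>
     (if weight x \<le> m then (if m \<le> c then E ^ ((m - weight x) div i) else 0) else 0)"
    using count_weight_conj_word[OF assms(1), of m t x "signed_count i t xs"] order_trans by fastforce
  moreover have "count_weight m (collect i t (x # xs)) \<le>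
      count_weight m (conj_word i t x (signed_count i t xs)) + count_weight m (collect i t xs)"
    by simp
  moreover have "count_weight m (collect i t xs) \<le>
    sum_list (map (\<lambda>x. if weight x \<le> m then (if m \<le> c then E ^ ((m - weight x) div i) else 0) else 0) xs)"
    using Cons by simp
  ultimately show ?case unfolding list.map sum_list.Cons by linarith
qed simp

section \<open>Words with polynomially many letters of each weight\<close>

definition alphabet :: "nat \<Rightarrow> ('a \<times> nat) set \<Rightarrow> bool" where
  "alphabet i A \<longleftrightarrow> finite A \<and> (\<forall>(y, l)\<in>A. y \<in> \<Gamma> l \<and> i \<le> l \<and> l \<le> c)"

text \<open>The shape of an element of length \<open>n\<close>: a letter of weight \<open>m\<close>
  costs \<open>1 / n ^ (m - 1)\<close> of a generator, so to speak. This is the invariant of the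
  collection; its constants may grow from step to step but never with \<open>n\<close>.\<close>

definition weighted_word :: "('a \<times> nat) set \<Rightarrow> nat \<Rightarrow> nat \<Rightarrow> 'a wletter list \<Rightarrow> bool" where
  "weighted_word A K n xs \<longleftrightarrow>
    (\<forall>x\<in>set xs. (fst x, weight x) \<in> A \<and> snd (snd x) \<in> {1, -1}) \<and> (\<forall>m. count_weight m xs \<le> K * n ^ m)"

lemma weighted_wordD:
  assumes "alphabet i A" "weighted_word A K n xs" "x \<in> set xs"
  shows "fst x \<in> \<Gamma> (weight x)" "i \<le> weight x" "weight x \<le> c" "\<bar>snd (snd x)\<bar> \<le> 1"
  using assms by (auto simp: alphabet_def weighted_word_def)

text \<open>Each of the \<open>O(n ^ l)\<close> letters of weight \<open>l\<close> is conjugated by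
  a power with exponent \<open>O(n ^ i)\<close> and so emits \<open>O(n ^ (i * q))\<close> letters
  of weight \<open>m = l + q * i\<close>, in all \<open>O(n ^ m)\<close>. At most
  \<open>c + 1\<close> weights \<open>l\<close> contribute.\<close>

lemma count_weight_collect_word:
  assumes i: "0 < i" and n: "0 < n" and A: "alphabet i A" and w: "weighted_word A K n xs"
  shows "count_weight m (collect i t xs) \<le> (Suc c * Suc K ^ Suc c) * n ^ m"
proof -
  \<comment> \<open>\<open>Suc K\<close> in place of \<open>K\<close> keeps the base at least one,
    so its powers can be enlarged to the exponent \<open>c\<close>.\<close>
  let ?E = "Suc K * n ^ i"
  have cw: "count_weight l xs \<le> Suc K * n ^ l" for l
    using w by (auto simp: weighted_word_def intro: order_trans)
  have "count_weight m (collect i t xs) \<le>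
    sum_list (map (\<lambda>x. if weight x \<le> m then (if m \<le> c then ?E ^ ((m - weight x) div i) else 0) else 0) xs)"
    using count_weight_collect[OF i _ cw] weighted_wordD(4)[OF A w] by blast
  also have "\<dots> = (\<Sum>l\<le>m. count_weight l xs * (if m \<le> c then ?E ^ ((m - l) div i) else 0))"
    by (rule sum_list_by_weight)
  also have "\<dots> \<le> (\<Sum>l\<le>m. if m \<le> c then Suc K ^ Suc c * n ^ m else 0)"
  proof (intro sum_mono)
    fix l assume l: "l \<in> {..m}"
    show "count_weight l xs * (if m \<le> c then ?E ^ ((m - l) div i) else 0) \<le> (if m \<le> c then Suc K ^ Suc c * n ^ m else 0)"
    proof (cases "m \<le> c")
      case True
      let ?d = "(m - l) div i"
      have d: "?d \<le> c" "i * ?d \<le> m - l" using True by (auto intro: order_trans[OF div_le_dividend])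
      have "?E ^ ?d = Suc K ^ ?d * n ^ (i * ?d)" by (simp only: power_mult_distrib power_mult)
      also have "\<dots> \<le> Suc K ^ c * n ^ (m - l)"
        using d n by (intro mult_le_mono power_increasing) auto
      finally have "count_weight l xs * ?E ^ ?d \<le> (Suc K * n ^ l) * (Suc K ^ c * n ^ (m - l))"
        by (intro mult_le_mono cw)
      also have "\<dots> = Suc K ^ Suc c * n ^ (l + (m - l))" by (simp only: power_add power_Suc mult_ac)
      finally show ?thesis using True l by simp
    qed simp
  qed
  also have "\<dots> \<le> (Suc c * Suc K ^ Suc c) * n ^ m"
  proof (cases "m \<le> c")
    case True
    have "(\<Sum>l\<le>m. if m \<le> c then Suc K ^ Suc c * n ^ m else 0) = Suc m * (Suc K ^ Suc c * n ^ m)"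
      using True by (simp del: power_Suc)
    also have "\<dots> \<le> Suc c * (Suc K ^ Suc c * n ^ m)" using True by (intro mult_le_mono1) simp
    finally show ?thesis by (simp only: mult.assoc)
  qed simp
  finally show ?thesis .
qed

text \<open>All letters that collecting \<open>t\<close> can leave, independently of the word and of
  \<open>n\<close>. The range \<open>q <= c\<close> is exhaustive, since for positive
  \<open>i\<close> the number \<open>q\<close> is at most the new weight.\<close>

definition collect_alphabet :: "nat \<Rightarrow> 'a \<Rightarrow> ('a \<times> nat) set \<Rightarrow> ('a \<times> nat) set" where
  "collect_alphabet i t A = (A - {(t, i)}) \<union>
     {z \<in> (\<lambda>((y, l), s, e, q). (iter_commut G s (y [^] (e::int)) q, l + q * i)) ` (A \<times> {t, inv t} \<times> {1, -1} \<times> {1..c}). snd z \<le> c}"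

lemma alphabet_collect:
  assumes i: "0 < i" and A: "alphabet i A" and t: "t \<in> \<Gamma> i"
  shows "alphabet i (collect_alphabet i t A)" "{y. (y, i) \<in> collect_alphabet i t A} = {y. (y, i) \<in> A} - {t}"
proof -
  have st: "s \<in> \<Gamma> i" if "s \<in> {t, inv t}" for s
    using that t subgroup.m_inv_closed[OF filt_subgroup] by auto
  have new: "iter_commut G s (y [^] (e::int)) q \<in> \<Gamma> (l + q * i)" if "(y, l) \<in> A" "s \<in> {t, inv t}" for s y e q l
    using that A subgroup_int_pow_closed[OF filt_subgroup] by (intro iter_commut_filt st) (auto simp: alphabet_def)
  show "alphabet i (collect_alphabet i t A)"
    using A new unfolding alphabet_def collect_alphabet_def
    by (fastforce intro: trans_le_add1)
  have "i < l + q * i" if "(y, l) \<in> A" "1 \<le> q" for y l and q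
  proof -
    have "i \<le> l" "0 < q * i" using that A i by (auto simp: alphabet_def)
    then show ?thesis by linarith
  qed
  then show "{y. (y, i) \<in> collect_alphabet i t A} = {y. (y, i) \<in> A} - {t}"
    unfolding collect_alphabet_def by fastforce
qed

lemma weighted_word_collect:
  assumes i: "0 < i" and n: "0 < n" and A: "alphabet i A" and w: "weighted_word A K n xs"
  shows "weighted_word (collect_alphabet i t A) (Suc c * Suc K ^ Suc c) n (collect i t xs)"
proof -
  have "\<forall>x\<in>set (collect i t ys). (fst x, weight x) \<in> collect_alphabet i t A \<and> snd (snd x) \<in> {1, -1}"
    if "set ys \<subseteq> set xs" for ys using that
  proof (induction ys)
    case (Cons x ys)
    then have x: "(fst x, weight x) \<in> A" "snd (snd x) \<in> {1, -1}" "weight x \<le> c"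
      using w weighted_wordD[OF A w] by (auto simp: weighted_word_def)
    show ?case
    proof (cases "fst x = t \<and> weight x = i")
      case True then show ?thesis using Cons by simp
    next
      case False
      obtain V where V: "conj_word i t x (signed_count i t ys) = x # V"
        "\<forall>y\<in>set V. weight x + i \<le> weight y \<and> weight y \<le> c \<and> snd (snd y) = 1 \<and>
     (\<exists>q\<in>{1..}. weight y = weight x + q * i \<and> (\<exists>s\<in>{t, inv t}. fst y = iter_commut G s (letter_val G x) q))"
        using conj_word_Cons[OF x(3), of i t "signed_count i t ys"] by blast
      have "(fst y, weight y) \<in> collect_alphabet i t A" if "y \<in> set V" for y
      proof -
        have yc: "weight y \<le> c" and "\<exists>q\<in>{1..}. weight y = weight x + q * i \<and>
            (\<exists>s\<in>{t, inv t}. fst y = iter_commut G s (letter_val G x) q)"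
          using V(2) \<open>y \<in> set V\<close> by blast+
        then obtain q where "q \<in> {1..}" and wy: "weight y = weight x + q * i"
          and "\<exists>s\<in>{t, inv t}. fst y = iter_commut G s (letter_val G x) q" by blast
        then obtain s where "s \<in> {t, inv t}" "fst y = iter_commut G s (letter_val G x) q" by blast
        with \<open>q \<in> {1..}\<close> wy yc have q: "1 \<le> q" "weight y = weight x + q * i" "s \<in> {t, inv t}"
          "fst y = iter_commut G s (letter_val G x) q" "weight y \<le> c" by simp_all
        have "q \<le> q * i" using i by simp
        then have "q \<le> c" using q by linarith
        then have "((fst x, weight x), s, snd (snd x), q) \<in> A \<times> {t, inv t} \<times> {1, -1} \<times> {1..c}"
          using x q by simp
        moreover have "(fst y, weight y) = (\<lambda>((y, l), s, e, q). (iter_commut G s (y [^] (e::int)) q, l + q * i))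
            ((fst x, weight x), s, snd (snd x), q)" using q by (simp add: letter_val_def)
        ultimately have "(fst y, weight y) \<in> (\<lambda>((y, l), s, e, q). (iter_commut G s (y [^] (e::int)) q, l + q * i))
            ` (A \<times> {t, inv t} \<times> {1, -1} \<times> {1..c})" by (rule rev_image_eqI)
        then show ?thesis unfolding collect_alphabet_def using q(5)
          by (intro UnI2 CollectI conjI) simp_all
      qed
      moreover have "(fst x, weight x) \<in> collect_alphabet i t A" using x False by (auto simp: collect_alphabet_def)
      ultimately show ?thesis using Cons V x False by auto
    qed
  qed simp
  then show ?thesis using count_weight_collect_word[OF assms] unfolding weighted_word_def by blast
qed

text \<open>Collects the letters of weight \<open>i\<close> one after the other. Each round removes
  its letter from the alphabet, adds only heavier ones and leaves the exponents of the remaining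
  letters of weight \<open>i\<close> alone; so all exponents can be read off the original
  word.\<close>

lemma collect_all:
  assumes "0 < i" "distinct ts" "set ts = {y. (y, i) \<in> A}" "alphabet i A"
  shows "\<exists>A' K'. alphabet (Suc i) A' \<and> (\<forall>n>0. \<forall>xs. weighted_word A K n xs \<longrightarrow>
    (\<exists>xs'. weighted_word A' K' n xs' \<and>
      word_val G xs = product_list G (map (\<lambda>t. t [^] signed_count i t xs) ts) \<otimes> word_val G xs'))"
  using assms(2-4)
proof (induction ts arbitrary: A K)
  case Nil
  then have "i \<noteq> l" if "(y, l) \<in> A" for y l using that by auto
  then have "alphabet (Suc i) A" using Nil unfolding alphabet_def by (fastforce simp: Suc_le_eq order_le_less)
  moreover have "word_val G xs \<in> carrier G" if "weighted_word A K n xs" for n xs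
    using word_val_carr weighted_wordD(1)[OF Nil(3) that] by blast
  ultimately show ?case by (intro exI[of _ A] exI[of _ K]) auto
next
  case (Cons t ts)
  let ?A = "collect_alphabet i t A" and ?K = "Suc c * Suc K ^ Suc c"
  have t: "t \<in> \<Gamma> i" "set ts = {y. (y, i) \<in> A} - {t}" using Cons by (auto simp: alphabet_def)
  have p: "distinct ts" "set ts = {y. (y, i) \<in> ?A}" "alphabet i ?A"
    using Cons.prems alphabet_collect[OF assms(1) Cons.prems(3) t(1)] t(2) by simp_all
  obtain A' K' where A': "alphabet (Suc i) A'" and K': "\<And>n xs. 0 < n \<Longrightarrow> weighted_word ?A ?K n xs \<Longrightarrow>
    (\<exists>xs'. weighted_word A' K' n xs' \<and>
      word_val G xs = product_list G (map (\<lambda>t. t [^] signed_count i t xs) ts) \<otimes> word_val G xs')"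
    using Cons.IH[OF p, of ?K] by blast
  have "\<exists>xs'. weighted_word A' K' n xs' \<and>
      word_val G xs = product_list G (map (\<lambda>t. t [^] signed_count i t xs) (t # ts)) \<otimes> word_val G xs'"
    if n: "0 < n" and w: "weighted_word A K n xs" for n xs
  proof -
    obtain xs' where xs': "weighted_word A' K' n xs'" "word_val G (collect i t xs) =
      product_list G (map (\<lambda>s. s [^] signed_count i s (collect i t xs)) ts) \<otimes> word_val G xs'"
      using K'[OF n weighted_word_collect[OF assms(1) n Cons.prems(3) w]] by blast
    have eq: "map (\<lambda>s. s [^] signed_count i s (collect i t xs)) ts = map (\<lambda>s. s [^] signed_count i s xs) ts"
    proof (rule map_cong[OF refl])
      fix s assume "s \<in> set ts"
      then have "s \<noteq> t" using Cons.prems(1) by auto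
      moreover have "\<forall>x\<in>set xs. i \<le> weight x \<and> weight x \<le> c"
        using weighted_wordD[OF Cons.prems(3) w] by blast
      ultimately have "signed_count i s (collect i t xs) = signed_count i s xs"
        by (rule signed_count_collect[OF assms(1)])
      then show "s [^] signed_count i s (collect i t xs) = s [^] signed_count i s xs" by simp
    qed
    have "word_val G xs = t [^] signed_count i t xs \<otimes> word_val G (collect i t xs)"
      using word_val_collect[OF t(1)] weighted_wordD[OF Cons.prems(3) w] by blast
    then have "word_val G xs = t [^] signed_count i t xs \<otimes>
        (product_list G (map (\<lambda>s. s [^] signed_count i s xs) ts) \<otimes> word_val G xs')"
      unfolding xs'(2) eq .
    moreover have "word_val G xs' \<in> carrier G"
      using word_val_carr weighted_wordD(1)[OF A' xs'(1)] by blast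
    moreover have "product_list G (map (\<lambda>s. s [^] signed_count i s xs) ts) \<in> carrier G"
      by (rule product_list_closed) (use t filt_in_carr Cons.prems(3) in \<open>force simp: alphabet_def\<close>)
    ultimately show ?thesis using xs' filt_in_carr[OF t(1)] by (auto simp: m_assoc)
  qed
  then show ?case using A' by blast
qed

end

section \<open>Volume doubling\<close>

text \<open>The indices from which on the value is never undercut are infinitely many, since every
  tail attains its minimum.\<close>

lemma nat_seq_mono_subseq:
  fixes s :: "nat \<Rightarrow> nat"
  shows "\<exists>r :: nat \<Rightarrow> nat. strict_mono r \<and> mono (s \<circ> r)"
proof -
  let ?V = "{n. \<forall>m\<ge>n. s n \<le> s m}"
  have "\<exists>n\<ge>k. n \<in> ?V" for k
  proof -
    obtain n where "k \<le> n" "\<And>m. k \<le> m \<Longrightarrow> s n \<le> s m"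
      using ex_has_least_nat[of "\<lambda>n. k \<le> n" k s] by blast
    then show ?thesis by (intro exI[of _ n]) auto
  qed
  then have inf: "infinite ?V" unfolding infinite_nat_iff_unbounded_le by blast
  then have "strict_mono (enumerate ?V)" by (simp add: strict_mono_enumerate)
  moreover have "mono (s \<circ> enumerate ?V)"
  proof (rule monoI)
    fix a b :: nat assume "a \<le> b"
    then have "enumerate ?V a \<le> enumerate ?V b" using calculation by (simp add: strict_mono_less_eq)
    then show "(s \<circ> enumerate ?V) a \<le> (s \<circ> enumerate ?V) b" using enumerate_in_set[OF inf, of a] by simp
  qed
  ultimately show ?thesis by blast
qed

text \<open>The coordinates are handled one after the other, because a monotone sequence stays
  monotone along a subsequence.\<close>

lemma Dickson_subseq:
  fixes f :: "nat \<Rightarrow> 'b \<Rightarrow> nat"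
  assumes "finite L"
  shows "\<exists>r :: nat \<Rightarrow> nat. strict_mono r \<and> (\<forall>x\<in>L. mono (\<lambda>n. f (r n) x))"
  using assms
proof (induction L rule: finite_induct)
  case empty then show ?case using strict_mono_id by blast
next
  case (insert x L)
  then obtain r :: "nat \<Rightarrow> nat" where r: "strict_mono r" "\<forall>x\<in>L. mono (\<lambda>n. f (r n) x)" by blast
  obtain r' :: "nat \<Rightarrow> nat" where r': "strict_mono r'" "mono ((\<lambda>n. f (r n) x) \<circ> r')" using nat_seq_mono_subseq by blast
  have "mono (\<lambda>n. f (r (r' n)) y)" if "y \<in> L" for y
    using r that strict_mono_mono[OF r'(1)] by (auto simp: mono_def)
  then have "\<forall>y\<in>insert x L. mono (\<lambda>n. f ((r \<circ> r') n) y)" using r'(2) by (simp add: o_def)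
  then show ?case using strict_mono_o[OF r(1) r'(1)] by blast
qed

text \<open>Gordan's lemma: by Dickson's lemma there are only finitely many minimal nonzero elements, and
  each summand has size at least one, so the number of summands is at most the size.\<close>
lemma multiset_decomposition:
  assumes L: "finite L" and sub: "\<And>m. m \<in> \<Sigma> \<Longrightarrow> set_mset m \<subseteq> L"
    and diff: "\<And>m m'. m \<in> \<Sigma> \<Longrightarrow> m' \<in> \<Sigma> \<Longrightarrow> m' \<subseteq># m \<Longrightarrow> m - m' \<in> \<Sigma>"
  shows "\<exists>M. finite M \<and> M \<subseteq> \<Sigma> \<and> (\<forall>m\<in>\<Sigma>. \<exists>ms. set ms \<subseteq> M \<and> length ms \<le> size m \<and> sum_list ms = m)"
proof -
  define M where "M = {m \<in> \<Sigma>. m \<noteq> {#} \<and> (\<forall>m'\<in>\<Sigma>. m' \<noteq> {#} \<longrightarrow> m' \<subseteq># m \<longrightarrow> m' = m)}"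
  have "finite M"
  proof (rule ccontr)
    assume "infinite M"
    then obtain f :: "nat \<Rightarrow> _" where f: "inj f" "range f \<subseteq> M" using infinite_countable_subset by blast
    obtain r :: "nat \<Rightarrow> nat" where r: "strict_mono r" "\<forall>x\<in>L. mono (\<lambda>n. count (f (r n)) x)"
      using Dickson_subseq[OF L, of "\<lambda>n. count (f n)"] by blast
    have fM: "f n \<in> M" for n using f by blast
    have "f (r 0) \<subseteq># f (r 1)"
    proof (rule mset_subset_eqI)
      fix x show "count (f (r 0)) x \<le> count (f (r 1)) x"
      proof (cases "x \<in> L")
        case True then show ?thesis using r(2) monoD[of "\<lambda>n. count (f (r n)) x" 0 1] by simp
      next
        case False
        then have "x \<notin># f (r 0)" using sub fM[of "r 0"] by (auto simp: M_def)
        then show ?thesis by (simp add: not_in_iff)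
      qed
    qed
    then have "f (r 0) = f (r 1)" using fM by (auto simp: M_def)
    then have "r 0 = r 1" using f by (simp add: inj_def)
    then show False using r(1) by (simp add: strict_mono_eq)
  qed
  moreover have "\<exists>ms. set ms \<subseteq> M \<and> length ms \<le> size m \<and> sum_list ms = m" if "m \<in> \<Sigma>" for m
    using that
  proof (induction "size m" arbitrary: m rule: less_induct)
    case less
    show ?case
    proof (cases "m = {#}")
      case True then show ?thesis by (intro exI[of _ "[]"]) auto
    next
      case False
      let ?P = "\<lambda>m'. m' \<in> \<Sigma> \<and> m' \<noteq> {#} \<and> m' \<subseteq># m"
      obtain m0 where m0: "?P m0" "\<And>m'. ?P m' \<Longrightarrow> size m0 \<le> size m'"
        using ex_has_least_nat[of ?P m size] False less.prems by auto
      have "m0 \<in> M" unfolding M_def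
      proof (intro CollectI conjI ballI impI)
        fix m' assume m': "m' \<in> \<Sigma>" "m' \<noteq> {#}" "m' \<subseteq># m0"
        then have "size m0 \<le> size m'" using m0 subset_mset.order_trans by blast
        then show "m' = m0" using m'(3) mset_subset_size subset_mset.le_neq_trans by fastforce
      qed (use m0 in auto)
      have sz: "size (m - m0) + size m0 = size m" "0 < size m0"
        using m0(1) by (auto simp: size_Diff_submset size_mset_mono nonempty_has_size)
      have "m - m0 \<in> \<Sigma>" using diff less.prems m0 by blast
      then obtain ms where ms: "set ms \<subseteq> M" "length ms \<le> size (m - m0)" "sum_list ms = m - m0"
        using less.hyps[of "m - m0"] sz by auto
      then show ?thesis using \<open>m0 \<in> M\<close> m0(1) sz by (intro exI[of _ "m0 # ms"]) auto
    qed
  qed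
  moreover have "M \<subseteq> \<Sigma>" by (auto simp: M_def)
  ultimately show ?thesis by blast
qed

section \<open>Permuting, inverting and regrouping weighted words\<close>

lemma signed_count_mset: "mset xs = mset ys \<Longrightarrow> signed_count i t xs = signed_count i t ys"
  unfolding signed_count_def sum_mset_sum_list[symmetric] mset_map by simp

lemma signed_count_filter: "signed_count i t (filter (\<lambda>x. weight x = i) xs) = signed_count i t xs"
  by (induction xs) auto

definition word_inv :: "'a wletter list \<Rightarrow> 'a wletter list" where
  "word_inv xs = rev (map (\<lambda>x. (fst x, weight x, - snd (snd x))) xs)"

lemma signed_count_rev: "signed_count i t (rev xs) = signed_count i t xs"
  by (induction xs) auto

lemma signed_count_word_inv: "signed_count i t (word_inv xs) = - signed_count i t xs"
  unfolding word_inv_def signed_count_rev by (induction xs) auto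

lemma count_weight_word_inv: "count_weight m (word_inv xs) = count_weight m xs"
proof -
  have "count_weight m (rev ys) = count_weight m ys" for ys :: "'a wletter list" by (induction ys) auto
  then show ?thesis unfolding word_inv_def by (induction xs) auto
qed

lemma (in group) word_val_word_inv:
  assumes "\<forall>x\<in>set xs. fst x \<in> carrier G"
  shows "word_val G (word_inv xs) = inv (word_val G xs)"
proof -
  have *: "map (letter_val G) (word_inv xs) = rev (map (m_inv G) (map (letter_val G) xs))"
    using assms unfolding word_inv_def rev_map map_map
    by (intro arg_cong[of _ _ rev] map_cong) (auto simp: letter_val_def int_pow_neg)
  show ?thesis unfolding * by (rule product_list_rev_inv) (use assms in \<open>auto simp: letter_val_def\<close>)
qed

context nilpotent_filtration
begin

lemma filt_left:
  assumes "z \<in> \<Gamma> i" "w \<in> carrier G"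
  shows "coset_eq G (\<Gamma> i) (z \<otimes> w) w"
proof -
  have "z \<in> carrier G" "inv z \<in> \<Gamma> i" using assms filt_in_carr subgroup.m_inv_closed[OF filt_subgroup] by blast+
  then have "coset_eq G (\<Gamma> i) z \<one>" by (simp add: coset_eq_def)
  from filt_mult[OF this filt_refl[OF assms(2)]] show ?thesis using assms by simp
qed

lemma product_list_perm:
  assumes "mset xs = mset ys" "set xs \<subseteq> \<Gamma> i"
  shows "coset_eq G (\<Gamma> (Suc i)) (product_list G xs) (product_list G ys)"
  using assms
proof (induction xs arbitrary: ys)
  case Nil then show ?case using filt_refl by simp
next
  case (Cons x xs)
  then obtain a b where ys: "ys = a @ x # b" by (metis list.set_intros(1) set_mset_mset split_list)
  have "set ys \<subseteq> \<Gamma> i" using Cons.prems by (metis set_mset_mset)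
  then have c: "set a \<subseteq> carrier G" "set b \<subseteq> carrier G" "x \<in> carrier G" "x \<in> \<Gamma> i"
    using ys filt_carr by auto
  have "coset_eq G (\<Gamma> (Suc i)) (x \<otimes> product_list G xs) (x \<otimes> product_list G (a @ b))"
    using Cons ys by (intro filt_mult filt_refl c) simp_all
  also have "x \<otimes> product_list G (a @ b) = (x \<otimes> product_list G a) \<otimes> product_list G b"
    using c by (simp add: product_list_append m_assoc)
  also have "coset_eq G (\<Gamma> (Suc i)) \<dots> ((product_list G a \<otimes> x) \<otimes> product_list G b)"
    by (rule filt_mult[OF filt_sym[OF filt_central] filt_refl]) (use c in simp_all)
  also have "(product_list G a \<otimes> x) \<otimes> product_list G b = product_list G ys"
    using c by (simp add: ys product_list_append m_assoc)
  finally show ?case by simp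
qed

lemma word_val_filter:
  assumes "\<forall>x\<in>set xs. fst x \<in> \<Gamma> (weight x) \<and> i \<le> weight x"
  shows "coset_eq G (\<Gamma> (Suc i)) (word_val G xs) (word_val G (filter (\<lambda>x. weight x = i) xs))"
  using assms
proof (induction xs)
  case Nil then show ?case using filt_refl by simp
next
  case (Cons x xs)
  have c: "letter_val G x \<in> carrier G" "word_val G xs \<in> carrier G"
    using Cons letter_val_carr word_val_carr by auto
  have IH: "coset_eq G (\<Gamma> (Suc i)) (word_val G xs) (word_val G (filter (\<lambda>x. weight x = i) xs))"
    using Cons by simp
  show ?case
  proof (cases "weight x = i")
    case True then show ?thesis using filt_mult[OF filt_refl[OF c(1)] IH] by simp
  next
    case False
    then have "letter_val G x \<in> \<Gamma> (Suc i)"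
      using letter_val_filt[of x] filt_mono[of "Suc i" "weight x"] Cons.prems by auto
    from filt_trans[OF filt_left[OF this c(2)] IH] show ?thesis using False by simp
  qed
qed

lemma word_val_append:
  assumes "\<forall>x\<in>set xs. fst x \<in> \<Gamma> (weight x)" "\<forall>x\<in>set ys. fst x \<in> \<Gamma> (weight x)"
  shows "word_val G (xs @ ys) = word_val G xs \<otimes> word_val G ys"
  unfolding map_append by (rule product_list_append; unfold set_map;
    intro image_subsetI letter_val_carr) (use assms in blast)+

text \<open>In a word with value in \<open>\<Gamma> (i + 1)\<close> the letters of weight
  \<open>i\<close> multiply into \<open>\<Gamma> (i + 1)\<close> too, but their exponents need not
  vanish, since generators of \<open>\<Gamma> i / \<Gamma> (i + 1)\<close> may satisfy relations.
  Gordan's lemma cuts these letters into blocks of finitely many types with value in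
  \<open>\<Gamma> (i + 1)\<close>. Dividing the word by the blocks makes all exponents of weight
  \<open>i\<close> zero, and every block becomes one new letter of weight
  \<open>i + 1\<close>.\<close>

lemma raise_level:
  assumes i: "0 < i" "i < c" and A: "alphabet i A"
  shows "\<exists>A' K'. alphabet (Suc i) A' \<and> (\<forall>n>0. \<forall>xs. weighted_word A K n xs \<longrightarrow> word_val G xs \<in> \<Gamma> (Suc i) \<longrightarrow>
    (\<exists>xs'. weighted_word A' K' n xs' \<and> word_val G xs' = word_val G xs))"
proof -
  define L :: "'a wletter set" where "L = {x. (fst x, weight x) \<in> A \<and> weight x = i \<and> snd (snd x) \<in> {1, -1}}"
  have "L \<subseteq> (\<lambda>((y, l), e). (y, l, e)) ` (A \<times> {1, -1})"
  proof
    fix x assume "x \<in> L"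
    then show "x \<in> (\<lambda>((y, l), e). (y, l, e)) ` (A \<times> {1, -1})"
      by (intro rev_image_eqI[of "((fst x, weight x), snd (snd x))"]) (auto simp: L_def prod_eq_iff)
  qed
  then have finL: "finite L" using A finite_subset by (fastforce simp: alphabet_def)
  have Ldef: "x \<in> L \<longleftrightarrow> (fst x, weight x) \<in> A \<and> weight x = i \<and> snd (snd x) \<in> {1, -1}" for x
    by (simp add: L_def)
  have LG: "fst x \<in> \<Gamma> i" "fst x \<in> \<Gamma> (weight x)" "letter_val G x \<in> \<Gamma> i" if "x \<in> L" for x
    using that A letter_val_filt[of x] by (auto simp: Ldef alphabet_def)
  \<comment> \<open>Modulo \<open>\<Gamma> (i + 1)\<close> the order of the factors is immaterial;
    demanding the property of all orderings makes it a property of the multiset.\<close>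
  define \<Sigma> where "\<Sigma> = {m. set_mset m \<subseteq> L \<and> (\<forall>ys. mset ys = m \<longrightarrow> word_val G ys \<in> \<Gamma> (Suc i))}"
  have \<Sigma>_diff: "m - m' \<in> \<Sigma>" if m: "m \<in> \<Sigma>" and m': "m' \<in> \<Sigma>" and sub: "m' \<subseteq># m" for m m'
    unfolding \<Sigma>_def
  proof (intro CollectI conjI allI impI)
    show "set_mset (m - m') \<subseteq> L" using m by (auto simp: \<Sigma>_def dest: in_diffD)
    fix ys assume ys: "mset ys = m - m'"
    obtain zs where zs: "mset zs = m'" using ex_mset by blast
    have c: "set ys \<subseteq> L" "set zs \<subseteq> L"
      using m m' by (auto simp: \<Sigma>_def zs[symmetric] ys simp flip: set_mset_mset dest: in_diffD)
    have "mset (zs @ ys) = m" using ys zs sub by simp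
    then have "word_val G (zs @ ys) \<in> \<Gamma> (Suc i)" using m unfolding \<Sigma>_def by blast
    moreover have "word_val G (zs @ ys) = word_val G zs \<otimes> word_val G ys"
      by (rule word_val_append) (use c LG in blast)+
    moreover have "word_val G zs \<in> \<Gamma> (Suc i)" using m' zs by (simp add: \<Sigma>_def)
    moreover have "word_val G ys \<in> carrier G" "word_val G zs \<in> carrier G"
      using word_val_carr c LG by (meson subsetD)+
    ultimately show "word_val G ys \<in> \<Gamma> (Suc i)"
      using subgroup.m_closed[OF filt_subgroup, of "inv (word_val G zs)" "Suc i" "word_val G (zs @ ys)"]
        subgroup.m_inv_closed[OF filt_subgroup] by (simp add: mult_inv_cancel)
  qed
  have \<Sigma>_sub: "set_mset m \<subseteq> L" if "m \<in> \<Sigma>" for m using that by (simp add: \<Sigma>_def)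
  have "\<exists>M. finite M \<and> M \<subseteq> \<Sigma> \<and> (\<forall>m\<in>\<Sigma>. \<exists>ms. set ms \<subseteq> M \<and> length ms \<le> size m \<and> sum_list ms = m)"
    by (rule multiset_decomposition[OF finL]) (use \<Sigma>_sub \<Sigma>_diff in blast)+
  then obtain M where M: "finite M" "M \<subseteq> \<Sigma>"
    "\<And>m. m \<in> \<Sigma> \<Longrightarrow> \<exists>ms. set ms \<subseteq> M \<and> length ms \<le> size m \<and> sum_list ms = m"
    by blast
  define u where "u m = (SOME ys. mset ys = m)" for m :: "'a wletter multiset"
  have u: "mset (u m) = m" for m unfolding u_def by (rule someI_ex[OF ex_mset])
  have uL: "set (u m) \<subseteq> L" if "m \<in> M" for m
    using \<Sigma>_sub[of m] M(2) that unfolding set_mset_mset[symmetric] u by blast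
  have uG: "word_val G (u m) \<in> \<Gamma> (Suc i)" if "m \<in> M" for m using M(2) that u by (auto simp: \<Sigma>_def)
  obtain ts where ts: "distinct ts" "set ts = {y. (y, i) \<in> A}"
  proof -
    have "{y. (y, i) \<in> A} \<subseteq> fst ` A" by force
    then have "finite {y. (y, i) \<in> A}" using A finite_subset by (fastforce simp: alphabet_def)
    then show ?thesis using finite_distinct_list that by metis
  qed
  \<comment> \<open>The factor two pays for the appended inverse of the blocks.\<close>
  obtain A1 K1 where A1: "alphabet (Suc i) A1" and K1: "\<And>n xs. 0 < n \<Longrightarrow> weighted_word A (2 * K) n xs \<Longrightarrow>
    (\<exists>xs'. weighted_word A1 K1 n xs' \<and>
      word_val G xs = product_list G (map (\<lambda>t. t [^] signed_count i t xs) ts) \<otimes> word_val G xs')"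
    using collect_all[OF i(1) ts A, of "2 * K"] by blast
  let ?A = "A1 \<union> (\<lambda>m. (word_val G (u m), Suc i)) ` M"
  have "alphabet (Suc i) ?A" using A1 M(1) uG i by (auto simp: alphabet_def)
  moreover have "\<exists>xs'. weighted_word ?A (K1 + K) n xs' \<and> word_val G xs' = word_val G xs"
    if n: "0 < n" and w: "weighted_word A K n xs" and v: "word_val G xs \<in> \<Gamma> (Suc i)" for n xs
  proof -
    define m where "m = mset (filter (\<lambda>x. weight x = i) xs)"
    note wD = weighted_wordD[OF A w]
    have fL: "set_mset m \<subseteq> L" using w by (auto simp: m_def Ldef weighted_word_def)
    have "word_val G ys \<in> \<Gamma> (Suc i)" if ys: "mset ys = m" for ys
    proof -
      have "coset_eq G (\<Gamma> (Suc i)) (word_val G xs) (word_val G (filter (\<lambda>x. weight x = i) xs))"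
        by (rule word_val_filter) (use wD in blast)
      also have "coset_eq G (\<Gamma> (Suc i)) \<dots> (word_val G ys)"
        by (rule product_list_perm) (use ys fL LG in \<open>auto simp: m_def\<close>)
      finally show ?thesis
        by (rule coset_eq_memD[OF normal_filt _ v subset_refl filt_subgroup])
    qed
    then have "m \<in> \<Sigma>" using fL by (simp add: \<Sigma>_def)
    then obtain ms where ms: "set ms \<subseteq> M" "length ms \<le> size m" "sum_list ms = m" using M(3) by blast
    let ?U = "concat (map u ms)"
    have mU: "mset ?U = m" unfolding ms(3)[symmetric] by (induction ms) (auto simp: u)
    have UL: "set ?U \<subseteq> L" using mU fL by (metis set_mset_mset)
    have UG: "\<forall>x\<in>set ?U. fst x \<in> \<Gamma> (weight x)" using UL LG by blast
    have szm: "size m \<le> K * n ^ i" 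
    proof -
      have "size m = count_weight i xs" unfolding m_def count_weight_def size_mset ..
      then show ?thesis using w by (simp add: weighted_word_def)
    qed
    have cU: "count_weight l ?U \<le> K * n ^ l" for l
    proof (cases "l = i")
      case True
      have "count_weight l ?U \<le> length ?U" by (simp add: count_weight_def)
      also have "length ?U = size m" using mU by (metis size_mset)
      finally show ?thesis using szm True by simp
    next
      case False
      then have "filter (\<lambda>x. weight x = l) ?U = []" using UL by (auto simp: filter_empty_conv Ldef)
      then show ?thesis by (simp add: count_weight_def)
    qed
    let ?zs = "xs @ word_inv ?U"
    have Ux: "(fst x, weight x) \<in> A \<and> snd (snd x) \<in> {1, -1}" if x: "x \<in> set (word_inv ?U)" for x
    proof -
      obtain y where "y \<in> L" "x = (fst y, weight y, - snd (snd y))"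
        using x UL unfolding word_inv_def set_rev set_map by blast
      then show ?thesis by (auto simp: Ldef)
    qed
    have "weighted_word A (2 * K) n ?zs" unfolding weighted_word_def
    proof (intro conjI ballI allI)
      fix l show "count_weight l ?zs \<le> 2 * K * n ^ l"
        using w cU[of l] unfolding weighted_word_def count_weight_word_inv count_weight_simps
          mult_2 distrib_right by (blast intro: add_mono)
    qed (use w Ux in \<open>auto simp: weighted_word_def\<close>)
    then obtain xs' where xs': "weighted_word A1 K1 n xs'"
      "word_val G ?zs = product_list G (map (\<lambda>t. t [^] signed_count i t ?zs) ts) \<otimes> word_val G xs'"
      using K1[OF n] by blast
    \<comment> \<open>Blocks and word contain the same letters of weight \<open>i\<close>, so the
      exponents cancel and the collected powers disappear.\<close>
    have "signed_count i t ?U = signed_count i t xs" for t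
      using signed_count_mset[of ?U "filter (\<lambda>x. weight x = i) xs"] mU by (simp add: m_def signed_count_filter)
    then have "signed_count i t ?zs = 0" for t by (simp add: signed_count_word_inv)
    then have "product_list G (map (\<lambda>t. t [^] signed_count i t ?zs) ts) = \<one>"
      by (induction ts) (auto simp del: signed_count_simps)
    moreover have x'c: "word_val G xs' \<in> carrier G" using word_val_carr weighted_wordD(1)[OF A1 xs'(1)] by blast
    ultimately have zs: "word_val G ?zs = word_val G xs'" using xs' by simp
    have Uc: "word_val G ?U \<in> carrier G" using word_val_carr UG by blast
    have "word_val G ?zs = word_val G xs \<otimes> word_val G (word_inv ?U)"
      by (rule word_val_append) (use wD Ux A in \<open>unfold alphabet_def, blast\<close>)+
    also have "word_val G (word_inv ?U) = inv (word_val G ?U)"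
      using word_val_word_inv UG filt_in_carr by blast
    finally have "word_val G xs = word_val G xs' \<otimes> word_val G ?U"
      using zs inv_solve_right[OF x'c filt_in_carr[OF v] Uc] by simp
    also have "word_val G ?U = word_val G (map (\<lambda>m. (word_val G (u m), Suc i, 1)) ms)"
      using ms(1)
    proof (induction ms)
      case (Cons m ms)
      have c: "set (u m) \<subseteq> L"
        using uL Cons.prems by simp
      have c': "set (concat (map u ms)) \<subseteq> L"
        using uL Cons.prems by auto
      have eq: "word_val G (concat (map u (m # ms))) = word_val G (u m) \<otimes> word_val G (concat (map u ms))"
        unfolding list.map concat.simps
        by (rule word_val_append) (use c c' LG in blast)+
      have "word_val G (u m) \<in> carrier G" using uG Cons.prems filt_in_carr by auto
      then have "letter_val G (word_val G (u m), Suc i, 1) = word_val G (u m)" by (simp add: letter_val_def)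
      then show ?case unfolding eq using Cons by simp
    qed simp
    also have "word_val G xs' \<otimes> word_val G (map (\<lambda>m. (word_val G (u m), Suc i, 1)) ms)
      = word_val G (xs' @ map (\<lambda>m. (word_val G (u m), Suc i, 1)) ms)"
      by (rule word_val_append[symmetric]) (use weighted_wordD(1)[OF A1 xs'(1)] uG ms in auto)
    finally have eq: "word_val G (xs' @ map (\<lambda>m. (word_val G (u m), Suc i, 1)) ms) = word_val G xs" ..
    have "count_weight l (map (\<lambda>m. (word_val G (u m), Suc i, 1 :: int)) ms) \<le> K * n ^ l" for l
    proof (cases "l = Suc i")
      case True
      have "count_weight l (map (\<lambda>m. (word_val G (u m), Suc i, 1 :: int)) ms) \<le> length ms"
        unfolding count_weight_def by (rule order_trans[OF length_filter_le]) simp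
      \<comment> \<open>There are at most as many blocks as letters of weight \<open>i\<close>, well
        within the number allowed at weight \<open>i + 1\<close>.\<close>
      also have "\<dots> \<le> K * n ^ i" using ms szm by simp
      also have "\<dots> \<le> K * n ^ l" using n True by (intro mult_le_mono2 power_increasing) auto
      finally show ?thesis .
    next
      case False
      then show ?thesis by (simp add: count_weight_def)
    qed
    then have "weighted_word ?A (K1 + K) n (xs' @ map (\<lambda>m. (word_val G (u m), Suc i, 1)) ms)"
      using xs'(1) ms(1) unfolding weighted_word_def by (auto simp: distrib_right intro: add_mono)
    then show ?thesis using eq by blast
  qed
  ultimately show ?thesis by blast
qed

text \<open>Starts from words in \<open>S\<close> with all weights one and raises the level step by
  step. The alphabet and the constant depend on \<open>i\<close> but serve every \<open>n\<close>
  and every element.\<close>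

lemma level_words:
  assumes "0 < i" "i \<le> c"
  shows "\<exists>A K. alphabet i A \<and> (\<forall>n>0. \<forall>g\<in>\<Gamma> i \<inter> B n. \<exists>xs. weighted_word A K n xs \<and> word_val G xs = g)"
  using assms
proof (induction i rule: nat_induct_non_zero)
  case 1
  let ?A = "(\<lambda>x. (x, 1 :: nat)) ` S"
  have "alphabet 1 ?A" using fin_S S_carr filt_1 1 by (auto simp: alphabet_def)
  moreover have "\<exists>xs. weighted_word ?A 1 n xs \<and> word_val G xs = g" if "g \<in> B n" for g n
  proof -
    obtain ys where ys: "g = product_list G ys" "set ys \<subseteq> S" "length ys \<le> n"
      using \<open>g \<in> B n\<close> unfolding word_ball_def by blast
    let ?xs = "map (\<lambda>y. (y, 1 :: nat, 1 :: int)) ys"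
    have "count_weight m ?xs \<le> n ^ m" for m
    proof (cases "m = 1")
      case True then show ?thesis using ys(3) length_filter_le[of _ ?xs] by (simp add: count_weight_def)
    next
      case False then show ?thesis by (simp add: count_weight_def)
    qed
    then have "weighted_word ?A 1 n ?xs" using ys by (auto simp: weighted_word_def)
    moreover have "map (letter_val G) ?xs = ys"
      using ys S_carr by (induction ys arbitrary: g n) (auto simp: letter_val_def)
    ultimately show ?thesis using ys(1) by metis
  qed
  ultimately show ?case by blast
next
  case (Suc i)
  then obtain A K where A: "alphabet i A" and
    K: "\<And>n g. 0 < n \<Longrightarrow> g \<in> \<Gamma> i \<inter> B n \<Longrightarrow> \<exists>xs. weighted_word A K n xs \<and> word_val G xs = g"
    by (meson Suc_leD)
  obtain A' K' where A': "alphabet (Suc i) A'" and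
    K': "\<And>n xs. 0 < n \<Longrightarrow> weighted_word A K n xs \<Longrightarrow> word_val G xs \<in> \<Gamma> (Suc i) \<Longrightarrow>
    \<exists>xs'. weighted_word A' K' n xs' \<and> word_val G xs' = word_val G xs"
    using raise_level[OF Suc.hyps(1) _ A, of K] Suc.prems by auto
  have "\<exists>xs. weighted_word A' K' n xs \<and> word_val G xs = g" if n: "0 < n" and g: "g \<in> \<Gamma> (Suc i) \<inter> B n" for n g
  proof -
    have "g \<in> \<Gamma> i \<inter> B n" using g filt_decr by blast
    then obtain xs where xs: "weighted_word A K n xs" "word_val G xs = g" using K[OF n] by blast
    then show ?thesis using K'[OF n xs(1)] g by auto
  qed
  then show ?case using A' by blast
qed

text \<open>Collecting once more at weight \<open>i\<close> leaves a rest in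
  \<open>\<Gamma> (i + 1)\<close>, and an exponent is bounded by the number of letters of weight
  \<open>i\<close>. This is the converse of \<open>power_distortion\<close>: modulo
  \<open>\<Gamma> (i + 1)\<close> the part of \<open>B n\<close> in \<open>\<Gamma> i\<close> fits
  into a box of side \<open>O(n ^ i)\<close>.\<close>

lemma level_box:
  assumes "0 < i" "i \<le> c"
  shows "\<exists>ts K. set ts \<subseteq> \<Gamma> i \<and> (\<forall>n>0. \<forall>g\<in>\<Gamma> i \<inter> B n. \<exists>a :: 'a \<Rightarrow> int. (\<forall>t. \<bar>a t\<bar> \<le> int (K * n ^ i)) \<and>
     coset_eq G (\<Gamma> (Suc i)) g (product_list G (map (\<lambda>t. t [^] a t) ts)))"
proof -
  obtain A K where A: "alphabet i A" and
    K: "\<And>n g. 0 < n \<Longrightarrow> g \<in> \<Gamma> i \<inter> B n \<Longrightarrow> \<exists>xs. weighted_word A K n xs \<and> word_val G xs = g"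
    using level_words[OF assms] by blast
  obtain ts where ts: "distinct ts" "set ts = {y. (y, i) \<in> A}"
  proof -
    have "{y. (y, i) \<in> A} \<subseteq> fst ` A" by force
    then have "finite {y. (y, i) \<in> A}" using A finite_subset by (fastforce simp: alphabet_def)
    then show ?thesis using finite_distinct_list that by metis
  qed
  have tsG: "set ts \<subseteq> \<Gamma> i" using A ts by (auto simp: alphabet_def)
  obtain A1 K1 where A1: "alphabet (Suc i) A1" and K1: "\<And>n xs. 0 < n \<Longrightarrow> weighted_word A K n xs \<Longrightarrow>
    (\<exists>xs'. weighted_word A1 K1 n xs' \<and>
      word_val G xs = product_list G (map (\<lambda>t. t [^] signed_count i t xs) ts) \<otimes> word_val G xs')"
    using collect_all[OF assms(1) ts A, of K] by blast
  have "\<exists>a :: 'a \<Rightarrow> int. (\<forall>t. \<bar>a t\<bar> \<le> int (K * n ^ i)) \<and>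
     coset_eq G (\<Gamma> (Suc i)) g (product_list G (map (\<lambda>t. t [^] a t) ts))" if n: "0 < n" and g: "g \<in> \<Gamma> i \<inter> B n" for n g
  proof -
    obtain xs where xs: "weighted_word A K n xs" "word_val G xs = g" using K[OF n g] by blast
    obtain xs' where xs': "weighted_word A1 K1 n xs'"
      "word_val G xs = product_list G (map (\<lambda>t. t [^] signed_count i t xs) ts) \<otimes> word_val G xs'"
      using K1[OF n xs(1)] by blast
    have "set (map (letter_val G) xs') \<subseteq> \<Gamma> (Suc i)"
    proof -
      have "letter_val G x \<in> \<Gamma> (Suc i)" if "x \<in> set xs'" for x
        using letter_val_filt[OF weighted_wordD(1)[OF A1 xs'(1) that]] filt_mono[OF weighted_wordD(2)[OF A1 xs'(1) that]]
        by blast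
      then show ?thesis by auto
    qed
    then have v: "word_val G xs' \<in> \<Gamma> (Suc i)" by (rule product_list_subgroup[OF filt_subgroup])
    have "product_list G (map (\<lambda>t. t [^] signed_count i t xs) ts) \<in> carrier G"
      by (rule product_list_closed) (use tsG filt_in_carr in auto)
    from coset_eq_right(1)[OF normal_filt this v]
    have "coset_eq G (\<Gamma> (Suc i)) g (product_list G (map (\<lambda>t. t [^] signed_count i t xs) ts))"
      using xs xs' by simp
    moreover have "\<bar>signed_count i t xs\<bar> \<le> int (K * n ^ i)" for t
    proof -
      have "\<bar>signed_count i t xs\<bar> \<le> int (count_weight i xs)"
        by (rule abs_signed_count) (use weighted_wordD(4)[OF A xs(1)] in blast)
      moreover have "int (count_weight i xs) \<le> int (K * n ^ i)"
        using xs(1) by (simp only: weighted_word_def of_nat_le_iff)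
      ultimately show ?thesis by (rule order_trans)
    qed
    ultimately show ?thesis by (intro exI[of _ "\<lambda>t. signed_count i t xs"] conjI allI)
  qed
  then show ?thesis using tsG by blast
qed

section \<open>Covering large balls by boundedly many small ones\<close>

lemma product_list_cong_filt:
  assumes "\<And>t. t \<in> set ts \<Longrightarrow> coset_eq G (\<Gamma> i) (f t) (g t)"
  shows "coset_eq G (\<Gamma> i) (product_list G (map f ts)) (product_list G (map g ts))"
  using assms by (induction ts) (auto intro: filt_refl filt_mult)

lemma ball_product_list: "(\<And>t. t \<in> set ts \<Longrightarrow> f t \<in> B m) \<Longrightarrow> product_list G (map f ts) \<in> B (length ts * m)"
proof (induction ts)
  case Nil then show ?case using ball_one by simp
next
  case (Cons t ts)
  then show ?case using ball_mult[of "f t" m "product_list G (map f ts)" "length ts * m"] by simp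
qed

lemma ball_int_pow: "x \<in> B m \<Longrightarrow> x [^] (q::int) \<in> B (nat \<bar>q\<bar> * m)"
proof (cases q rule: int_cases2)
  case (nonneg n)
  then show "x \<in> B m \<Longrightarrow> ?thesis" using ball_pow by (simp add: int_pow_int)
next
  case (nonpos n)
  assume x: "x \<in> B m"
  then have "x [^] q = inv (x [^] n)" using nonpos int_pow_neg_int[OF ball_carr[OF x]] by simp
  then show ?thesis using ball_inv[OF ball_pow[OF x, of n]] nonpos by simp
qed

lemma power_distortion_uniform:
  assumes "0 < i" "set ts \<subseteq> \<Gamma> i"
  shows "\<exists>K. \<forall>t\<in>set ts. \<forall>n>0. \<forall>a::int. \<bar>a\<bar> \<le> int (n ^ i) \<longrightarrow> (\<exists>b\<in>B (K * n). coset_eq G (\<Gamma> (Suc i)) (t [^] a) b)"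
  using assms(2)
proof (induction ts)
  case (Cons t ts)
  let ?P = "\<lambda>t K. \<forall>n>0. \<forall>a::int. \<bar>a\<bar> \<le> int (n ^ i) \<longrightarrow> (\<exists>b\<in>B (K * n). coset_eq G (\<Gamma> (Suc i)) (t [^] a) b)"
  have mono: "?P s L" if sK: "?P s K" and KL: "K \<le> L" for s K L
  proof (intro allI impI)
    fix n :: nat and a :: int assume "0 < n" "\<bar>a\<bar> \<le> int (n ^ i)"
    then obtain b where "b \<in> B (K * n)" "coset_eq G (\<Gamma> (Suc i)) (s [^] a) b" using sK by blast
    moreover have "B (K * n) \<subseteq> B (L * n)" using KL by (intro ball_mono) simp
    ultimately show "\<exists>b\<in>B (L * n). coset_eq G (\<Gamma> (Suc i)) (s [^] a) b" by blast
  qed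
  obtain K where K: "\<forall>t\<in>set ts. ?P t K" using Cons by auto
  obtain L where L: "?P t L" using power_distortion_int[OF assms(1), of t] Cons.prems by auto
  have "?P s (max K L)" if "s \<in> set (t # ts)" for s
  proof (cases "s = t")
    case True then show ?thesis using mono[OF L max.cobounded2] by simp
  next
    case False
    then have "s \<in> set ts" using that by simp
    then have "?P s K" using K by blast
    then show ?thesis by (rule mono[OF _ max.cobounded1])
  qed
  then show ?case by blast
qed simp

text \<open>An exponent of size \<open>Q * n ^ i\<close> is split as \<open>q * n ^ i + r\<close>: the boundedly many \<open>q\<close> give
  the centres of the covering and the \<open>r\<close> a ball of radius \<open>O(n)\<close>.\<close>
lemma covering:
  assumes "0 < i" "i \<le> Suc c"
  shows "\<exists>K. \<forall>C. \<exists>M D. \<forall>n>0. \<exists>F. finite F \<and> card F \<le> M \<and> F \<subseteq> B (D * n) \<and>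
    (\<forall>x\<in>B (C * n). \<exists>f\<in>F. \<exists>b\<in>B (K * n). coset_eq G (\<Gamma> i) x (f \<otimes> b))"
  using assms
proof (induction i rule: nat_induct_non_zero)
  case 1
  have "\<exists>f\<in>{\<one>}. \<exists>b\<in>B (0 * n). coset_eq G (\<Gamma> 1) x (f \<otimes> b)" if "x \<in> B m" for x m n
    using ball_carr[OF that] filt_1 ball_one by (intro bexI[of _ \<one>]) (auto simp: coset_eq_def)
  then have "finite {\<one>} \<and> card {\<one>} \<le> 1 \<and> {\<one>} \<subseteq> B (0 * n) \<and>
    (\<forall>x\<in>B (C * n). \<exists>f\<in>{\<one>}. \<exists>b\<in>B (0 * n). coset_eq G (\<Gamma> 1) x (f \<otimes> b))" for C n
    using ball_one[of "0 * n"] by simp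
  then show ?case by iprover
next
  case (Suc i)
  let ?N = "\<Gamma> (Suc i)"
  obtain K0 where K0: "\<And>C. \<exists>M D. \<forall>n>0. \<exists>F. finite F \<and> card F \<le> M \<and> F \<subseteq> B (D * n) \<and>
    (\<forall>x\<in>B (C * n). \<exists>f\<in>F. \<exists>b\<in>B (K0 * n). coset_eq G (\<Gamma> i) x (f \<otimes> b))"
    using Suc.IH[OF Suc_leD[OF Suc.prems]] by iprover
  obtain ts Kb where ts: "set ts \<subseteq> \<Gamma> i" and Kb: "\<And>n g. 0 < n \<Longrightarrow> g \<in> \<Gamma> i \<inter> B n \<Longrightarrow>
     \<exists>a :: 'a \<Rightarrow> int. (\<forall>t. \<bar>a t\<bar> \<le> int (Kb * n ^ i)) \<and>
     coset_eq G ?N g (product_list G (map (\<lambda>t. t [^] a t) ts))"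
    using level_box[OF Suc.hyps] Suc.prems by (metis Suc_le_mono)
  obtain K1 where K1: "\<And>t n a. t \<in> set ts \<Longrightarrow> 0 < n \<Longrightarrow> \<bar>a\<bar> \<le> int (n ^ i) \<Longrightarrow>
     \<exists>b\<in>B (K1 * n). coset_eq G ?N (t [^] a) b"
    using power_distortion_uniform[OF Suc.hyps ts] by blast
  let ?l = "length ts"
  have step: "\<exists>M D. \<forall>n>0. \<exists>F. finite F \<and> card F \<le> M \<and> F \<subseteq> B (D * n) \<and>
    (\<forall>x\<in>B (C * n). \<exists>f\<in>F. \<exists>b\<in>B ((K0 + ?l * K1) * n). coset_eq G ?N x (f \<otimes> b))" for C
  proof -
    obtain M0 D0 where MD: "\<And>n. 0 < n \<Longrightarrow> \<exists>F. finite F \<and> card F \<le> M0 \<and> F \<subseteq> B (D0 * n) \<and>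
      (\<forall>x\<in>B (C * n). \<exists>f\<in>F. \<exists>b\<in>B (K0 * n). coset_eq G (\<Gamma> i) x (f \<otimes> b))"
      using K0[of C] by blast
    \<comment> \<open>The quotient \<open>z\<close> of \<open>x\<close> by its approximation at
      level \<open>i\<close> lies in \<open>B (E * n)\<close>; at that scale its exponents are at
      most \<open>Kb * (E * n) ^ i = Q * n ^ i\<close>.\<close>
    define E where "E = Suc (D0 + K0 + C)"
    define Q where "Q = Kb * E ^ i"
    have "\<exists>F. finite F \<and> card F \<le> M0 * (2 * Q + 1) ^ ?l \<and> F \<subseteq> B ((D0 + ?l * (Q * K1)) * n) \<and>
      (\<forall>x\<in>B (C * n). \<exists>f\<in>F. \<exists>b\<in>B ((K0 + ?l * K1) * n). coset_eq G ?N x (f \<otimes> b))" if n: "0 < n" for n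
    proof -
      obtain F where F: "finite F" "card F \<le> M0" "F \<subseteq> B (D0 * n)"
        "\<And>x. x \<in> B (C * n) \<Longrightarrow> \<exists>f\<in>F. \<exists>b\<in>B (K0 * n). coset_eq G (\<Gamma> i) x (f \<otimes> b)"
        using MD[OF n] by blast
      \<comment> \<open>Words of length \<open>O(n)\<close> for the powers with exponent
        \<open>n ^ i\<close>; at most \<open>Q\<close> copies of each enter a new centre, whose
        length is therefore still \<open>O(n)\<close>.\<close>
      have "\<forall>t\<in>set ts. \<exists>b. b \<in> B (K1 * n) \<and> coset_eq G ?N (t [^] int (n ^ i)) b"
        using K1[OF _ n, of _ "int (n ^ i)"] by auto
      then obtain \<tau> where \<tau>: "\<And>t. t \<in> set ts \<Longrightarrow> \<tau> t \<in> B (K1 * n)"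
        "\<And>t. t \<in> set ts \<Longrightarrow> coset_eq G ?N (t [^] int (n ^ i)) (\<tau> t)"
        by (metis bchoice)
      have tG: "t \<in> \<Gamma> i" "t \<in> carrier G" if "t \<in> set ts" for t using ts that filt_in_carr by auto
      have \<tau>G: "\<tau> t \<in> \<Gamma> i" if "t \<in> set ts" for t
        by (rule coset_eq_memD[OF normal_filt \<tau>(2)[OF that] _ filt_decr filt_subgroup])
          (rule subgroup_int_pow_closed[OF filt_subgroup tG(1)[OF that]])
      define QS where "QS = PiE (set ts) (\<lambda>_. {- int Q..int Q})"
      define h where "h q = product_list G (map (\<lambda>t. \<tau> t [^] (q t :: int)) ts)" for q
      have QS: "finite QS" "card QS \<le> (2 * Q + 1) ^ ?l"
      proof -
        show "finite QS" unfolding QS_def by (intro finite_PiE) auto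
        have "card QS = (2 * Q + 1) ^ card (set ts)"
          unfolding QS_def by (simp add: card_PiE nat_add_distrib nat_mult_distrib)
        also have "\<dots> \<le> (2 * Q + 1) ^ ?l" by (intro power_increasing card_length) auto
        finally show "card QS \<le> (2 * Q + 1) ^ ?l" .
      qed
      have hB: "h q \<in> B (?l * (Q * K1) * n)" if q: "q \<in> QS" for q
      proof -
        have "\<tau> t [^] q t \<in> B (Q * (K1 * n))" if "t \<in> set ts" for t
        proof -
          have "nat \<bar>q t\<bar> \<le> Q" using q that by (auto simp: QS_def PiE_iff)
          then have "nat \<bar>q t\<bar> * (K1 * n) \<le> Q * (K1 * n)" by simp
          then show ?thesis using ball_int_pow[OF \<tau>(1)[OF that], of "q t"] ball_mono by blast
        qed
        then have "h q \<in> B (?l * (Q * (K1 * n)))" unfolding h_def by (rule ball_product_list)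
        then show ?thesis by (simp only: mult.assoc)
      qed
      have hG: "h q \<in> \<Gamma> i" for q unfolding h_def
        by (rule product_list_subgroup[OF filt_subgroup])
          (use subgroup_int_pow_closed[OF filt_subgroup \<tau>G] in auto)
      let ?F = "(\<lambda>(f, q). f \<otimes> h q) ` (F \<times> QS)"
      have "finite ?F" using F QS by simp
      moreover have "card ?F \<le> M0 * (2 * Q + 1) ^ ?l"
      proof -
        have "card ?F \<le> card (F \<times> QS)" using F QS by (intro card_image_le) simp
        also have "\<dots> \<le> M0 * (2 * Q + 1) ^ ?l" unfolding card_cartesian_product using F QS by (intro mult_le_mono)
        finally show ?thesis .
      qed
      moreover have "?F \<subseteq> B ((D0 + ?l * (Q * K1)) * n)"
        using F(3) hB ball_mult by (fastforce simp: distrib_right)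
      moreover have "\<exists>f\<in>?F. \<exists>b\<in>B ((K0 + ?l * K1) * n). coset_eq G ?N x (f \<otimes> b)" if x: "x \<in> B (C * n)" for x
      proof -
        obtain f b where fb: "f \<in> F" "b \<in> B (K0 * n)" "coset_eq G (\<Gamma> i) x (f \<otimes> b)" using F(4)[OF x] by blast
        have c: "f \<in> carrier G" "b \<in> carrier G" "x \<in> carrier G"
          using F(3) fb x ball_carr by blast+
        define z where "z = inv (f \<otimes> b) \<otimes> x"
        have zG: "z \<in> \<Gamma> i" using coset_eq_sym[OF normal_filt fb(3)] by (simp add: coset_eq_def z_def)
        have "z \<in> B ((D0 * n + K0 * n) + C * n)"
          unfolding z_def by (intro ball_mult ball_inv x fb) (use F fb in blast)
        moreover have "(D0 * n + K0 * n) + C * n \<le> E * n" by (simp add: E_def distrib_right)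
        ultimately have zB: "z \<in> B (E * n)" using ball_mono by blast
        have "0 < E * n" using n by (simp add: E_def)
        then obtain a :: "'a \<Rightarrow> int" where a: "\<And>t. \<bar>a t\<bar> \<le> int (Kb * (E * n) ^ i)"
          "coset_eq G ?N z (product_list G (map (\<lambda>t. t [^] a t) ts))"
          using Kb[of "E * n" z] zG zB by blast
        define q where "q = restrict (\<lambda>t. a t div int (n ^ i)) (set ts)"
        define r where "r t = a t mod int (n ^ i)" for t
        have np: "0 < int (n ^ i)" using n by simp
        have aqr: "a t = int (n ^ i) * q t + r t" if "t \<in> set ts" for t
          using that by (simp add: q_def r_def)
        have rb: "\<bar>r t\<bar> \<le> int (n ^ i)" for t
          using pos_mod_bound[OF np, of "a t"] pos_mod_sign[OF np, of "a t"] unfolding r_def by linarith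
        have "q \<in> QS" unfolding QS_def q_def
        proof (intro restrict_PiE_iff[THEN iffD2] ballI)
          fix t
          have "\<bar>a t\<bar> \<le> int Q * int (n ^ i)" using a(1)[of t] by (simp add: Q_def power_mult_distrib mult_ac)
          then have "a t \<le> int Q * int (n ^ i)" "- int Q * int (n ^ i) \<le> a t" by auto
          moreover have "z * int (n ^ i) div int (n ^ i) = z" for z
            by (rule nonzero_mult_div_cancel_right) (use np in linarith)
          ultimately show "a t div int (n ^ i) \<in> {- int Q..int Q}"
            using zdiv_mono1[OF _ np] by (metis atLeastAtMost_iff)
        qed
        have "\<forall>t\<in>set ts. \<exists>b. b \<in> B (K1 * n) \<and> coset_eq G ?N (t [^] r t) b"
          using K1[OF _ n rb] by blast
        then obtain \<rho> where \<rho>: "\<And>t. t \<in> set ts \<Longrightarrow> \<rho> t \<in> B (K1 * n)"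
          "\<And>t. t \<in> set ts \<Longrightarrow> coset_eq G ?N (t [^] r t) (\<rho> t)"
          by (metis bchoice)
        have \<rho>G: "\<rho> t \<in> \<Gamma> i" if "t \<in> set ts" for t
          by (rule coset_eq_memD[OF normal_filt \<rho>(2)[OF that] _ filt_decr filt_subgroup])
            (rule subgroup_int_pow_closed[OF filt_subgroup tG(1)[OF that]])
        define b' where "b' = product_list G (map \<rho> ts)"
        have b'B: "b' \<in> B (?l * (K1 * n))" unfolding b'_def by (rule ball_product_list[OF \<rho>(1)])
        have "coset_eq G ?N (t [^] a t) (\<tau> t [^] q t \<otimes> \<rho> t)" if "t \<in> set ts" for t
        proof -
          have "t [^] a t = (t [^] int (n ^ i)) [^] q t \<otimes> t [^] r t"
            using aqr[OF that] tG[OF that] by (simp only: int_pow_mult int_pow_pow)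
          then show ?thesis
            using filt_mult[OF coset_eq_int_pow[OF normal_filt \<tau>(2)[OF that]] \<rho>(2)[OF that]] by simp
        qed
        then have "coset_eq G ?N (product_list G (map (\<lambda>t. t [^] a t) ts))
           (product_list G (map (\<lambda>t. \<tau> t [^] q t \<otimes> \<rho> t) ts))" by (rule product_list_cong_filt)
        also have "coset_eq G ?N \<dots> (h q \<otimes> b')" unfolding h_def b'_def
          by (rule product_list_mult_central[OF normal_filt])
              (use filt_in_carr[OF \<rho>G] filt_in_carr[OF \<tau>G] filt_commut[OF \<rho>G, of _ _ 1] filt_1 in auto)
        finally have zh: "coset_eq G ?N z (h q \<otimes> b')" by (rule filt_trans[OF a(2)])
        have c': "h q \<in> carrier G" "b' \<in> carrier G" using hG filt_in_carr b'B ball_carr by blast+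
        have "x = f \<otimes> b \<otimes> z" using c by (simp add: z_def word_simps)
        also have "coset_eq G ?N \<dots> (f \<otimes> b \<otimes> (h q \<otimes> b'))"
          using filt_mult[OF filt_refl zh, of "f \<otimes> b"] c by simp
        also have "f \<otimes> b \<otimes> (h q \<otimes> b') = f \<otimes> (b \<otimes> h q) \<otimes> b'" using c c' by (simp add: m_assoc)
        \<comment> \<open>\<open>h q\<close> lies in \<open>\<Gamma> i\<close> and so commutes with
          \<open>b\<close> modulo \<open>\<Gamma> (i + 1)\<close>; this joins it to the centre
          \<open>f\<close>.\<close>
        also have "coset_eq G ?N \<dots> (f \<otimes> (h q \<otimes> b) \<otimes> b')"
          by (rule filt_mult[OF filt_mult[OF filt_refl filt_central] filt_refl]) (use c c' hG in simp_all)
        also have "f \<otimes> (h q \<otimes> b) \<otimes> b' = (f \<otimes> h q) \<otimes> (b \<otimes> b')" using c c' by (simp add: m_assoc)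
        finally have eq: "coset_eq G ?N x ((f \<otimes> h q) \<otimes> (b \<otimes> b'))" .
        have "b \<otimes> b' \<in> B ((K0 + ?l * K1) * n)"
          using ball_mult[OF fb(2) b'B] by (simp only: distrib_right mult.assoc)
        moreover have "f \<otimes> h q \<in> ?F" using fb(1) \<open>q \<in> QS\<close> by force
        ultimately show ?thesis using eq by blast
      qed
      ultimately show ?thesis by blast
    qed
    then show ?thesis by blast
  qed
  then show ?case by (intro exI[of _ "K0 + ?l * K1"]) blast
qed

text \<open>At level \<open>c + 1\<close> congruence is equality, so the ball of radius
  \<open>4 * L * n\<close> is covered by \<open>M\<close> translates of the ball of radius
  \<open>K * n\<close>. Radii that are not multiples of \<open>L\<close> are rounded, and those
  below \<open>L\<close> are covered by a constant.\<close>

theorem volume_doubling: "\<exists>M. \<forall>n>0. card (B (2 * n)) \<le> M * card (B n)"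
proof -
  obtain K where K: "\<And>C. \<exists>M D. \<forall>n>0. \<exists>F. finite F \<and> card F \<le> M \<and> F \<subseteq> B (D * n) \<and>
    (\<forall>x\<in>B (C * n). \<exists>f\<in>F. \<exists>b\<in>B (K * n). coset_eq G (\<Gamma> (Suc c)) x (f \<otimes> b))"
    using covering[of "Suc c"] by blast
  \<comment> \<open>In \<open>covering\<close> the constant \<open>K\<close> precedes
    \<open>C\<close>, so the large radius may be chosen after the small one.\<close>
  define L where "L = Suc K"
  obtain M D where M: "\<And>n. 0 < n \<Longrightarrow> \<exists>F. finite F \<and> card F \<le> M \<and> F \<subseteq> B (D * n) \<and>
    (\<forall>x\<in>B (4 * L * n). \<exists>f\<in>F. \<exists>b\<in>B (K * n). coset_eq G (\<Gamma> (Suc c)) x (f \<otimes> b))"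
    using K[of "4 * L"] by blast
  have cov: "card (B (4 * L * n)) \<le> M * card (B (L * n))" if n: "0 < n" for n
  proof -
    obtain F where F: "finite F" "card F \<le> M" "F \<subseteq> B (D * n)"
      "\<And>x. x \<in> B (4 * L * n) \<Longrightarrow> \<exists>f\<in>F. \<exists>b\<in>B (K * n). coset_eq G (\<Gamma> (Suc c)) x (f \<otimes> b)"
      using M[OF n] by blast
    have "B (4 * L * n) \<subseteq> (\<lambda>(f, b). f \<otimes> b) ` (F \<times> B (K * n))"
    proof
      fix x assume "x \<in> B (4 * L * n)"
      then obtain f b where fb: "f \<in> F" "b \<in> B (K * n)" "coset_eq G {\<one>} x (f \<otimes> b)"
        using F(4) unfolding filt_top by blast
      then have "inv x \<otimes> (f \<otimes> b) = \<one>" "x \<in> carrier G" "f \<otimes> b \<in> carrier G" by (auto simp: coset_eq_def)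
      then have "x = f \<otimes> b" using inv_solve_left[of \<one> x "f \<otimes> b"] by simp
      then show "x \<in> (\<lambda>(f, b). f \<otimes> b) ` (F \<times> B (K * n))" using fb by (intro rev_image_eqI[of "(f, b)"]) auto
    qed
    then have "card (B (4 * L * n)) \<le> card ((\<lambda>(f, b). f \<otimes> b) ` (F \<times> B (K * n)))"
      using F(1) finite_ball by (intro card_mono) auto
    also have "\<dots> \<le> card (F \<times> B (K * n))" using F(1) finite_ball by (intro card_image_le) auto
    also have "\<dots> \<le> M * card (B (L * n))" unfolding card_cartesian_product
      using F(2) by (intro mult_le_mono card_mono finite_ball ball_mono) (auto simp: L_def)
    finally show ?thesis .
  qed
  have "card (B (2 * m)) \<le> (M + card (B (2 * L))) * card (B m)" if m: "0 < m" for m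
  proof (cases "L \<le> m")
    case True
    define n where "n = m div L"
    have n: "0 < n" using True by (simp add: n_def div_greater_zero_iff L_def)
    have "L * n \<le> m" by (simp add: n_def)
    have "m = L * n + m mod L" by (simp add: n_def)
    moreover have "m mod L < L" by (simp add: L_def)
    moreover have "L \<le> L * n" using n by simp
    ultimately have "2 * m \<le> 4 * L * n" by linarith
    then have "card (B (2 * m)) \<le> card (B (4 * L * n))" by (intro card_mono finite_ball ball_mono)
    also have "\<dots> \<le> M * card (B (L * n))" using cov[OF n] .
    also have "\<dots> \<le> M * card (B m)" using \<open>L * n \<le> m\<close> by (intro mult_le_mono2 card_mono finite_ball ball_mono)
    finally show ?thesis by (simp add: distrib_right)
  next
    case False
    then have "card (B (2 * m)) \<le> card (B (2 * L))" by (intro card_mono finite_ball ball_mono) simp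
    moreover have "0 < card (B m)" using ball_one finite_ball by (metis card_gt_0_iff empty_iff)
    ultimately have "card (B (2 * m)) \<le> card (B (2 * L)) * card (B m)"
      by (metis Suc_leI One_nat_def le_trans mult.right_neutral mult_le_mono2)
    then show ?thesis by (simp add: distrib_right)
  qed
  then show ?thesis by blast
qed

end

lemma (in group) nilpotent_volume_doubling:
  assumes "nilpotent_group G" "finite S" "S \<subseteq> carrier G" "\<And>x. x \<in> S \<Longrightarrow> inv x \<in> S" "generate G S = carrier G"
  shows "\<exists>M. \<forall>n>0. card (word_ball S (2 * n)) \<le> M * card (word_ball S n)"
proof -
  obtain c where c: "lower_central G c = {\<one>}" using assms(1) by (auto simp: nilpotent_group_def)
  \<comment> \<open>With truncated subtraction the terms \<open>0\<close> and \<open>1\<close> of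
    the filtration are both the whole group; commutators with index \<open>0\<close> are handled by
    normality alone.\<close>
  interpret nilpotent_filtration G "\<lambda>i. lower_central G (i - 1)" c S
  proof (intro nilpotent_filtration.intro nilpotent_filtration_axioms.intro)
    fix x y i j assume x: "x \<in> lower_central G (i - 1)" and y: "y \<in> lower_central G (j - 1)"
    have carr: "lower_central G n \<subseteq> carrier G" for n using normal_lower_central normal_subset by blast
    show "commut G x y \<in> lower_central G (i + j - 1)"
    proof (cases "i = 0 \<or> j = 0")
      case True
      then consider "i = 0" | "j = 0" by blast
      then show ?thesis
      proof cases
        case 1
        then show ?thesis using normal_commut(1)[OF normal_lower_central _ y, of x] x carr[of 0] by auto
      next
        case 2
        then show ?thesis using normal_commut(2)[OF normal_lower_central _ x, of y] y carr[of 0] by auto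
      qed
    next
      case False
      then have eq: "i + j - 1 = Suc ((i - 1) + (j - 1))" by linarith
      show ?thesis unfolding eq by (rule commut_lower_central[OF x y])
    qed
  next
    fix i :: nat assume "0 < i"
    then obtain j where "i = Suc j" by (cases i) auto
    then show "lower_central G (Suc i - 1) = generate G {commut G h k | h k. h \<in> lower_central G (i - 1) \<and> k \<in> carrier G}"
      by (simp add: commut_subgroup_eq)
  next
    fix i show "lower_central G (Suc i - 1) \<subseteq> lower_central G (i - 1)"
      using lower_central_decr[of "i - 1"] by (cases i) auto
  qed (use is_group assms c normal_lower_central in simp_all)
  show ?thesis by (rule volume_doubling)
qed

section \<open>Lazy walks by isometries\<close>

text \<open>Covers the twisted and the plain walk alike. The letter \<open>e\<close> acting as the
  identity is the laziness of the walk, on which \<open>gradient_bound\<close> rests; the pairing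
  \<open>iv\<close> makes the averaging operator self-adjoint.\<close>

locale lazy_walk =
  fixes A :: "'l set" and U :: "'l \<Rightarrow> 'v::real_inner \<Rightarrow> 'v" and e :: 'l and iv :: "'l \<Rightarrow> 'l"
  assumes fin_A: "finite A" and e_in: "e \<in> A" and U_e: "U e v = v"
    and U_lin: "linear (U a)" and U_norm: "norm (U a v) = norm v"
    and iv_in: "a \<in> A \<Longrightarrow> iv a \<in> A" and iv_iv: "a \<in> A \<Longrightarrow> iv (iv a) = a"
    and U_adj: "a \<in> A \<Longrightarrow> inner (U a v) w = inner v (U (iv a) w)"
begin

definition deg :: real where "deg = real (card A)"

definition P :: "'v \<Rightarrow> 'v" where "P v = (1 / deg) *\<^sub>R (\<Sum>a\<in>A. U a v)"

lemma deg_pos: "0 < deg" "1 \<le> deg"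
  using fin_A e_in unfolding deg_def by (auto simp: card_gt_0_iff Suc_le_eq)

lemma sum_U: "(\<Sum>a\<in>A. U a v) = deg *\<^sub>R P v"
  using deg_pos by (simp add: P_def)

lemma linear_P: "linear P"
proof (rule linearI)
  show "P (x + y) = P x + P y" for x y
    by (simp add: P_def linear_add[OF U_lin] sum.distrib scaleR_add_right)
  show "P (r *\<^sub>R x) = r *\<^sub>R P x" for r x
    by (simp add: P_def linear_scale[OF U_lin] flip: scaleR_sum_right)
qed

lemma P_sym: "inner (P v) w = inner v (P w)"
proof -
  have "(\<Sum>a\<in>A. inner v (U (iv a) w)) = (\<Sum>a\<in>A. inner v (U a w))"
    by (rule sum.reindex_bij_witness[of _ iv iv]) (auto simp: iv_in iv_iv)
  then have "(\<Sum>a\<in>A. inner (U a v) w) = (\<Sum>a\<in>A. inner v (U a w))"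
    using U_adj by simp
  then show ?thesis by (simp add: P_def inner_sum_left inner_sum_right)
qed

text \<open>A variance: the vectors \<open>U a v\<close> have mean \<open>P v\<close> and all have
  the norm of \<open>v\<close>.\<close>

lemma sum_norm_diff: "(\<Sum>a\<in>A. (norm (U a v - P v))\<^sup>2) = deg * ((norm v)\<^sup>2 - (norm (P v))\<^sup>2)"
proof -
  have "(norm (U a v - P v))\<^sup>2 = (norm v)\<^sup>2 + (norm (P v))\<^sup>2 - 2 * inner (U a v) (P v)" for a
    by (simp add: power2_norm_eq_inner inner_diff_left inner_diff_right inner_commute U_norm
        flip: U_norm[of a v, THEN arg_cong[of _ _ "\<lambda>x. x\<^sup>2"], unfolded power2_norm_eq_inner])
  then have "(\<Sum>a\<in>A. (norm (U a v - P v))\<^sup>2) =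
      deg * ((norm v)\<^sup>2 + (norm (P v))\<^sup>2) - 2 * inner (\<Sum>a\<in>A. U a v) (P v)"
    by (simp add: sum_subtractf inner_sum_left sum_distrib_left deg_def)
  then show ?thesis by (simp add: sum_U power2_norm_eq_inner algebra_simps)
qed

lemma norm_diff_sq: "(norm (x - y))\<^sup>2 \<le> 2 * (norm (x - z))\<^sup>2 + 2 * (norm (y - z :: 'v))\<^sup>2"
proof -
  have "0 \<le> (norm ((x - z) + (y - z)))\<^sup>2" by simp
  then show ?thesis
    by (simp add: power2_norm_eq_inner inner_add_left inner_add_right inner_diff_left inner_diff_right inner_commute)
qed

text \<open>Both \<open>v = U e v\<close> and \<open>U a v\<close> occur in the variance, which
  bounds their distance through \<open>P v\<close>. Without the lazy letter the vectors
  \<open>U a v\<close> could all be close to \<open>- v\<close> with hardly any loss of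
  norm.\<close>

lemma gradient_bound:
  assumes a: "a \<in> A"
  shows "(norm (v - U a v))\<^sup>2 \<le> 2 * deg * ((norm v)\<^sup>2 - (norm (P v))\<^sup>2)"
proof -
  have S: "0 \<le> deg * ((norm v)\<^sup>2 - (norm (P v))\<^sup>2)"
    unfolding sum_norm_diff[symmetric] by (intro sum_nonneg) auto
  show ?thesis
  proof (cases "a = e")
    case True then show ?thesis using S U_e by simp
  next
    case False
    have "(\<Sum>b\<in>{e, a}. (norm (U b v - P v))\<^sup>2) \<le> (\<Sum>a\<in>A. (norm (U a v - P v))\<^sup>2)"
      using a e_in fin_A by (intro sum_mono2) auto
    then have "(norm (v - P v))\<^sup>2 + (norm (U a v - P v))\<^sup>2 \<le> deg * ((norm v)\<^sup>2 - (norm (P v))\<^sup>2)"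
      using False U_e by (simp add: sum_norm_diff)
    then show ?thesis using norm_diff_sq[of v "U a v" "P v"] by linarith
  qed
qed

lemma norm_P_le: "norm (P v) \<le> norm v"
proof -
  have "0 \<le> deg * ((norm v)\<^sup>2 - (norm (P v))\<^sup>2)"
    unfolding sum_norm_diff[symmetric] by (intro sum_nonneg) auto
  then have "(norm (P v))\<^sup>2 \<le> (norm v)\<^sup>2" using deg_pos by (simp add: zero_le_mult_iff)
  then show ?thesis using power2_le_imp_le norm_ge_zero by blast
qed

text \<open>Telescoping along the word; the isometries reduce each step to the displacement of
  \<open>v\<close> by one letter.\<close>

lemma path_bound:
  assumes "set w \<subseteq> A"
  shows "norm (v - foldr U w v) \<le> length w * sqrt (2 * deg * ((norm v)\<^sup>2 - (norm (P v))\<^sup>2))"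
  using assms
proof (induction w)
  case (Cons a w)
  let ?g = "sqrt (2 * deg * ((norm v)\<^sup>2 - (norm (P v))\<^sup>2))"
  have "v - foldr U (a # w) v = (v - U a v) + U a (v - foldr U w v)"
    by (simp add: linear_diff[OF U_lin])
  then have "norm (v - foldr U (a # w) v) \<le> norm (v - U a v) + norm (v - foldr U w v)"
    using norm_triangle_ineq U_norm by metis
  also have "\<dots> \<le> ?g + length w * ?g"
    using Cons gradient_bound[of a v] by (intro add_mono real_le_rsqrt) auto
  finally show ?case by (simp add: algebra_simps)
qed simp

text \<open>The loop displaces \<open>v\<close> by \<open>2 * norm v\<close>, and each of its
  letters accounts for no more than the bound of \<open>gradient_bound\<close>; so the loss of norm
  cannot be small.\<close>

lemma spectral_gap:
  assumes "set w \<subseteq> A" "foldr U w v = - v"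
  shows "2 * (norm v)\<^sup>2 \<le> (length w)\<^sup>2 * deg * ((norm v)\<^sup>2 - (norm (P v))\<^sup>2)"
proof -
  have ge: "0 \<le> 2 * deg * ((norm v)\<^sup>2 - (norm (P v))\<^sup>2)"
    using norm_P_le deg_pos by (simp add: power_mono)
  have "2 * norm v \<le> length w * sqrt (2 * deg * ((norm v)\<^sup>2 - (norm (P v))\<^sup>2))"
    using path_bound[OF assms(1), of v] assms(2) norm_scaleR[of 2 v] by (simp add: scaleR_2)
  then have "(2 * norm v)\<^sup>2 \<le> (length w * sqrt (2 * deg * ((norm v)\<^sup>2 - (norm (P v))\<^sup>2)))\<^sup>2"
    by (intro power_mono) auto
  then have "2 * (2 * (norm v)\<^sup>2) \<le> 2 * ((length w)\<^sup>2 * deg * ((norm v)\<^sup>2 - (norm (P v))\<^sup>2))"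
    using ge by (simp add: power_mult_distrib algebra_simps)
  then show ?thesis by (simp add: mult_ac)
qed

text \<open>For a point mass and no twist this is the return probability after \<open>2 * n\<close>
  steps.\<close>

definition s :: "'v \<Rightarrow> nat \<Rightarrow> real" where "s v n = (norm ((P ^^ n) v))\<^sup>2"

lemma s_nonneg: "0 \<le> s v n" by (simp add: s_def)

lemma s_decr: "s v (Suc n) \<le> s v n"
  using norm_P_le by (simp add: s_def power_mono)

lemma s_antimono: "m \<le> n \<Longrightarrow> s v n \<le> s v m"
  using s_decr lift_Suc_antimono_le by blast

lemma inner_P_pow: "inner ((P ^^ m) v) ((P ^^ n) w) = inner ((P ^^ (m + n)) v) w"
proof (induction n arbitrary: m)
  case (Suc n)
  have "inner ((P ^^ m) v) (P ((P ^^ n) w)) = inner ((P ^^ Suc m) v) ((P ^^ n) w)"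
    using P_sym by simp
  then show ?case using Suc.IH[of "Suc m"] by simp
qed simp

lemma s_inner: "s v n = inner ((P ^^ (2 * n)) v) v"
  using inner_P_pow[of n v n v] by (simp add: s_def power2_norm_eq_inner mult_2)

text \<open>One \<open>P\<close> is moved across the inner product. Expanding the square of a
  difference then gives convexity of \<open>s v\<close>, and Cauchy-Schwarz gives
  log-convexity.\<close>

lemma s_Suc_inner: "s v (Suc n) = inner ((P ^^ Suc (Suc n)) v) ((P ^^ n) v)"
  using inner_P_pow[of "Suc n" v "Suc n" v] inner_P_pow[of "Suc (Suc n)" v n v]
  by (simp add: s_def power2_norm_eq_inner)

lemma s_convex: "s v (Suc n) - s v (Suc (Suc n)) \<le> s v n - s v (Suc n)"
proof -
  have "0 \<le> (norm ((P ^^ Suc (Suc n)) v - (P ^^ n) v))\<^sup>2" by simp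
  then show ?thesis using s_Suc_inner[of v n]
    by (simp add: s_def power2_norm_eq_inner inner_diff_left inner_diff_right inner_commute)
qed

lemma s_log_convex: "(s v (Suc n))\<^sup>2 \<le> s v n * s v (Suc (Suc n))"
  using Cauchy_Schwarz_ineq[of "(P ^^ Suc (Suc n)) v" "(P ^^ n) v"] s_Suc_inner[of v n]
  by (simp add: s_def power2_norm_eq_inner mult.commute)

text \<open>By convexity the decrements of \<open>s v\<close> decrease, so the one at
  \<open>2 * m\<close> is at most the mean of the \<open>m\<close> decrements before it, which
  telescope.\<close>

lemma s_gradient: "real m * (s v (2 * m) - s v (Suc (2 * m))) \<le> s v m"
proof -
  have d: "s v (j + i) - s v (Suc (j + i)) \<le> s v j - s v (Suc j)" for i j
  proof (induction i)
    case (Suc i) then show ?case using s_convex[of v "j + i"] by simp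
  qed simp
  have "real m * (s v (2 * m) - s v (Suc (2 * m))) = (\<Sum>i<m. s v (2 * m) - s v (Suc (2 * m)))" by simp
  also have "\<dots> \<le> (\<Sum>i<m. s v (m + i) - s v (Suc (m + i)))"
  proof (intro sum_mono)
    fix i assume "i \<in> {..<m}"
    then show "s v (2 * m) - s v (Suc (2 * m)) \<le> s v (m + i) - s v (Suc (m + i))"
      using d[of "m + i" "m - i"] by (simp add: mult_2)
  qed
  also have "\<dots> = s v m - s v (m + m)"
    using sum_lessThan_telescope'[of "\<lambda>i. s v (m + i)" m] by simp
  also have "\<dots> \<le> s v m" using s_nonneg by simp
  finally show ?thesis .
qed

text \<open>The pseudo-Poincare inequality: relative to \<open>sqrt (s v m)\<close>, the iterate
  hardly moves under words that are short against the square root of \<open>m\<close>.\<close>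

lemma path_bound_iterate:
  assumes "set w \<subseteq> A" "length w \<le> r" "0 < m"
  shows "norm ((P ^^ (2 * m)) v - foldr U w ((P ^^ (2 * m)) v)) \<le> r * sqrt (2 * deg * s v m / m)"
proof -
  have "norm ((P ^^ (2 * m)) v - foldr U w ((P ^^ (2 * m)) v))
     \<le> length w * sqrt (2 * deg * (s v (2 * m) - s v (Suc (2 * m))))"
    using path_bound[OF assms(1), of "(P ^^ (2 * m)) v"] by (simp add: s_def)
  also have "\<dots> \<le> r * sqrt (2 * deg * s v m / m)"
  proof (intro mult_mono real_sqrt_le_mono)
    have "s v (2 * m) - s v (Suc (2 * m)) \<le> s v m / m"
      using s_gradient[of m v] assms by (simp add: field_simps)
    then show "2 * deg * (s v (2 * m) - s v (Suc (2 * m))) \<le> 2 * deg * s v m / m"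
      using deg_pos mult_left_mono[of _ _ "2 * deg"] by fastforce
  qed (use assms s_decr[of v "2 * m"] deg_pos in auto)
  finally show ?thesis .
qed

text \<open>Small displacement by every letter makes \<open>inner (P v) v\<close> large, which
  bounds the first quotient \<open>s v 1 / s v 0\<close> from below. By log-convexity the later
  quotients are no smaller.\<close>

lemma s_power_lower:
  assumes "v \<noteq> 0" "0 \<le> D" "D \<le> 2 * (norm v)\<^sup>2" "\<And>a. a \<in> A \<Longrightarrow> (norm (v - U a v))\<^sup>2 \<le> D"
  shows "(norm v)\<^sup>2 * (1 - D / (2 * (norm v)\<^sup>2)) ^ (2 * m) \<le> s v m"
proof -
  let ?z = "(norm v)\<^sup>2"
  have z: "0 < ?z" using assms by simp
  have "?z - D / 2 \<le> inner (U a v) v" if "a \<in> A" for a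
  proof -
    have "(norm (v - U a v))\<^sup>2 = 2 * ?z - 2 * inner (U a v) v"
      using U_norm[of a v, THEN arg_cong[of _ _ "\<lambda>x. x\<^sup>2"]]
      by (simp add: power2_norm_eq_inner inner_diff_left inner_diff_right inner_commute)
    then show ?thesis using assms(4)[OF that] by linarith
  qed
  then have "(\<Sum>a\<in>A. ?z - D / 2) \<le> (\<Sum>a\<in>A. inner (U a v) v)" by (intro sum_mono)
  then have "deg * (?z - D / 2) \<le> deg * inner (P v) v"
    by (simp add: deg_def[symmetric] sum_U flip: inner_sum_left)
  then have ip: "?z - D / 2 \<le> inner (P v) v" using deg_pos by simp
  define q where "q = (1 - D / (2 * ?z))\<^sup>2"
  have q0: "0 \<le> q" by (simp add: q_def)
  have "(?z - D / 2)\<^sup>2 \<le> (inner (P v) v)\<^sup>2" using ip assms by (intro power_mono) auto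
  also have "\<dots> \<le> ?z * s v 1"
    using Cauchy_Schwarz_ineq[of "P v" v] by (simp add: s_def power2_norm_eq_inner mult.commute)
  finally have "(?z - D / 2)\<^sup>2 \<le> ?z * s v 1" .
  moreover have eq: "?z - D / 2 = ?z * (1 - D / (2 * ?z))" using z by (simp add: field_simps)
  moreover have "(?z - D / 2)\<^sup>2 = ?z * (?z * q)"
    unfolding eq q_def power_mult_distrib power2_eq_square[of ?z] by (simp only: mult.assoc)
  ultimately have "?z * (?z * q) \<le> ?z * s v 1" by simp
  then have s1: "q * s v 0 \<le> s v 1" using z by (simp add: s_def mult.commute)
  have step: "q * s v n \<le> s v (Suc n)" for n
  proof (induction n)
    case 0 then show ?case using s1 by simp
  next
    case (Suc n)
    show ?case
    proof (cases "s v (Suc n) = 0")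
      case True then show ?thesis using s_nonneg by simp
    next
      case False
      then have pos: "0 < s v (Suc n)" using s_nonneg[of v "Suc n"] by simp
      then have pos': "0 < s v n" using s_decr[of v n] by linarith
      have "q * s v n * s v (Suc n) \<le> s v (Suc n) * s v (Suc n)" using Suc pos by (intro mult_right_mono) auto
      also have "\<dots> \<le> s v n * s v (Suc (Suc n))" using s_log_convex[of v n] by (simp add: power2_eq_square)
      finally have "s v n * (q * s v (Suc n)) \<le> s v n * s v (Suc (Suc n))" by (simp only: mult_ac)
      then show ?thesis using pos' by simp
    qed
  qed
  have "q ^ m * s v 0 \<le> s v m"
  proof (induction m)
    case (Suc m)
    have "q ^ Suc m * s v 0 = q * (q ^ m * s v 0)" by simp
    also have "\<dots> \<le> q * s v m" using Suc q0 by (intro mult_left_mono)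
    also have "\<dots> \<le> s v (Suc m)" by (rule step)
    finally show ?case .
  qed simp
  then show ?thesis by (simp add: s_def q_def mult.commute flip: power_mult)
qed

section \<open>Expansion of the iterates over words\<close>

definition words :: "nat \<Rightarrow> 'l list set" where "words n = {w. set w \<subseteq> A \<and> length w = n}"

lemma finite_words: "finite (words n)"
  unfolding words_def by (rule finite_lists_length_eq[OF fin_A])

lemma card_words: "real (card (words n)) = deg ^ n"
  unfolding words_def by (simp add: card_lists_length_eq[OF fin_A] deg_def)

lemma P_pow_expand: "deg ^ n *\<^sub>R (P ^^ n) v = (\<Sum>w\<in>words n. foldr U w v)"
proof (induction n)
  case 0
  have "words 0 = {[]}" by (auto simp: words_def)
  then show ?case by simp
next
  case (Suc n)
  have W: "words (Suc n) = (\<lambda>(a, w). a # w) ` (A \<times> words n)"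
    by (auto simp: words_def length_Suc_conv image_iff)
  have inj: "inj_on (\<lambda>(a, w). a # w) (A \<times> words n)" by (auto simp: inj_on_def)
  have "(\<Sum>w\<in>words (Suc n). foldr U w v) = (\<Sum>(a, w)\<in>A \<times> words n. U a (foldr U w v))"
    unfolding W sum.reindex[OF inj] by (intro sum.cong) auto
  also have "\<dots> = (\<Sum>a\<in>A. U a (\<Sum>w\<in>words n. foldr U w v))"
    unfolding linear_sum[OF U_lin] by (simp add: sum.cartesian_product)
  also have "\<dots> = (\<Sum>a\<in>A. U a (deg ^ n *\<^sub>R (P ^^ n) v))" by (simp only: Suc)
  also have "\<dots> = deg *\<^sub>R P (deg ^ n *\<^sub>R (P ^^ n) v)" by (rule sum_U)
  also have "\<dots> = deg ^ Suc n *\<^sub>R (P ^^ Suc n) v" by (simp add: linear_scale[OF linear_P])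
  finally show ?case by simp
qed

end

section \<open>Twisted random walks\<close>

text \<open>A space that contains all iterates of a point mass, since these have finite support. Its
  inner product below is the real part of the Hermitian one.\<close>

typedef 'a fin_fun = "{f :: 'a \<Rightarrow> complex. finite {x. f x \<noteq> 0}}"
  morphisms fun_app Abs_fin_fun
  by (intro exI[of _ "\<lambda>_. 0"]) simp

setup_lifting type_definition_fin_fun

definition fsupport :: "'a fin_fun \<Rightarrow> 'a set" where "fsupport f = {x. fun_app f x \<noteq> 0}"

lemma finite_fsupport: "finite (fsupport f)"
  unfolding fsupport_def using fun_app by blast

lemma in_fsupport [simp]: "x \<in> fsupport f \<longleftrightarrow> fun_app f x \<noteq> 0"
  by (simp add: fsupport_def)

lemma fin_fun_eqI: "(\<And>x. fun_app f x = fun_app g x) \<Longrightarrow> f = g"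
  by (metis ext fun_app_inject)

instantiation fin_fun :: (type) real_vector
begin

lift_definition zero_fin_fun :: "'a fin_fun" is "\<lambda>_. 0" by simp

lift_definition plus_fin_fun :: "'a fin_fun \<Rightarrow> 'a fin_fun \<Rightarrow> 'a fin_fun" is "\<lambda>f g x. f x + g x"
proof -
  fix f g :: "'a \<Rightarrow> complex" assume "finite {x. f x \<noteq> 0}" "finite {x. g x \<noteq> 0}"
  then show "finite {x. f x + g x \<noteq> 0}"
    by (rule finite_subset[rotated, OF finite_UnI]) auto
qed

lift_definition uminus_fin_fun :: "'a fin_fun \<Rightarrow> 'a fin_fun" is "\<lambda>f x. - f x" by simp

lift_definition minus_fin_fun :: "'a fin_fun \<Rightarrow> 'a fin_fun \<Rightarrow> 'a fin_fun" is "\<lambda>f g x. f x - g x"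
proof -
  fix f g :: "'a \<Rightarrow> complex" assume "finite {x. f x \<noteq> 0}" "finite {x. g x \<noteq> 0}"
  then show "finite {x. f x - g x \<noteq> 0}"
    by (rule finite_subset[rotated, OF finite_UnI]) auto
qed

lift_definition scaleR_fin_fun :: "real \<Rightarrow> 'a fin_fun \<Rightarrow> 'a fin_fun" is "\<lambda>r f x. r *\<^sub>R f x"
  by (rule finite_subset) auto

instance
  by standard (transfer; simp add: algebra_simps)+

end

lemmas fun_app_simps [simp] = zero_fin_fun.rep_eq plus_fin_fun.rep_eq uminus_fin_fun.rep_eq
  minus_fin_fun.rep_eq scaleR_fin_fun.rep_eq

lemma fun_app_sum [simp]: "fun_app (sum F I) x = (\<Sum>i\<in>I. fun_app (F i) x)"
  by (induction I rule: infinite_finite_induct) auto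

instantiation fin_fun :: (type) real_inner
begin

definition inner_fin_fun :: "'a fin_fun \<Rightarrow> 'a fin_fun \<Rightarrow> real" where
  "inner_fin_fun f g = (\<Sum>x\<in>fsupport f. inner (fun_app f x) (fun_app g x))"

definition norm_fin_fun :: "'a fin_fun \<Rightarrow> real" where
  "norm_fin_fun f = sqrt (inner f f)"

definition sgn_fin_fun :: "'a fin_fun \<Rightarrow> 'a fin_fun" where
  "sgn_fin_fun f = f /\<^sub>R norm f"

definition dist_fin_fun :: "'a fin_fun \<Rightarrow> 'a fin_fun \<Rightarrow> real" where
  "dist_fin_fun f g = norm (f - g)"

definition uniformity_fin_fun :: "('a fin_fun \<times> 'a fin_fun) filter" where
  "uniformity_fin_fun = (INF e\<in>{0<..}. principal {(x, y). dist x y < e})"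

definition open_fin_fun :: "'a fin_fun set \<Rightarrow> bool" where
  "open_fin_fun U = (\<forall>x\<in>U. eventually (\<lambda>(x', y). x' = x \<longrightarrow> y \<in> U) uniformity)"

lemma inner_fin_fun_eq:
  assumes "finite D" "fsupport f \<subseteq> D"
  shows "inner f g = (\<Sum>x\<in>D. inner (fun_app f x) (fun_app g x))"
  unfolding inner_fin_fun_def using assms by (intro sum.mono_neutral_left) auto

instance
proof
  fix f g h :: "'a fin_fun" and r :: real
  let ?D = "fsupport f \<union> fsupport g"
  have fin: "finite ?D" using finite_fsupport by blast
  show "inner f g = inner g f"
    using inner_fin_fun_eq[OF fin, of f g] inner_fin_fun_eq[OF fin, of g f] by (simp add: inner_commute)
  have "fsupport (f + g) \<subseteq> ?D" by auto
  then show "inner (f + g) h = inner f h + inner g h"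
    using inner_fin_fun_eq[OF fin, of f h] inner_fin_fun_eq[OF fin, of g h] inner_fin_fun_eq[OF fin, of "f + g" h]
    by (simp add: inner_add_left sum.distrib)
  have "fsupport (r *\<^sub>R f) \<subseteq> ?D" by auto
  then show "inner (r *\<^sub>R f) g = r * inner f g"
    using inner_fin_fun_eq[OF fin, of f g] inner_fin_fun_eq[OF fin, of "r *\<^sub>R f" g]
    by (simp add: sum_distrib_left)
  show "0 \<le> inner f f" unfolding inner_fin_fun_def by (intro sum_nonneg) simp
  show "inner f f = 0 \<longleftrightarrow> f = 0"
  proof
    assume "inner f f = 0"
    then have "\<forall>x\<in>fsupport f. inner (fun_app f x) (fun_app f x) = 0"
      unfolding inner_fin_fun_def using finite_fsupport[of f] by (subst (asm) sum_nonneg_eq_0_iff) auto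
    then show "f = 0" by (intro fin_fun_eqI) auto
  qed (simp add: inner_fin_fun_def)
qed (simp_all add: norm_fin_fun_def sgn_fin_fun_def dist_fin_fun_def uniformity_fin_fun_def open_fin_fun_def)

end

lift_definition delta :: "'a \<Rightarrow> 'a fin_fun" is "\<lambda>x y. if y = x then 1 else 0"
  by simp

lemmas fun_app_delta [simp] = delta.rep_eq

lemma inner_delta: "inner f (delta x) = Re (fun_app f x)"
proof -
  have "inner f (delta x) = inner (delta x) f" by (rule inner_commute)
  also have "\<dots> = (\<Sum>y\<in>{x}. inner (fun_app (delta x) y) (fun_app f y))"
    by (rule inner_fin_fun_eq) (auto split: if_splits)
  also have "\<dots> = Re (fun_app f x)" by (simp add: inner_complex_def)
  finally show ?thesis .
qed

lemma norm_delta [simp]: "norm (delta x) = 1"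
  by (simp add: norm_eq_sqrt_inner inner_delta)

section \<open>Twisted translations and their random walk\<close>

lemma free_group_carrier: "w \<in> carrier (free_group d) \<longleftrightarrow> set w \<subseteq> letters d \<and> reduced_word w"
  by (auto simp: free_group_def)

lemma free_group_letter: "x \<in> letters d \<Longrightarrow> [x] \<in> carrier (free_group d)"
  by (simp add: free_group_carrier)

lemma free_group_inv_letter: "x \<in> letters d \<Longrightarrow> inv\<^bsub>free_group d\<^esub> [x] = [inv_letter x]"
  by (rule group.inv_equality[OF group_free_group]) (auto simp: free_group_letter, simp add: free_group_def reduce_def)

text \<open>Invariance of the character under conjugation makes the holonomy of a loop independent
  of the point of \<open>G\<close> at which it starts; see \<open>cocycle_of_Ker\<close>.\<close>

locale twisted_model = group G for G :: "('a, 'b) monoid_scheme" (structure) +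
  fixes d :: nat and q :: "gen_word \<Rightarrow> 'a" and \<omega> :: "gen_word \<Rightarrow> complex"
  assumes q_hom: "q \<in> hom (free_group d) G"
    and q_surj: "q ` carrier (free_group d) = carrier G"
    and \<omega>_norm: "u \<in> kernel (free_group d) G q \<Longrightarrow> cmod (\<omega> u) = 1"
    and \<omega>_mult: "u \<in> kernel (free_group d) G q \<Longrightarrow> v \<in> kernel (free_group d) G q \<Longrightarrow>
      \<omega> (u \<otimes>\<^bsub>free_group d\<^esub> v) = \<omega> u * \<omega> v"
    and \<omega>_conj: "u \<in> kernel (free_group d) G q \<Longrightarrow> g \<in> carrier (free_group d) \<Longrightarrow>
      \<omega> (g \<otimes>\<^bsub>free_group d\<^esub> u \<otimes>\<^bsub>free_group d\<^esub> inv\<^bsub>free_group d\<^esub> g) = \<omega> u"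
begin

abbreviation "F \<equiv> free_group d"

sublocale F: group F by (rule group_free_group)
sublocale q: group_hom F G q
  by (intro group_hom.intro group_hom_axioms.intro group_free_group is_group q_hom)

abbreviation "Ker \<equiv> kernel F G q"

definition sec :: "'a \<Rightarrow> gen_word" where
  "sec x = (SOME g. g \<in> carrier F \<and> q g = x)"

lemma sec:
  assumes "x \<in> carrier G"
  shows "sec x \<in> carrier F" "q (sec x) = x"
proof -
  have "x \<in> q ` carrier F" using assms q_surj by simp
  then obtain g where "g \<in> carrier F \<and> q g = x" by blast
  then have "sec x \<in> carrier F \<and> q (sec x) = x" unfolding sec_def by (rule someI)
  then show "sec x \<in> carrier F" "q (sec x) = x" by simp_all
qed

text \<open>The path \<open>g\<close> from \<open>x\<close>, closed up by the section at both ends,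
  is a loop; its character is the parallel transport along \<open>g\<close>.\<close>

definition cocycle :: "'a \<Rightarrow> gen_word \<Rightarrow> complex" where
  "cocycle x g = \<omega> (sec x \<otimes>\<^bsub>F\<^esub> g \<otimes>\<^bsub>F\<^esub> inv\<^bsub>F\<^esub> sec (x \<otimes> q g))"

lemma Ker_iff: "u \<in> Ker \<longleftrightarrow> u \<in> carrier F \<and> q u = \<one>"
  by (simp add: kernel_def)

lemma cocycle_Ker:
  "x \<in> carrier G \<Longrightarrow> g \<in> carrier F \<Longrightarrow> sec x \<otimes>\<^bsub>F\<^esub> g \<otimes>\<^bsub>F\<^esub> inv\<^bsub>F\<^esub> sec (x \<otimes> q g) \<in> Ker"
  using sec by (simp add: Ker_iff)

lemma norm_cocycle: "x \<in> carrier G \<Longrightarrow> g \<in> carrier F \<Longrightarrow> cmod (cocycle x g) = 1"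
  unfolding cocycle_def using cocycle_Ker \<omega>_norm by blast

lemma cocycle_mult:
  assumes "x \<in> carrier G" "g \<in> carrier F" "h \<in> carrier F"
  shows "cocycle x (g \<otimes>\<^bsub>F\<^esub> h) = cocycle x g * cocycle (x \<otimes> q g) h"
proof -
  have "cocycle x g * cocycle (x \<otimes> q g) h =
    \<omega> ((sec x \<otimes>\<^bsub>F\<^esub> g \<otimes>\<^bsub>F\<^esub> inv\<^bsub>F\<^esub> sec (x \<otimes> q g)) \<otimes>\<^bsub>F\<^esub>
       (sec (x \<otimes> q g) \<otimes>\<^bsub>F\<^esub> h \<otimes>\<^bsub>F\<^esub> inv\<^bsub>F\<^esub> sec (x \<otimes> q g \<otimes> q h)))"
    unfolding cocycle_def using assms cocycle_Ker by (intro \<omega>_mult[symmetric]) auto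
  also have "(sec x \<otimes>\<^bsub>F\<^esub> g \<otimes>\<^bsub>F\<^esub> inv\<^bsub>F\<^esub> sec (x \<otimes> q g)) \<otimes>\<^bsub>F\<^esub>
       (sec (x \<otimes> q g) \<otimes>\<^bsub>F\<^esub> h \<otimes>\<^bsub>F\<^esub> inv\<^bsub>F\<^esub> sec (x \<otimes> q g \<otimes> q h))
     = sec x \<otimes>\<^bsub>F\<^esub> (g \<otimes>\<^bsub>F\<^esub> h) \<otimes>\<^bsub>F\<^esub> inv\<^bsub>F\<^esub> sec (x \<otimes> q g \<otimes> q h)"
    using assms sec by (simp add: F.word_simps)
  finally show ?thesis using assms by (simp add: cocycle_def m_assoc)
qed

lemma cocycle_of_Ker:
  assumes "x \<in> carrier G" "u \<in> Ker"
  shows "cocycle x u = \<omega> u"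
  using assms sec \<omega>_conj by (simp add: cocycle_def Ker_iff)

lemma cocycle_one: "x \<in> carrier G \<Longrightarrow> cocycle x \<one>\<^bsub>F\<^esub> = 1"
  using cocycle_mult[of x "\<one>\<^bsub>F\<^esub>" "\<one>\<^bsub>F\<^esub>"] norm_cocycle[of x "\<one>\<^bsub>F\<^esub>"] by auto

text \<open>\<open>translate g\<close> is right translation by \<open>q g\<close> on functions \<open>f\<close> on the free group with
  \<open>f (u x) = \<omega> u * f x\<close> for \<open>u\<close> in the kernel, written in the trivialization given by the section
  \<open>sec\<close>.\<close>
definition translate_fun :: "gen_word \<Rightarrow> ('a \<Rightarrow> complex) \<Rightarrow> 'a \<Rightarrow> complex" where
  "translate_fun g f x = (if x \<in> carrier G \<and> g \<in> carrier F then cocycle x g * f (x \<otimes> q g) else f x)"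

lemma finite_translate_fun:
  assumes "finite {x. f x \<noteq> 0}"
  shows "finite {x. translate_fun g f x \<noteq> 0}"
proof (cases "g \<in> carrier F")
  case True
  define D where "D = (\<lambda>y. y \<otimes> inv (q g)) ` {x. f x \<noteq> 0} \<union> {x. f x \<noteq> 0}"
  have sub: "x \<in> D" if x: "translate_fun g f x \<noteq> 0" for x
  proof (cases "x \<in> carrier G")
    case True
    then have "f (x \<otimes> q g) \<noteq> 0" "x = (x \<otimes> q g) \<otimes> inv (q g)"
      using x \<open>g \<in> carrier F\<close> by (auto simp: translate_fun_def m_assoc split: if_splits)
    then show ?thesis unfolding D_def by blast
  qed (use x in \<open>auto simp: translate_fun_def D_def\<close>)
  have "finite D" using assms by (simp add: D_def)
  then show ?thesis by (rule finite_subset[rotated]) (use sub in blast)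
qed (use assms in \<open>auto simp: translate_fun_def\<close>)

definition translate :: "gen_word \<Rightarrow> 'a fin_fun \<Rightarrow> 'a fin_fun" where
  "translate g f = Abs_fin_fun (translate_fun g (fun_app f))"

lemma fun_app_translate: "fun_app (translate g f) = translate_fun g (fun_app f)"
  unfolding translate_def using finite_translate_fun[OF finite_fsupport[unfolded fsupport_def]]
  by (intro Abs_fin_fun_inverse) blast

lemma linear_translate: "linear (translate g)"
  by (rule linearI; rule fin_fun_eqI)
    (auto simp: fun_app_translate translate_fun_def algebra_simps)

lemma translate_one: "translate \<one>\<^bsub>F\<^esub> f = f"
  by (rule fin_fun_eqI) (auto simp: fun_app_translate translate_fun_def cocycle_one)

lemma translate_mult:
  assumes "g \<in> carrier F" "h \<in> carrier F"
  shows "translate g (translate h f) = translate (g \<otimes>\<^bsub>F\<^esub> h) f"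
  by (rule fin_fun_eqI)
    (use assms in \<open>auto simp: fun_app_translate translate_fun_def cocycle_mult m_assoc\<close>)

lemma inner_translate:
  assumes g: "g \<in> carrier F"
  shows "inner (translate g f) (translate g h) = inner f h"
proof -
  \<comment> \<open>The permutation that underlies \<open>translate g\<close>. It fixes all points
    off the carrier of \<open>G\<close>, so the isometry extends to functions on the whole
    type.\<close>
  define \<pi> where "\<pi> x = (if x \<in> carrier G then x \<otimes> q g else x)" for x
  define \<pi>' where "\<pi>' x = (if x \<in> carrier G then x \<otimes> inv (q g) else x)" for x
  have inv: "\<pi> (\<pi>' x) = x" "\<pi>' (\<pi> x) = x" for x
    using g by (auto simp: \<pi>_def \<pi>'_def m_assoc)
  let ?D = "fsupport f"
  have val: "inner (fun_app (translate g f) x) (fun_app (translate g h) x)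
     = inner (fun_app f (\<pi> x)) (fun_app h (\<pi> x))" for x
  proof (cases "x \<in> carrier G")
    case True
    have "inner (c * a) (c * b) = inner a b" if "cmod c = 1" for a b c :: complex
    proof -
      have ic: "inner x y = Re (cnj x * y)" for x y :: complex by (simp add: inner_complex_def)
      have "cnj (c * a) * (c * b) = (cnj c * c) * (cnj a * b)" by (simp only: complex_cnj_mult mult_ac)
      moreover have "cnj c * c = 1" using that complex_norm_square[of c] by (simp add: mult.commute)
      ultimately show ?thesis by (simp only: ic mult_1)
    qed
    then show ?thesis using True g norm_cocycle by (simp add: fun_app_translate translate_fun_def \<pi>_def)
  next
    case False
    then show ?thesis by (simp add: fun_app_translate translate_fun_def \<pi>_def)
  qed
  have "inner (translate g f) (translate g h) =
     (\<Sum>x\<in>\<pi>' ` ?D. inner (fun_app (translate g f) x) (fun_app (translate g h) x))"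
  proof (rule inner_fin_fun_eq)
    show "finite (\<pi>' ` ?D)" by (intro finite_imageI finite_fsupport)
    show "fsupport (translate g f) \<subseteq> \<pi>' ` ?D"
    proof
      fix x assume "x \<in> fsupport (translate g f)"
      then have "fun_app f (\<pi> x) \<noteq> 0" by (auto simp: fun_app_translate translate_fun_def \<pi>_def g split: if_splits)
      then show "x \<in> \<pi>' ` ?D" using inv(2)[of x] by (intro rev_image_eqI[of "\<pi> x"]) auto
    qed
  qed
  also have "\<dots> = (\<Sum>x\<in>\<pi>' ` ?D. inner (fun_app f (\<pi> x)) (fun_app h (\<pi> x)))" by (simp only: val)
  also have "\<dots> = (\<Sum>x\<in>?D. inner (fun_app f x) (fun_app h x))"
    by (rule sum.reindex_bij_witness[of _ \<pi>' \<pi>]) (auto simp: inv)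
  finally show ?thesis by (simp add: inner_fin_fun_def)
qed

lemma norm_translate: "norm (translate g f) = norm f"
proof (cases "g \<in> carrier F")
  case True then show ?thesis by (simp add: norm_eq_sqrt_inner inner_translate)
next
  case False
  then have "translate g f = f" by (intro fin_fun_eqI) (simp add: fun_app_translate translate_fun_def)
  then show ?thesis by simp
qed

lemma translate_adj:
  assumes "g \<in> carrier F"
  shows "inner (translate g f) h = inner f (translate (inv\<^bsub>F\<^esub> g) h)"
  using inner_translate[OF assms, of f "translate (inv\<^bsub>F\<^esub> g) h"] assms
  by (simp add: translate_mult translate_one)

lemma inner_translate_delta:
  assumes "g \<in> carrier F"
  shows "inner (translate g (delta \<one>)) (delta \<one>) = (if q g = \<one> then Re (\<omega> g) else 0)"
  using assms cocycle_of_Ker[of \<one> g] by (auto simp: inner_delta fun_app_translate translate_fun_def Ker_iff)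

definition letter_word :: "letter option \<Rightarrow> gen_word" where
  "letter_word a = (case a of None \<Rightarrow> \<one>\<^bsub>F\<^esub> | Some x \<Rightarrow> [x])"

definition Letters :: "letter option set" where "Letters = insert None (Some ` letters d)"

lemma letter_word_carrier: "a \<in> Letters \<Longrightarrow> letter_word a \<in> carrier F"
  using free_group_letter by (auto simp: Letters_def letter_word_def)

sublocale lazy_walk Letters "\<lambda>a. translate (letter_word a)" None "map_option inv_letter"
proof (rule lazy_walk.intro)
  show "finite Letters" by (simp add: Letters_def letters_def)
  show "None \<in> Letters" by (simp add: Letters_def)
  show "translate (letter_word None) v = v" for v by (simp add: letter_word_def translate_one)
  show "linear (translate (letter_word a))" for a by (rule linear_translate)
  show "norm (translate (letter_word a) v) = norm v" for a v by (rule norm_translate)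
  show "map_option inv_letter a \<in> Letters" if "a \<in> Letters" for a using that by (auto simp: Letters_def)
  show "map_option inv_letter (map_option inv_letter a) = a" for a by (cases a) auto
  show "inner (translate (letter_word a) v) w = inner v (translate (letter_word (map_option inv_letter a)) w)"
    if "a \<in> Letters" for a v w
    using that translate_adj[OF letter_word_carrier[OF that]]
    by (cases a) (auto simp: letter_word_def free_group_inv_letter Letters_def)
qed

lemma words_eq: "words n = lazy_words d n"
  unfolding words_def lazy_words_def by (auto simp: Letters_def)

lemma lazy_value_eq: "lazy_value d w = product_list F (map letter_word w)"
  unfolding lazy_value_def letter_word_def[abs_def] by simp

lemma lazy_value_carrier: "set w \<subseteq> Letters \<Longrightarrow> lazy_value d w \<in> carrier F"
  unfolding lazy_value_eq using letter_word_carrier by (intro F.product_list_closed) auto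

lemma foldr_translate:
  "set w \<subseteq> Letters \<Longrightarrow> foldr (\<lambda>a. translate (letter_word a)) w f = translate (lazy_value d w) f"
proof (induction w)
  case Nil then show ?case by (simp add: lazy_value_eq translate_one)
next
  case (Cons a w)
  then show ?case using letter_word_carrier[of a] lazy_value_carrier[of w]
    by (simp add: translate_mult lazy_value_eq)
qed

definition null_words :: "nat \<Rightarrow> letter option list set" where
  "null_words n = {w \<in> lazy_words d n. q (lazy_value d w) = \<one>}"

text \<open>Only words that close up bring the point mass back to the identity, each with its
  holonomy as weight. For the trivial character the sum counts the null words.\<close>

lemma return_sum:
  "deg ^ n * inner ((P ^^ n) (delta \<one>)) (delta \<one>) = (\<Sum>w\<in>null_words n. Re (\<omega> (lazy_value d w)))"
proof -
  have "deg ^ n * inner ((P ^^ n) (delta \<one>)) (delta \<one>) =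
     inner (\<Sum>w\<in>words n. foldr (\<lambda>a. translate (letter_word a)) w (delta \<one>)) (delta \<one>)"
    using P_pow_expand[of n "delta \<one>"] by (metis inner_scaleR_left)
  also have "\<dots> = (\<Sum>w\<in>words n. if q (lazy_value d w) = \<one> then Re (\<omega> (lazy_value d w)) else 0)"
    unfolding inner_sum_left
    by (intro sum.cong) (auto simp: words_def foldr_translate inner_translate_delta lazy_value_carrier)
  also have "\<dots> = (\<Sum>w\<in>null_words n. Re (\<omega> (lazy_value d w)))"
    unfolding null_words_def words_eq[symmetric] using finite_words by (simp add: sum.If_cases Int_def)
  finally show ?thesis .
qed

text \<open>On the carrier this is the holonomy \<open>-1\<close>; off the carrier
  \<open>translate\<close> is the identity, so \<open>f\<close> has to vanish there, as the iterates
  do by \<open>support_P_pow\<close>.\<close>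

lemma translate_Ker:
  assumes "u \<in> Ker" "\<omega> u = - 1" "\<And>x. x \<notin> carrier G \<Longrightarrow> fun_app f x = 0"
  shows "translate u f = - f"
  by (rule fin_fun_eqI) (use assms in \<open>auto simp: fun_app_translate translate_fun_def Ker_iff cocycle_of_Ker\<close>)

lemma support_P_pow: "x \<notin> carrier G \<Longrightarrow> fun_app ((P ^^ n) (delta \<one>)) x = 0"
  by (induction n) (auto simp: P_def fun_app_translate translate_fun_def)

end

section \<open>Return probabilities\<close>

lemma Re_of_real_nat: "inner (of_nat a :: complex) (of_nat b) = real a * real b"
  by (simp add: inner_complex_def)

lemma product_list_hom:
  assumes "group_hom F G q" "set xs \<subseteq> carrier F"
  shows "q (product_list F xs) = product_list G (map q xs)"
proof -
  interpret group_hom F G q by fact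
  show ?thesis using assms(2) by (induction xs) (auto simp: G.product_list_closed)
qed

lemma product_list_letters:
  "set w \<subseteq> letters d \<Longrightarrow> product_list (free_group d) (map (\<lambda>x. [x]) w) = reduce w"
proof (induction w)
  case Nil then show ?case by (simp add: reduce_def free_group_def)
next
  case (Cons x w)
  then show ?case using reduce_reduce_append_right[of "[x]" w] by (simp add: free_group_def)
qed

context twisted_model
begin

definition gens :: "'a set" where "gens = (\<lambda>a. q (letter_word a)) ` Letters"

abbreviation "B \<equiv> word_ball gens"

definition V :: "nat \<Rightarrow> nat" where "V n = card (B n)"

lemma finite_gens: "finite gens" by (simp add: gens_def fin_A)

lemma gens_carrier: "gens \<subseteq> carrier G"
  using letter_word_carrier by (auto simp: gens_def)

lemma gens_inv: "x \<in> gens \<Longrightarrow> inv x \<in> gens"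
proof -
  assume "x \<in> gens"
  then obtain a where a: "a \<in> Letters" "x = q (letter_word a)" by (auto simp: gens_def)
  have "inv x = q (letter_word (map_option inv_letter a))"
  proof (cases a)
    case None then show ?thesis using a by (simp add: letter_word_def)
  next
    case (Some y)
    then have "y \<in> letters d" using a by (auto simp: Letters_def)
    then show ?thesis using a Some q.hom_inv[OF free_group_letter, of y] by (simp add: letter_word_def free_group_inv_letter)
  qed
  then show ?thesis using iv_in[OF a(1)] by (auto simp: gens_def)
qed

lemma q_lazy_value: "set w \<subseteq> Letters \<Longrightarrow> q (lazy_value d w) = product_list G (map (\<lambda>a. q (letter_word a)) w)"
proof -
  assume "set w \<subseteq> Letters"
  then have "set (map letter_word w) \<subseteq> carrier F" using letter_word_carrier by auto
  from product_list_hom[OF q.group_hom_axioms this] show ?thesis by (simp add: lazy_value_eq o_def)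
qed

lemma ball_eq: "B n = (\<lambda>w. q (lazy_value d w)) ` {w. set w \<subseteq> Letters \<and> length w \<le> n}"
proof -
  have "x \<in> B n \<longleftrightarrow> (\<exists>w. x = q (lazy_value d w) \<and> set w \<subseteq> Letters \<and> length w \<le> n)" for x
  proof
    assume "x \<in> B n"
    then obtain xs where xs: "x = product_list G xs" "set xs \<subseteq> gens" "length xs \<le> n"
      unfolding word_ball_def by blast
    have "\<exists>w. xs = map (\<lambda>a. q (letter_word a)) w \<and> set w \<subseteq> Letters"
      using xs(2) unfolding gens_def
    proof (induction xs)
      case (Cons y xs)
      then obtain a w where "a \<in> Letters" "y = q (letter_word a)" "set w \<subseteq> Letters"
        "xs = map (\<lambda>a. q (letter_word a)) w" by auto
      then show ?case by (intro exI[of _ "a # w"]) auto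
    qed simp
    then obtain w where w: "xs = map (\<lambda>a. q (letter_word a)) w" "set w \<subseteq> Letters" by blast
    then show "\<exists>w. x = q (lazy_value d w) \<and> set w \<subseteq> Letters \<and> length w \<le> n"
      using xs q_lazy_value[OF w(2)] by (intro exI[of _ w]) auto
  next
    assume "\<exists>w. x = q (lazy_value d w) \<and> set w \<subseteq> Letters \<and> length w \<le> n"
    then obtain w where w: "x = q (lazy_value d w)" "set w \<subseteq> Letters" "length w \<le> n" by blast
    then show "x \<in> B n" unfolding word_ball_def
      using q_lazy_value[OF w(2)] by (intro CollectI exI[of _ "map (\<lambda>a. q (letter_word a)) w"]) (auto simp: gens_def)
  qed
  then show ?thesis by blast
qed

lemma generate_gens: "generate G gens = carrier G"
proof
  show "generate G gens \<subseteq> carrier G" using generate_incl[OF gens_carrier] .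
  show "carrier G \<subseteq> generate G gens"
  proof
    fix x assume "x \<in> carrier G"
    then obtain g where g: "g \<in> carrier F" "x = q g" using q_surj by blast
    have sub: "set g \<subseteq> letters d" "reduced_word g" using g by (auto simp: free_group_def)
    then have "g = product_list F (map (\<lambda>x. [x]) g)" by (simp add: product_list_letters reduce_reduced)
    also have "map (\<lambda>x. [x]) g = map letter_word (map Some g)" by (simp add: letter_word_def)
    finally have "g = lazy_value d (map Some g)" by (simp only: lazy_value_eq)
    moreover have "set (map Some g) \<subseteq> Letters" using sub by (auto simp: Letters_def)
    ultimately have "x = product_list G (map (\<lambda>a. q (letter_word a)) (map Some g))"
      using g(2) q_lazy_value by metis
    moreover have "product_list G (map (\<lambda>a. q (letter_word a)) (map Some g)) \<in> generate G gens"
      by (rule product_list_subgroup[OF generate_is_subgroup[OF gens_carrier]])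
        (use \<open>set (map Some g) \<subseteq> Letters\<close> in \<open>auto simp: gens_def intro!: generate.incl\<close>)
    ultimately show "x \<in> generate G gens" by simp
  qed
qed

end

section \<open>The untwisted walk: return probabilities against volume\<close>

locale plain_model = twisted_model G d q "\<lambda>_. 1" for G :: "('a, 'b) monoid_scheme" (structure) and d q +
  assumes nilp: "nilpotent_group G"
begin

lemma ball_carrier: "x \<in> B n \<Longrightarrow> x \<in> carrier G"
  unfolding ball_eq using lazy_value_carrier by auto

lemma ball_mono: "m \<le> n \<Longrightarrow> B m \<subseteq> B n"
  unfolding ball_eq by auto

lemma finite_ball: "finite (B n)"
  unfolding ball_eq using finite_lists_length_le[OF fin_A] by simp

lemma one_ball: "\<one> \<in> B n"
  unfolding word_ball_def by (rule CollectI, rule exI[of _ "[]"]) auto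

lemma V_pos: "0 < V n"
  unfolding V_def using one_ball finite_ball by (metis card_gt_0_iff empty_iff)

lemma V_mono: "m \<le> n \<Longrightarrow> V m \<le> V n"
  unfolding V_def by (intro card_mono finite_ball ball_mono)

lemma ball_step: "x \<in> B n \<Longrightarrow> y \<in> gens \<Longrightarrow> x \<otimes> y \<in> B (Suc n)"
proof -
  assume "x \<in> B n" and y: "y \<in> gens"
  then obtain xs where xs: "x = product_list G xs" "set xs \<subseteq> gens" "length xs \<le> n"
    unfolding word_ball_def by blast
  have "product_list G (xs @ [y]) = x \<otimes> y"
    using xs y gens_carrier by (subst product_list_append) (auto intro: subsetD)
  then show ?thesis using xs y unfolding word_ball_def by (intro CollectI exI[of _ "xs @ [y]"]) auto
qed

lemma doubling: "\<exists>M\<ge>1. \<forall>n>0. V (2 * n) \<le> M * V n"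
proof -
  obtain M where "\<forall>n>0. V (2 * n) \<le> M * V n"
    using nilpotent_volume_doubling[OF nilp finite_gens gens_carrier gens_inv generate_gens]
    unfolding V_def by blast
  then have "\<forall>n>0. V (2 * n) \<le> Suc M * V n" by (simp add: trans_le_add2)
  then show ?thesis by (intro exI[of _ "Suc M"]) auto
qed

lemma cocycle_1: "cocycle x g = 1" by (simp add: cocycle_def)

lemma translate_delta:
  assumes "x \<in> carrier G" "g \<in> carrier F"
  shows "translate g (delta x) = delta (x \<otimes> inv (q g))"
proof (rule fin_fun_eqI)
  fix y
  show "fun_app (translate g (delta x)) y = fun_app (delta (x \<otimes> inv (q g))) y"
    using assms inv_solve_right[of y x "q g"] inv_solve_right'[of y x "q g"]
    by (auto simp: fun_app_translate translate_fun_def cocycle_1)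
qed

lemma inner_delta_delta: "inner (delta x) (delta y) = (if x = y then 1 else 0)"
  by (simp add: inner_delta)

text \<open>Right translation by a word fixes the point mass at \<open>x\<close> exactly when the
  word is null, whatever \<open>x\<close> is.\<close>

lemma inner_P_delta:
  assumes "x \<in> carrier G"
  shows "inner ((P ^^ n) (delta x)) (delta x) = inner ((P ^^ n) (delta \<one>)) (delta \<one>)"
proof -
  have "deg ^ n * inner ((P ^^ n) (delta x)) (delta x) =
     inner (\<Sum>w\<in>words n. foldr (\<lambda>a. translate (letter_word a)) w (delta x)) (delta x)" if "x \<in> carrier G" for x
    using P_pow_expand[of n "delta x"] by (metis inner_scaleR_left)
  also have "\<dots> x = (\<Sum>w\<in>words n. if q (lazy_value d w) = \<one> then 1 else 0)" if x: "x \<in> carrier G" for x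
    unfolding inner_sum_left
  proof (intro sum.cong refl)
    fix w assume "w \<in> words n"
    then have w: "set w \<subseteq> Letters" by (simp add: words_def)
    then have c: "q (lazy_value d w) \<in> carrier G" using lazy_value_carrier by simp
    have "inner (foldr (\<lambda>a. translate (letter_word a)) w (delta x)) (delta x)
       = (if x \<otimes> inv (q (lazy_value d w)) = x then 1 else 0)"
      using foldr_translate[OF w] translate_delta[OF x lazy_value_carrier[OF w]] by (simp add: inner_delta_delta)
    also have "x \<otimes> inv (q (lazy_value d w)) = x \<longleftrightarrow> q (lazy_value d w) = \<one>"
      using x c l_cancel[of x "inv (q (lazy_value d w))" \<one>] inv_eq_1_iff[OF c] by simp
    finally show "inner (foldr (\<lambda>a. translate (letter_word a)) w (delta x)) (delta x)
       = (if q (lazy_value d w) = \<one> then 1 else 0)" by simp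
  qed
  finally have "deg ^ n * inner ((P ^^ n) (delta x)) (delta x) = deg ^ n * inner ((P ^^ n) (delta \<one>)) (delta \<one>)"
    using assms by simp
  then show ?thesis using deg_pos by simp
qed

text \<open>The return probability at time \<open>2 * m\<close>; along even times it is
  decreasing.\<close>

definition ret :: "nat \<Rightarrow> real" where "ret m = s (delta \<one>) m"

lemma ret_delta: "x \<in> carrier G \<Longrightarrow> norm ((P ^^ m) (delta x)) = sqrt (ret m)"
  using inner_P_delta[of x "2 * m"] s_inner[of "delta x" m] s_inner[of "delta \<one>" m]
  by (simp add: ret_def) (metis norm_ge_zero real_sqrt_unique s_def)

lemma ret_nonneg: "0 \<le> ret m" by (simp add: ret_def s_nonneg)
lemma ret_antimono: "m \<le> n \<Longrightarrow> ret n \<le> ret m" by (simp add: ret_def s_antimono)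
lemma ret_0: "ret 0 = 1" by (simp add: ret_def s_def)

text \<open>The correlations of the iterate with its translates over a ball are each nearly
  \<open>ret (2 * m)\<close> by the pseudo-Poincare inequality, while their sum is at most one
  because the iterate is a probability distribution.\<close>

lemma ret_upper_step:
  assumes m: "0 < m"
  shows "real (V r) * (ret (2 * m) - r * sqrt (2 * deg / m) * ret m) \<le> 1"
proof -
  let ?v = "(P ^^ (2 * m)) (delta \<one>)"
  define w where "w x = (SOME w. x = q (lazy_value d w) \<and> set w \<subseteq> Letters \<and> length w \<le> r)" for x
  have w: "x = q (lazy_value d (w x))" "set (w x) \<subseteq> Letters" "length (w x) \<le> r" if "x \<in> B r" for x
  proof -
    have "\<exists>w. x = q (lazy_value d w) \<and> set w \<subseteq> Letters \<and> length w \<le> r" using that unfolding ball_eq by blast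
    from someI_ex[OF this] show "x = q (lazy_value d (w x))" "set (w x) \<subseteq> Letters" "length (w x) \<le> r"
      unfolding w_def by blast+
  qed
  have nv: "norm ?v = sqrt (ret (2 * m))" by (simp add: ret_delta)
  have low: "ret (2 * m) - r * sqrt (2 * deg / m) * ret m \<le> inner ?v (translate (lazy_value d (w x)) ?v)"
    if x: "x \<in> B r" for x
  proof -
    let ?T = "translate (lazy_value d (w x)) ?v"
    have "norm (?v - ?T) \<le> r * sqrt (2 * deg * ret m / m)"
      using path_bound_iterate[OF w(2)[OF x] w(3)[OF x] m, of "delta \<one>"] foldr_translate[OF w(2)[OF x]]
      by (simp add: ret_def)
    moreover have "norm ?v \<le> sqrt (ret m)" unfolding nv by (intro real_sqrt_le_mono ret_antimono) simp
    ultimately have "norm ?v * norm (?v - ?T) \<le> sqrt (ret m) * (r * sqrt (2 * deg * ret m / m))"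
      by (intro mult_mono) (auto simp: ret_nonneg)
    also have "\<dots> = r * sqrt (2 * deg / m) * ret m"
      using ret_nonneg[of m] by (simp add: real_sqrt_mult real_sqrt_divide)
    finally have "inner ?v (?v - ?T) \<le> r * sqrt (2 * deg / m) * ret m"
      using norm_cauchy_schwarz[of ?v "?v - ?T"] by linarith
    moreover have "inner ?v ?v = ret (2 * m)" using nv ret_nonneg by (simp add: power2_norm_eq_inner[symmetric])
    ultimately show ?thesis by (simp add: inner_diff_right)
  qed
  have "real (V r) * (ret (2 * m) - r * sqrt (2 * deg / m) * ret m)
      = (\<Sum>x\<in>B r. ret (2 * m) - r * sqrt (2 * deg / m) * ret m)" by (simp add: V_def)
  also have "\<dots> \<le> (\<Sum>x\<in>B r. inner ?v (translate (lazy_value d (w x)) ?v))" by (intro sum_mono low)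
  also have "\<dots> \<le> 1"
  proof -
    \<comment> \<open>Scaled by \<open>deg ^ ?n\<close> the iterate is a sum of point masses, one
      for each word; a pair of end points matches at most one \<open>x\<close> in the sum of
      correlations.\<close>
    let ?n = "2 * m" and ?\<delta> = "\<lambda>u. delta (inv (q (lazy_value d u)))"
    have vexp: "deg ^ ?n *\<^sub>R ?v = (\<Sum>u\<in>words ?n. ?\<delta> u)"
      unfolding P_pow_expand
      by (intro sum.cong refl) (auto simp: words_def foldr_translate translate_delta lazy_value_carrier)
    have cW: "q (lazy_value d u) \<in> carrier G" if "u \<in> words ?n" for u
      using that lazy_value_carrier by (auto simp: words_def)
    have "deg ^ ?n * (deg ^ ?n * (\<Sum>x\<in>B r. inner ?v (translate (lazy_value d (w x)) ?v)))
       = (\<Sum>x\<in>B r. inner (deg ^ ?n *\<^sub>R ?v) (translate (lazy_value d (w x)) (deg ^ ?n *\<^sub>R ?v)))"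
      by (simp add: linear_scale[OF linear_translate] sum_distrib_left)
    also have "\<dots> = (\<Sum>x\<in>B r. \<Sum>u\<in>words ?n. \<Sum>u'\<in>words ?n. inner (?\<delta> u) (translate (lazy_value d (w x)) (?\<delta> u')))"
      unfolding vexp by (simp only: linear_sum[OF linear_translate] inner_sum_left) (simp only: inner_sum_right)
    also have "\<dots> = (\<Sum>u\<in>words ?n. \<Sum>u'\<in>words ?n. \<Sum>x\<in>B r. inner (?\<delta> u) (translate (lazy_value d (w x)) (?\<delta> u')))"
      by (subst sum.swap, intro sum.cong refl, subst sum.swap) simp
    also have "\<dots> \<le> (\<Sum>u\<in>words ?n. \<Sum>u'\<in>words ?n. 1)"
    proof (intro sum_mono)
      fix u u' assume u: "u \<in> words ?n" "u' \<in> words ?n"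
      let ?y = "inv (q (lazy_value d u'))" and ?z = "inv (q (lazy_value d u))"
      have c: "?y \<in> carrier G" "?z \<in> carrier G" using cW u by auto
      have "inner (?\<delta> u) (translate (lazy_value d (w x)) (?\<delta> u')) = (if x = inv ?z \<otimes> ?y then 1 else 0)" if x: "x \<in> B r" for x
      proof -
        have xc: "x \<in> carrier G" using ball_carrier x by blast
        have "translate (lazy_value d (w x)) (?\<delta> u') = delta (?y \<otimes> inv x)"
          using translate_delta[OF c(1) lazy_value_carrier[OF w(2)[OF x]]] w(1)[OF x] by simp
        moreover have "?z = ?y \<otimes> inv x \<longleftrightarrow> x = inv ?z \<otimes> ?y"
          using inv_solve_right[OF c(2) c(1) xc] inv_solve_left[OF xc c(2) c(1)] by auto
        ultimately show ?thesis by (simp add: inner_delta_delta)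
      qed
      then have "(\<Sum>x\<in>B r. inner (?\<delta> u) (translate (lazy_value d (w x)) (?\<delta> u')))
         = (\<Sum>x\<in>B r. if x = inv ?z \<otimes> ?y then 1 else 0)" by (intro sum.cong) auto
      also have "\<dots> \<le> 1" using finite_ball by (simp add: sum.delta)
      finally show "(\<Sum>x\<in>B r. inner (?\<delta> u) (translate (lazy_value d (w x)) (?\<delta> u'))) \<le> 1" .
    qed
    also have "\<dots> = deg ^ ?n * (deg ^ ?n * 1)" by (simp add: card_words)
    finally show ?thesis using deg_pos by (simp only: mult_le_cancel_left_pos zero_less_power)
  qed
  finally show ?thesis .
qed

text \<open>The tent function \<open>f\<close> over the ball of radius \<open>2 * t\<close> changes
  by at most one along a generator. For \<open>t\<close> of order the square root of
  \<open>m\<close> it therefore keeps half of its squared norm during \<open>m\<close> steps. On the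
  other hand \<open>f\<close> is a sum of at most \<open>2 * t * V (2 * t)\<close> point masses,
  whose iterates have norm \<open>sqrt (ret m)\<close>.\<close>

lemma ret_lower:
  assumes M: "1 \<le> M" "\<And>n. 0 < n \<Longrightarrow> V (2 * n) \<le> M * V n"
    and m: "0 < m" and t: "2 * M * m \<le> t\<^sup>2"
  shows "1 \<le> 8 * (real M)\<^sup>2 * V t * ret m"
proof -
  have t0: "0 < t" using t m M by (cases "t = 0") auto
  \<comment> \<open>On the inner ball of radius \<open>t\<close> the tent has height at least
    \<open>t\<close>, and by doubling the outer volume exceeds the inner one by a factor
    \<open>M\<close> at most.\<close>
  define r where "r = 2 * t"
  define h where "h x = card {i. i < r \<and> x \<in> B i}" for x
  define f :: "'a fin_fun" where "f = (\<Sum>i<r. \<Sum>x\<in>B i. delta x)"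
  have fh: "fun_app f x = of_nat (h x)" for x
  proof -
    have "fun_app f x = (\<Sum>i<r. if x \<in> B i then 1 else 0)"
      unfolding f_def by (simp add: finite_ball sum.delta)
    also have "\<dots> = of_nat (h x)" unfolding h_def
      by (simp add: sum.If_cases Int_def lessThan_def)
    finally show ?thesis .
  qed
  have hstep: "h x \<le> Suc (h (x \<otimes> y))" if "y \<in> gens" for x y
  proof -
    \<comment> \<open>A generator moves \<open>B i\<close> into \<open>B (Suc i)\<close>; only the
      largest radius has no successor below \<open>r\<close>.\<close>
    have "{i. i < r \<and> x \<in> B i} \<subseteq> insert (r - 1) {i. i < r - 1 \<and> x \<in> B i}" by auto
    then have "h x \<le> card (insert (r - 1) {i. i < r - 1 \<and> x \<in> B i})" unfolding h_def by (intro card_mono) auto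
    also have "\<dots> \<le> Suc (card {i. i < r - 1 \<and> x \<in> B i})" by (rule card_insert_le_m1) auto
    also have "card {i. i < r - 1 \<and> x \<in> B i} = card (Suc ` {i. i < r - 1 \<and> x \<in> B i})"
      by (simp add: card_image)
    also have "\<dots> \<le> h (x \<otimes> y)" unfolding h_def using ball_step[OF _ that] by (intro card_mono) auto
    finally show ?thesis by simp
  qed
  have h0: "h x = 0" if "x \<notin> B r" for x
  proof -
    have "\<not> (i < r \<and> x \<in> B i)" for i using ball_mono[of i r] that by auto
    then show ?thesis by (simp add: h_def)
  qed
  have hpos: "\<exists>i<r. x \<in> B i" if "h x \<noteq> 0" for x
  proof (rule ccontr)
    assume "\<not> (\<exists>i<r. x \<in> B i)"
    then have "\<not> (i < r \<and> x \<in> B i)" for i by blast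
    then show False using that by (simp add: h_def)
  qed
  have grad: "(norm (f - translate (letter_word a) f))\<^sup>2 \<le> real (V r)" if a: "a \<in> Letters" for a
  proof -
    let ?y = "q (letter_word a)" and ?D = "f - translate (letter_word a) f"
    have y: "?y \<in> gens" "?y \<in> carrier G" "inv ?y \<in> gens" using a gens_carrier gens_inv by (auto simp: gens_def)
    have D: "fun_app ?D x = (if x \<in> carrier G then of_nat (h x) - of_nat (h (x \<otimes> ?y)) else 0)" for x
      using letter_word_carrier[OF a] by (simp add: fun_app_translate translate_fun_def cocycle_1 fh)
    have D1: "inner (fun_app ?D x) (fun_app ?D x) \<le> 1" for x
    proof (cases "x \<in> carrier G")
      case True
      then have "h (x \<otimes> ?y) \<le> Suc (h x)" using hstep[OF y(3), of "x \<otimes> ?y"] y by (simp add: m_assoc)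
      then have "\<bar>real (h x) - real (h (x \<otimes> ?y))\<bar> \<le> 1" using hstep[OF y(1), of x] by linarith
      then have "(real (h x) - real (h (x \<otimes> ?y)))\<^sup>2 \<le> 1" by (simp add: abs_square_le_1)
      then show ?thesis using True unfolding D by (simp add: inner_complex_def power2_eq_square)
    next
      case False
      then show ?thesis unfolding D by simp
    qed
    have "fsupport ?D \<subseteq> B r"
    proof
      fix x assume "x \<in> fsupport ?D"
      then have x: "x \<in> carrier G" "h x \<noteq> 0 \<or> h (x \<otimes> ?y) \<noteq> 0" unfolding in_fsupport D by (auto split: if_splits)
      show "x \<in> B r"
      proof (rule ccontr)
        assume n: "x \<notin> B r"
        then have "h (x \<otimes> ?y) \<noteq> 0" using x(2) h0[of x] by simp
        from hpos[OF this] obtain i where i: "i < r" "x \<otimes> ?y \<in> B i" by blast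
        then have "x \<in> B (Suc i)" using ball_step[OF i(2) y(3)] x y by (simp add: m_assoc)
        then show False using n ball_mono[of "Suc i" r] i by auto
      qed
    qed
    from inner_fin_fun_eq[OF finite_ball this, of ?D]
    have "(norm ?D)\<^sup>2 = (\<Sum>x\<in>B r. inner (fun_app ?D x) (fun_app ?D x))" by (simp only: power2_norm_eq_inner)
    also have "\<dots> \<le> (\<Sum>x\<in>B r. 1)" by (intro sum_mono D1)
    finally show ?thesis by (simp add: V_def)
  qed
  have normf: "real (V t) * (real t)\<^sup>2 \<le> (norm f)\<^sup>2"
  proof -
    have "fsupport f \<subseteq> B r"
    proof
      fix x assume "x \<in> fsupport f"
      then have "h x \<noteq> 0" by (simp add: fh)
      then show "x \<in> B r" using h0[of x] by (cases "x \<in> B r") simp_all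
    qed
    from inner_fin_fun_eq[OF finite_ball this, of f]
    have nf: "(norm f)\<^sup>2 = (\<Sum>x\<in>B r. (real (h x))\<^sup>2)"
      by (simp only: power2_norm_eq_inner fh Re_of_real_nat) (simp only: power2_eq_square)
    have "t \<le> h x" if x: "x \<in> B t" for x
    proof -
      have "x \<in> B i" if "t \<le> i" for i using ball_mono[OF that] x by blast
      then have "{t..<r} \<subseteq> {i. i < r \<and> x \<in> B i}" by auto
      then have "card {t..<r} \<le> h x" unfolding h_def by (intro card_mono) auto
      then show ?thesis by (simp add: r_def)
    qed
    then have "(\<Sum>x\<in>B t. (real t)\<^sup>2) \<le> (\<Sum>x\<in>B t. (real (h x))\<^sup>2)" by (intro sum_mono power_mono) auto
    also have "\<dots> \<le> (\<Sum>x\<in>B r. (real (h x))\<^sup>2)"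
      using ball_mono[of t r] by (intro sum_mono2 finite_ball) (auto simp: r_def)
    finally show ?thesis using nf by (simp add: V_def)
  qed
  have Vr: "real (V r) \<le> real M * real (V t)" using M(2)[OF t0] by (simp add: r_def flip: of_nat_mult)
  have Vt: "0 < real (V t)" using V_pos by simp
  have tt: "2 * real M * real m \<le> (real t)\<^sup>2" using t by (metis of_nat_le_iff of_nat_mult of_nat_numeral of_nat_power)
  have M1: "1 \<le> real M" and m1: "1 \<le> real m" using M m by auto
  have tpos: "0 < (real t)\<^sup>2" using t0 by simp
  have z: "0 < (norm f)\<^sup>2" using normf mult_pos_pos[OF Vt tpos] by linarith
  then have f0: "f \<noteq> 0" by auto
  \<comment> \<open>The bound \<open>V r\<close> for the squared displacements relative to twice the
    squared norm, as in \<open>s_power_lower\<close>. The condition on \<open>t\<close> makes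
    \<open>2 * m * D\<close> at most one half, so Bernoulli's inequality leaves a factor of one
    half.\<close>
  define D where "D = real (V r) / (2 * (norm f)\<^sup>2)"
  have D: "D \<le> real M / (2 * (real t)\<^sup>2)"
  proof -
    have "D \<le> (real M * real (V t)) / (2 * (real (V t) * (real t)\<^sup>2))"
      unfolding D_def using Vr normf Vt tpos by (intro frac_le) auto
    then show ?thesis using Vt by simp
  qed
  have D0: "0 \<le> D" by (simp add: D_def)
  have mD: "2 * real m * D \<le> 1 / 2"
  proof -
    have "2 * real m * D \<le> 2 * real m * (real M / (2 * (real t)\<^sup>2))" using D by (intro mult_left_mono) auto
    also have "\<dots> \<le> 1 / 2" using tt tpos by (simp add: field_simps)
    finally show ?thesis .
  qed
  moreover have "1 * D \<le> (2 * real m) * D" using m1 D0 by (intro mult_right_mono) auto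
  ultimately have D1: "D \<le> 1" by linarith
  then have "real (V r) \<le> 2 * (norm f)\<^sup>2" using z by (simp add: D_def divide_le_eq)
  from s_power_lower[OF f0 _ this grad, of m]
  have "(norm f)\<^sup>2 * (1 - D) ^ (2 * m) \<le> s f m" by (simp add: D_def)
  moreover have "1 / 2 \<le> (1 - D) ^ (2 * m)"
    using Bernoulli_inequality[of "- D" "2 * m"] D1 mD by simp
  ultimately have low: "(norm f)\<^sup>2 / 2 \<le> s f m"
    using mult_left_mono[of "1 / 2" "(1 - D) ^ (2 * m)" "(norm f)\<^sup>2"] by simp
  have "norm ((P ^^ m) f) \<le> (\<Sum>i<r. \<Sum>x\<in>B i. norm ((P ^^ m) (delta x)))"
  proof -
    have lin: "linear (P ^^ m)"
    proof (induction m)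
      case (Suc m) then show ?case using linear_compose[OF Suc linear_P] by (simp add: o_def)
    qed (simp add: linear_id[unfolded id_def] id_def)
    show ?thesis unfolding f_def linear_sum[OF lin]
      by (intro order_trans[OF norm_sum] sum_mono order_refl)
  qed
  also have "\<dots> = (\<Sum>i<r. real (V i) * sqrt (ret m))"
    unfolding V_def by (intro sum.cong) (auto simp: ret_delta ball_carrier)
  also have "\<dots> \<le> (\<Sum>i<r. real (V r) * sqrt (ret m))"
    by (intro sum_mono mult_right_mono) (auto simp: V_mono ret_nonneg)
  also have "\<dots> = real r * real (V r) * sqrt (ret m)" by simp
  finally have "(norm ((P ^^ m) f))\<^sup>2 \<le> (real r * real (V r) * sqrt (ret m))\<^sup>2" by (intro power_mono) auto
  then have up: "s f m \<le> (real r)\<^sup>2 * (real (V r))\<^sup>2 * ret m"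
    by (simp add: s_def power_mult_distrib ret_nonneg)
  have "real (V t) * (real t)\<^sup>2 / 2 \<le> (2 * real t)\<^sup>2 * (real (V r))\<^sup>2 * ret m"
    using normf low up by (simp add: r_def)
  also have "\<dots> \<le> (2 * real t)\<^sup>2 * (real M * real (V t))\<^sup>2 * ret m"
    using Vr by (intro mult_right_mono mult_left_mono power_mono ret_nonneg) auto
  also have "\<dots> = (real (V t) * (real t)\<^sup>2 / 2) * (8 * (real M)\<^sup>2 * V t * ret m)"
    by (simp add: power2_eq_square)
  finally have "(real (V t) * (real t)\<^sup>2 / 2) * 1 \<le> (real (V t) * (real t)\<^sup>2 / 2) * (8 * (real M)\<^sup>2 * V t * ret m)"
    by simp
  moreover have "0 < real (V t) * (real t)\<^sup>2 / 2" using mult_pos_pos[OF Vt tpos] by simp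
  ultimately show ?thesis by (simp only: mult_le_cancel_left_pos)
qed

end

lemma ex_nat_sqrt: "\<exists>r::nat. r\<^sup>2 \<le> j \<and> j < (Suc r)\<^sup>2"
proof (induction j)
  case (Suc j)
  then obtain r where r: "r\<^sup>2 \<le> j" "j < (Suc r)\<^sup>2" by blast
  show ?case
  proof (cases "Suc j < (Suc r)\<^sup>2")
    case True then show ?thesis using r by (intro exI[of _ r]) simp
  next
    case False
    then have "Suc j = (Suc r)\<^sup>2" using r by simp
    then show ?thesis by (intro exI[of _ "Suc r"]) (simp add: power2_eq_square)
  qed
qed (auto intro: exI[of _ 0])

text \<open>\<open>(1 - x) * (1 + x) <= 1\<close> together with Bernoulli's inequality for
  \<open>1 + x\<close>. Decay of order \<open>1 / (k * x)\<close> is enough, since only a fixed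
  factor has to be gained.\<close>

lemma power_le_inverse_linear:
  fixes x :: real
  assumes "0 \<le> x" "x \<le> 1"
  shows "(1 - x) ^ k * (1 + real k * x) \<le> 1"
proof -
  have "(1 - x) ^ k * (1 + real k * x) \<le> (1 - x) ^ k * (1 + x) ^ k"
    using assms Bernoulli_inequality[of x k] by (intro mult_left_mono) auto
  also have "\<dots> = (1 - x\<^sup>2) ^ k" by (simp add: power_mult_distrib[symmetric] algebra_simps power2_eq_square)
  also have "\<dots> \<le> 1" using assms by (intro power_le_one) (auto simp: abs_square_le_1)
  finally show ?thesis .
qed

text \<open>In twice the square of \<open>sin (x / 2)\<close> one sine is bounded by one and the
  other by its argument: a first moment is wanted, not a second.\<close>

lemma one_minus_cos_le: "1 - cos x \<le> \<bar>x :: real\<bar>"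
proof -
  have "1 - cos x = 2 * (sin (x / 2))\<^sup>2" using cos_double_sin[of "x / 2"] by simp
  also have "\<dots> = 2 * (\<bar>sin (x / 2)\<bar> * \<bar>sin (x / 2)\<bar>)" by (simp add: power2_eq_square)
  also have "\<dots> \<le> 2 * (1 * \<bar>x / 2\<bar>)"
    by (intro mult_left_mono mult_mono abs_sin_x_le_abs_x) auto
  finally show ?thesis by simp
qed

context plain_model
begin

lemma V_double_pow:
  assumes "\<And>n. 0 < n \<Longrightarrow> V (2 * n) \<le> M * V n" "0 < n"
  shows "V (2 ^ k * n) \<le> M ^ k * V n"
proof (induction k)
  case (Suc k)
  have "V (2 ^ Suc k * n) \<le> M * V (2 ^ k * n)" using assms(1)[of "2 ^ k * n"] assms(2) by (simp add: mult.assoc)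
  also have "\<dots> \<le> M * (M ^ k * V n)" using Suc by simp
  finally show ?case by (simp add: mult.assoc)
qed simp

text \<open>Induction over scales. The step from \<open>r = r' div 2\<close> to \<open>r'\<close>
  applies \<open>ret_upper_step\<close> to a ball of radius \<open>\<rho>\<close>, a small fraction
  \<open>1 / K\<close> of \<open>r\<close>; this gives a bounded term and an error proportional to
  \<open>ret (r ^ 2)\<close>. The fraction is chosen so that the error, times the doubling loss
  \<open>M ^ 2\<close>, is at most half of the bound at \<open>r\<close>.\<close>

lemma ret_upper: "\<exists>C>0. \<forall>r>0. ret (r\<^sup>2) * V r \<le> C"
proof -
  obtain M where M: "1 \<le> M" "\<And>n. 0 < n \<Longrightarrow> V (2 * n) \<le> M * V n" using doubling by blast
  define c where "c = sqrt (2 * deg)"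
  have c: "0 \<le> c" by (simp add: c_def deg_def)
  obtain K :: nat where K0: "2 * c * (real M)\<^sup>2 + 1 \<le> real K" using real_arch_simple by blast
  moreover have "0 \<le> 2 * c * (real M)\<^sup>2" using c by simp
  ultimately have "1 \<le> real K" by linarith
  then have K1: "0 < K" by simp
  define k where "k = 2 * K"
  have kK: "2 * K \<le> 2 ^ k" unfolding k_def using less_exp[of "2 * K"] by (simp add: less_imp_le)
  \<comment> \<open>The first summand makes the bounded term at most \<open>C / 2\<close>, the
    second covers the radii below \<open>2 * K\<close>.\<close>
  define C where "C = 2 * real (M ^ (k + 2)) + real (V (2 * K))"
  have bound: "ret (r\<^sup>2) * V r \<le> C" if "0 < r" for r
    using that
  proof (induction r rule: less_induct)
    case (less r')
    show ?case
    proof (cases "r' < 2 * K")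
      case True
      have "ret (r'\<^sup>2) * V r' \<le> 1 * real (V (2 * K))"
        using ret_antimono[of 0 "r'\<^sup>2"] ret_0 V_mono[of r' "2 * K"] True ret_nonneg by (intro mult_mono) auto
      moreover have "0 \<le> real (M ^ (k + 2))" by simp
      ultimately show ?thesis unfolding C_def by linarith
    next
      case False
      define r where "r = r' div 2"
      have r: "K \<le> r" "r < r'" "2 * r \<le> r'" "r' \<le> 4 * r" "0 < r" using False K1 by (auto simp: r_def)
      define \<rho> where "\<rho> = r div K"
      have \<rho>: "0 < \<rho>" using r K1 by (simp add: \<rho>_def div_greater_zero_iff)
      have \<rho>K: "\<rho> * K \<le> r" by (simp add: \<rho>_def)
      have "r = \<rho> * K + r mod K" by (simp add: \<rho>_def)
      moreover have "r mod K < K" using K1 by simp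
      moreover have "K \<le> \<rho> * K" using \<rho> by simp
      ultimately have "r \<le> 2 * (\<rho> * K)" by linarith
      also have "\<dots> = 2 * K * \<rho>" by simp
      also have "\<dots> \<le> 2 ^ k * \<rho>" using kK by (intro mult_le_mono1)
      finally have "V r \<le> V (2 ^ k * \<rho>)" by (rule V_mono)
      also have "\<dots> \<le> M ^ k * V \<rho>" by (rule V_double_pow[OF M(2) \<rho>])
      finally have VV: "real (V r) \<le> real (M ^ k) * real (V \<rho>)" by (metis of_nat_le_iff of_nat_mult)
      have V4: "real (V r') \<le> (real M)\<^sup>2 * real (V r)"
      proof -
        have "V r' \<le> V (2\<^sup>2 * r)" using r by (intro V_mono) simp
        also have "\<dots> \<le> M\<^sup>2 * V r" by (rule V_double_pow[OF M(2) r(5)])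
        finally show ?thesis by (metis of_nat_le_iff of_nat_mult of_nat_power)
      qed
      have M0: "0 < (real M)\<^sup>2" using M by simp
      have V0: "0 < real (V \<rho>)" using V_pos by simp
      have "real \<rho> * sqrt (2 * deg / real (r\<^sup>2)) = real \<rho> * (c / r)"
        by (simp add: c_def real_sqrt_divide)
      also have "\<dots> \<le> 1 / (2 * (real M)\<^sup>2)"
      proof -
        have "real \<rho> * (2 * c * (real M)\<^sup>2) \<le> real \<rho> * real K" using K0 by (intro mult_left_mono) auto
        also have "\<dots> \<le> real r" using \<rho>K by (metis of_nat_le_iff of_nat_mult)
        finally show ?thesis using r(5) M0 by (simp add: field_simps)
      qed
      finally have e: "real \<rho> * sqrt (2 * deg / real (r\<^sup>2)) \<le> 1 / (2 * (real M)\<^sup>2)" .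
      define A where "A = ret (2 * r\<^sup>2)"
      define R where "R = ret (r\<^sup>2)"
      have "real (V \<rho>) * (A - real \<rho> * sqrt (2 * deg / real (r\<^sup>2)) * R) \<le> 1"
        unfolding A_def R_def using ret_upper_step[of "r\<^sup>2" \<rho>] r(5) by simp
      moreover have "real \<rho> * sqrt (2 * deg / real (r\<^sup>2)) * R \<le> 1 / (2 * (real M)\<^sup>2) * R"
        using e by (intro mult_right_mono) (auto simp: R_def ret_nonneg)
      then have "real (V \<rho>) * (A - 1 / (2 * (real M)\<^sup>2) * R)
         \<le> real (V \<rho>) * (A - real \<rho> * sqrt (2 * deg / real (r\<^sup>2)) * R)"
        by (intro mult_left_mono) auto
      ultimately have "real (V \<rho>) * (A - 1 / (2 * (real M)\<^sup>2) * R) \<le> 1" by linarith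
      then have "A - 1 / (2 * (real M)\<^sup>2) * R \<le> 1 / real (V \<rho>)" using V0 by (simp add: field_simps)
      then have A: "A \<le> 1 / real (V \<rho>) + 1 / (2 * (real M)\<^sup>2) * R" by simp
      have "ret (r'\<^sup>2) \<le> A" unfolding A_def
      proof (rule ret_antimono)
        have "2 * r\<^sup>2 \<le> (2 * r)\<^sup>2" by (simp add: power2_eq_square)
        also have "\<dots> \<le> r'\<^sup>2" using r by (intro power_mono) auto
        finally show "2 * r\<^sup>2 \<le> r'\<^sup>2" .
      qed
      then have "ret (r'\<^sup>2) * V r' \<le> A * ((real M)\<^sup>2 * real (V r))"
        using V4 by (intro mult_mono) (auto simp: A_def ret_nonneg)
      also have "\<dots> \<le> (1 / real (V \<rho>) + 1 / (2 * (real M)\<^sup>2) * R) * ((real M)\<^sup>2 * real (V r))"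
        using A by (intro mult_right_mono) auto
      also have "\<dots> = (real M)\<^sup>2 * (real (V r) / real (V \<rho>)) + R * V r / 2"
        using M0 by (simp add: field_simps)
      also have "\<dots> \<le> (real M)\<^sup>2 * real (M ^ k) + C / 2"
        using VV V0 less.IH[OF r(2,5)] M0
        by (intro add_mono mult_left_mono) (auto simp: R_def divide_le_eq)
      also have "(real M)\<^sup>2 * real (M ^ k) = real (M ^ (k + 2))" by (simp add: power_add power2_eq_square mult.commute)
      also have "\<dots> + C / 2 \<le> C" by (simp add: C_def)
      finally show ?thesis .
    qed
  qed
  have "0 < C" using M by (simp add: C_def add_pos_nonneg)
  then show ?thesis using bound by blast
qed

text \<open>Both sides are compared with the inverse volume of a ball whose radius is the square
  root of \<open>j\<close>: \<open>ret_upper\<close> is used at that radius and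
  \<open>ret_lower\<close> at \<open>L\<close> times that radius, with doubling in between.\<close>

lemma ret_ratio: "\<exists>C\<ge>1. \<forall>j>0. \<forall>m>0. m \<le> 7 * j \<longrightarrow> ret j \<le> C * ret m"
proof -
  obtain M where M: "1 \<le> M" "\<And>n. 0 < n \<Longrightarrow> V (2 * n) \<le> M * V n" using doubling by blast
  obtain C1 where C1: "0 < C1" "\<And>r. 0 < r \<Longrightarrow> ret (r\<^sup>2) * V r \<le> C1" using ret_upper by blast
  \<comment> \<open>From \<open>m <= 7 * j\<close> and \<open>j < 4 * r ^ 2\<close> the requirement
    of \<open>ret_lower\<close> follows from \<open>56 * M * r ^ 2 <= t ^ 2\<close>, which
    \<open>t = L * r\<close> meets.\<close>
  define L where "L = 56 * M"
  define C where "C = C1 * (8 * (real M)\<^sup>2 * real (M ^ L))"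
  have "ret j \<le> C * ret m" if j: "0 < j" and m: "0 < m" "m \<le> 7 * j" for j m
  proof -
    obtain r where r: "r\<^sup>2 \<le> j" "j < (Suc r)\<^sup>2" using ex_nat_sqrt by blast
    have r0: "0 < r" using j r by (cases r) auto
    have "(Suc r)\<^sup>2 \<le> (2 * r)\<^sup>2" using r0 by (intro power_mono) auto
    then have "m \<le> 28 * r\<^sup>2" using m r by (simp add: power_mult_distrib)
    then have "2 * M * m \<le> 2 * M * (28 * r\<^sup>2)" by (intro mult_le_mono2)
    also have "\<dots> = L * r\<^sup>2" by (simp add: L_def)
    also have "\<dots> \<le> L * L * r\<^sup>2" using M(1) by (simp add: L_def)
    also have "\<dots> = (L * r)\<^sup>2" by (simp add: power2_eq_square)
    finally have "1 \<le> 8 * (real M)\<^sup>2 * V (L * r) * ret m" by (intro ret_lower M m)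
    also have "V (L * r) \<le> V (2 ^ L * r)" by (intro V_mono mult_le_mono1 less_imp_le less_exp)
    also have "\<dots> \<le> M ^ L * V r" by (rule V_double_pow[OF M(2) r0])
    finally have one: "1 \<le> 8 * (real M)\<^sup>2 * real (M ^ L * V r) * ret m"
      by (simp add: mult_left_mono mult_right_mono ret_nonneg)
    have V0: "0 < real (V r)" using V_pos by simp
    have "ret j \<le> ret (r\<^sup>2)" by (rule ret_antimono[OF r(1)])
    also have "\<dots> \<le> C1 / V r" using C1(2)[OF r0] V0 by (simp add: field_simps)
    also have "\<dots> = (C1 / V r) * 1" by simp
    also have "\<dots> \<le> (C1 / V r) * (8 * (real M)\<^sup>2 * real (M ^ L * V r) * ret m)"
      using one C1(1) V0 by (intro mult_left_mono) auto
    also have "\<dots> = C * ret m" using V0 by (simp add: C_def)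
    finally show ?thesis .
  qed
  then have "ret j \<le> max 1 C * ret m" if "0 < j" "0 < m" "m \<le> 7 * j" for j m
    using that mult_right_mono[OF max.cobounded2 ret_nonneg] order_trans by meson
  then show ?thesis by (intro exI[of _ "max 1 C"]) auto
qed

section \<open>Twisted against untwisted return sums\<close>

lemma card_null_words: "real (card (null_words n)) = deg ^ n * inner ((P ^^ n) (delta \<one>)) (delta \<one>)"
  using return_sum[of n] by simp

lemma finite_null_words: "finite (null_words n)"
  using finite_words[of n] unfolding null_words_def words_eq by simp

text \<open>Odd lengths are reduced to even ones by prepending the lazy letter, at the cost of one
  factor \<open>deg\<close>.\<close>

lemma card_null_words_lower: "deg ^ n * ret (n div 2) \<le> deg * card (null_words n)"
proof -
  have even: "real (card (null_words (2 * m))) = deg ^ (2 * m) * ret m" for m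
    unfolding card_null_words ret_def s_inner ..
  show ?thesis
  proof (cases "even n")
    case True
    then obtain m where "n = 2 * m" by blast
    then have "deg ^ n * ret (n div 2) = real (card (null_words n))" using even by simp
    also have "\<dots> \<le> deg * real (card (null_words n))" using deg_pos(2) mult_right_mono[of 1 deg] by simp
    finally show ?thesis .
  next
    case False
    then obtain m where n: "n = Suc (2 * m)" by (metis oddE Suc_eq_plus1)
    have "Cons None ` null_words (2 * m) \<subseteq> null_words n"
    proof
      fix w assume "w \<in> Cons None ` null_words (2 * m)"
      then obtain u where u: "w = None # u" "u \<in> words (2 * m)" "q (lazy_value d u) = \<one>"
        by (auto simp: null_words_def words_eq)
      then have "lazy_value d w = lazy_value d u"
        using lazy_value_carrier[of u] by (simp add: words_def lazy_value_eq letter_word_def)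
      moreover have "w \<in> words n" using u n unfolding words_def by (simp add: Letters_def)
      ultimately show "w \<in> null_words n" using u by (simp add: null_words_def words_eq)
    qed
    then have "card (Cons None ` null_words (2 * m)) \<le> card (null_words n)" by (intro card_mono finite_null_words)
    then have "card (null_words (2 * m)) \<le> card (null_words n)" by (simp add: card_image)
    then have "deg ^ (2 * m) * ret m \<le> real (card (null_words n))" unfolding even[symmetric] by simp
    then have "deg * (deg ^ (2 * m) * ret m) \<le> deg * real (card (null_words n))" using deg_pos by simp
    then show ?thesis using n by (simp add: mult.assoc)
  qed
qed

text \<open>By self-adjointness and Cauchy-Schwarz the twisted sum at time \<open>n\<close> is at
  most the squared norm after \<open>n div 2\<close> steps, up to \<open>deg ^ n\<close>. From step
  \<open>j\<close> on the holonomy \<open>-1\<close> contracts the squared norm by a fixed factor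
  per step, and at step \<open>j\<close> the triangle inequality bounds it by the plain
  walk.\<close>

lemma twisted_return_bound:
  assumes tw: "twisted_model G d q \<omega>"
    and w: "set w \<subseteq> Letters" "q (lazy_value d w) = \<one>" "\<omega> (lazy_value d w) = - 1"
    and j: "j \<le> n div 2"
  shows "0 < length w" "(\<Sum>u\<in>null_words n. Re (\<omega> (lazy_value d u)))
    \<le> deg ^ n * ((1 - 1 / ((real (length w))\<^sup>2 * deg)) ^ (n div 2 - j) * ret j)"
proof -
  interpret T: twisted_model G d q \<omega> by (rule tw)
  let ?\<delta> = "delta \<one>" and ?m = "n div 2" and ?r = "real (length w)"
  show w0: "0 < length w"
  proof (rule ccontr)
    assume "\<not> 0 < length w"
    then have "lazy_value d w = \<one>\<^bsub>F\<^esub>" by (simp add: lazy_value_eq)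
    moreover have "\<one>\<^bsub>F\<^esub> \<in> Ker" by (simp add: Ker_iff)
    then have "\<omega> \<one>\<^bsub>F\<^esub> = \<omega> \<one>\<^bsub>F\<^esub> * \<omega> \<one>\<^bsub>F\<^esub>" using T.\<omega>_mult[of "\<one>\<^bsub>F\<^esub>" "\<one>\<^bsub>F\<^esub>"] by simp
    ultimately show False using w(3) by simp
  qed
  \<comment> \<open>The gap; the factor two of \<open>spectral_gap\<close> is given away to have
    \<open>x <= 1\<close>.\<close>
  define x where "x = 1 / (?r\<^sup>2 * deg)"
  have "1 \<le> ?r\<^sup>2" using w0 by (intro one_le_power) (simp add: Suc_le_eq)
  then have den: "1 \<le> ?r\<^sup>2 * deg" using deg_pos(2) mult_mono[of 1 "?r\<^sup>2" 1 deg] by linarith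
  then have x: "0 \<le> x" "x \<le> 1" by (auto simp: x_def)
  have step: "T.s ?\<delta> (Suc i) \<le> (1 - x) * T.s ?\<delta> i" for i
  proof -
    let ?v = "(T.P ^^ i) ?\<delta>"
    have "foldr (\<lambda>a. T.translate (letter_word a)) w ?v = - ?v"
      unfolding T.foldr_translate[OF w(1)]
      by (rule T.translate_Ker) (use w lazy_value_carrier T.support_P_pow in \<open>auto simp: T.Ker_iff\<close>)
    from T.spectral_gap[OF w(1) this]
    have g: "2 * T.s ?\<delta> i \<le> (?r\<^sup>2 * deg) * (T.s ?\<delta> i - T.s ?\<delta> (Suc i))" by (simp add: T.s_def)
    have "T.s ?\<delta> i \<le> (?r\<^sup>2 * deg) * (T.s ?\<delta> i - T.s ?\<delta> (Suc i))" using g T.s_nonneg[of ?\<delta> i] by linarith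
    then have "T.s ?\<delta> i * x \<le> T.s ?\<delta> i - T.s ?\<delta> (Suc i)" unfolding x_def
      using den by (simp add: divide_le_eq mult.commute)
    then show ?thesis by (simp add: algebra_simps)
  qed
  have pow: "T.s ?\<delta> (j + k) \<le> (1 - x) ^ k * T.s ?\<delta> j" for k
  proof (induction k)
    case (Suc k)
    have "T.s ?\<delta> (j + Suc k) \<le> (1 - x) * T.s ?\<delta> (j + k)" using step[of "j + k"] by simp
    also have "\<dots> \<le> (1 - x) * ((1 - x) ^ k * T.s ?\<delta> j)" using Suc x by (intro mult_left_mono) auto
    finally show ?case by (simp add: mult.assoc)
  qed simp
  have base: "T.s ?\<delta> j \<le> ret j"
  proof -
    have "deg ^ (2 * j) * T.s ?\<delta> j = (\<Sum>u\<in>null_words (2 * j). Re (\<omega> (lazy_value d u)))"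
      unfolding T.s_inner by (rule T.return_sum)
    also have "\<dots> \<le> (\<Sum>u\<in>null_words (2 * j). 1)"
    proof (rule sum_mono)
      fix u assume "u \<in> null_words (2 * j)"
      then have "lazy_value d u \<in> Ker"
        using lazy_value_carrier by (auto simp: null_words_def Ker_iff words_eq[symmetric] words_def)
      then show "Re (\<omega> (lazy_value d u)) \<le> 1" using T.\<omega>_norm complex_Re_le_cmod[of "\<omega> (lazy_value d u)"] by simp
    qed
    also have "\<dots> = deg ^ (2 * j) * ret j"
      using card_null_words[of "2 * j"] by (simp add: ret_def s_inner)
    finally show ?thesis using deg_pos by simp
  qed
  have "inner ((T.P ^^ n) ?\<delta>) ?\<delta> = inner ((T.P ^^ (n - ?m)) ?\<delta>) ((T.P ^^ ?m) ?\<delta>)"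
    using T.inner_P_pow[of "n - ?m" ?\<delta> ?m ?\<delta>] by simp
  also have "\<dots> \<le> norm ((T.P ^^ (n - ?m)) ?\<delta>) * norm ((T.P ^^ ?m) ?\<delta>)" by (rule norm_cauchy_schwarz)
  also have "\<dots> \<le> norm ((T.P ^^ ?m) ?\<delta>) * norm ((T.P ^^ ?m) ?\<delta>)"
  proof (intro mult_right_mono)
    have "T.s ?\<delta> (n - ?m) \<le> T.s ?\<delta> ?m" by (rule T.s_antimono) simp
    then show "norm ((T.P ^^ (n - ?m)) ?\<delta>) \<le> norm ((T.P ^^ ?m) ?\<delta>)"
      unfolding T.s_def by (rule power2_le_imp_le) simp
  qed simp
  also have "\<dots> = T.s ?\<delta> ?m" by (simp add: T.s_def power2_eq_square)
  also have "\<dots> \<le> (1 - x) ^ (?m - j) * T.s ?\<delta> j" using pow[of "?m - j"] j by simp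
  also have "\<dots> \<le> (1 - x) ^ (?m - j) * ret j" using base x by (intro mult_left_mono) auto
  finally have "deg ^ n * inner ((T.P ^^ n) ?\<delta>) ?\<delta> \<le> deg ^ n * ((1 - x) ^ (?m - j) * ret j)"
    using deg_pos by (intro mult_left_mono) auto
  then show "(\<Sum>u\<in>null_words n. Re (\<omega> (lazy_value d u)))
    \<le> deg ^ n * ((1 - 1 / (?r\<^sup>2 * deg)) ^ (?m - j) * ret j)"
    unfolding T.return_sum x_def .
qed

theorem average_lower_bound:
  "\<exists>\<eta>>0. \<forall>n\<ge>8. \<forall>l :: gen_word \<Rightarrow> real. \<forall>w.
    (\<forall>u\<in>Ker. \<forall>v\<in>Ker. l (u \<otimes>\<^bsub>F\<^esub> v) = l u + l v) \<longrightarrow>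
    (\<forall>u\<in>Ker. \<forall>g\<in>carrier F. l (g \<otimes>\<^bsub>F\<^esub> u \<otimes>\<^bsub>F\<^esub> inv\<^bsub>F\<^esub> g) = l u) \<longrightarrow>
    set w \<subseteq> Letters \<longrightarrow> q (lazy_value d w) = \<one> \<longrightarrow> (real (length w))\<^sup>2 \<le> \<eta> * real n \<longrightarrow>
    card (null_words n) * \<bar>l (lazy_value d w)\<bar> \<le> 8 * (\<Sum>u\<in>null_words n. \<bar>l (lazy_value d u)\<bar>)"
proof -
  obtain C where C: "1 \<le> C" "\<And>j m. 0 < j \<Longrightarrow> 0 < m \<Longrightarrow> m \<le> 7 * j \<Longrightarrow> ret j \<le> C * ret m"
    using ret_ratio by blast
  \<comment> \<open>Chosen so that \<open>m - j >= n / 4\<close> steps with gap at least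
    \<open>1 / (\<eta> * n * deg)\<close> give \<open>(m - j) * x >= 2 * C * deg\<close>; the factor
    \<open>deg\<close> on the right pays for \<open>card_null_words_lower\<close>.\<close>
  define \<eta> where "\<eta> = 1 / (8 * C * deg\<^sup>2)"
  have \<eta>: "0 < \<eta>" using C deg_pos by (simp add: \<eta>_def)
  have main: "card (null_words n) * \<bar>l (lazy_value d w)\<bar> \<le> 8 * (\<Sum>u\<in>null_words n. \<bar>l (lazy_value d u)\<bar>)"
    if n: "8 \<le> n" and l: "\<forall>u\<in>Ker. \<forall>v\<in>Ker. l (u \<otimes>\<^bsub>F\<^esub> v) = l u + l v"
      "\<forall>u\<in>Ker. \<forall>g\<in>carrier F. l (g \<otimes>\<^bsub>F\<^esub> u \<otimes>\<^bsub>F\<^esub> inv\<^bsub>F\<^esub> g) = l u"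
    and w: "set w \<subseteq> Letters" "q (lazy_value d w) = \<one>" and len: "(real (length w))\<^sup>2 \<le> \<eta> * real n"
    for n and l :: "gen_word \<Rightarrow> real" and w
  proof (cases "l (lazy_value d w) = 0")
    case True then show ?thesis by (simp add: sum_nonneg)
  next
    case False
    define \<theta> where "\<theta> = pi / l (lazy_value d w)"
    define \<omega> where "\<omega> u = cis (\<theta> * l u)" for u
    have tw: "twisted_model G d q \<omega>"
      by (intro twisted_model.intro twisted_model_axioms.intro is_group q_hom q_surj)
        (use l in \<open>auto simp: \<omega>_def cis_mult distrib_left\<close>)
    have w1: "\<omega> (lazy_value d w) = - 1" using False by (simp add: \<omega>_def \<theta>_def)
    define m where "m = n div 2"
    \<comment> \<open>A quarter leaves enough steps for the decay and keeps
      \<open>m <= 4 * j + 3 <= 7 * j\<close>, the range of \<open>ret_ratio\<close>.\<close>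
    define j where "j = m div 4"
    define i where "i = m mod 4"
    have i: "m = 4 * j + i" "i < 4" by (simp_all add: j_def i_def)
    have "4 \<le> m" using n by (simp add: m_def)
    with i have "1 \<le> j" by linarith
    with i have mj: "0 < j" "0 < m" "m \<le> 7 * j" "j \<le> m" by linarith+
    note jn = mj(4)[unfolded m_def]
    have k: "real n \<le> 4 * real (m - j)"
    proof -
      have "n \<le> 2 * m + 1" by (simp add: m_def)
      moreover have "m - j = 3 * j + i" using i by simp
      ultimately have "n \<le> 4 * (m - j)" using i mj(1) by linarith
      then show ?thesis by (metis of_nat_le_iff of_nat_mult of_nat_numeral)
    qed
    let ?r = "real (length w)"
    define x where "x = 1 / (?r\<^sup>2 * deg)"
    have r0: "0 < length w" by (rule twisted_return_bound(1)[OF tw w w1 jn])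
    have "1 \<le> ?r\<^sup>2" using r0 by (intro one_le_power) (simp add: Suc_le_eq)
    then have den: "1 \<le> ?r\<^sup>2 * deg" using deg_pos(2) mult_mono[of 1 "?r\<^sup>2" 1 deg] by linarith
    then have x: "0 \<le> x" "x \<le> 1" by (auto simp: x_def)
    have kx: "2 * C * deg \<le> 1 + real (m - j) * x"
    proof -
      have "2 * C * deg * (?r\<^sup>2 * deg) \<le> 2 * C * deg * (\<eta> * real n * deg)"
        using len C deg_pos by (intro mult_left_mono mult_right_mono) auto
      also have "\<dots> = real n / 4" using C deg_pos by (simp add: \<eta>_def power2_eq_square)
      also have "\<dots> \<le> real (m - j)" using k by simp
      finally have "2 * C * deg \<le> real (m - j) * x" unfolding x_def using den by (simp add: le_divide_eq)
      then show ?thesis by simp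
    qed
    have decay: "2 * C * deg * (1 - x) ^ (m - j) \<le> 1"
    proof -
      have "2 * C * deg * (1 - x) ^ (m - j) \<le> (1 + real (m - j) * x) * (1 - x) ^ (m - j)"
        using kx x by (intro mult_right_mono) auto
      also have "\<dots> \<le> 1" using power_le_inverse_linear[OF x, of "m - j"] by (simp only: mult.commute)
      finally show ?thesis .
    qed
    let ?c = "real (card (null_words n))"
    have "(\<Sum>u\<in>null_words n. Re (\<omega> (lazy_value d u))) \<le> deg ^ n * ((1 - x) ^ (m - j) * ret j)"
      using twisted_return_bound(2)[OF tw w w1 jn] by (simp only: x_def m_def)
    also have "\<dots> \<le> deg ^ n * ((1 - x) ^ (m - j) * (C * ret m))"
      using C(2)[OF mj(1-3)] x deg_pos by (intro mult_left_mono) auto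
    also have "\<dots> = (1 - x) ^ (m - j) * C * (deg ^ n * ret m)" by (simp only: mult_ac)
    also have "\<dots> \<le> (1 - x) ^ (m - j) * C * (deg * ?c)"
      using card_null_words_lower[of n] x C by (intro mult_left_mono) (auto simp: m_def)
    also have "\<dots> = (2 * C * deg * (1 - x) ^ (m - j)) * (?c / 2)" by simp
    also have "\<dots> \<le> 1 * (?c / 2)" using decay by (intro mult_right_mono) auto
    \<comment> \<open>The twisted sum is at most half the number of null words, so the sum of
      \<open>1 - cos\<close> is at least the other half.\<close>
    finally have "?c / 2 \<le> (\<Sum>u\<in>null_words n. 1 - cos (\<theta> * l (lazy_value d u)))"
      by (simp add: \<omega>_def sum_subtractf)
    also have "\<dots> \<le> (\<Sum>u\<in>null_words n. \<bar>\<theta> * l (lazy_value d u)\<bar>)" by (intro sum_mono one_minus_cos_le)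
    also have "\<dots> = pi / \<bar>l (lazy_value d w)\<bar> * (\<Sum>u\<in>null_words n. \<bar>l (lazy_value d u)\<bar>)"
      by (simp add: sum_distrib_left \<theta>_def abs_mult)
    finally have "?c * \<bar>l (lazy_value d w)\<bar> \<le> (2 * pi) * (\<Sum>u\<in>null_words n. \<bar>l (lazy_value d u)\<bar>)"
      using False by (simp add: field_simps)
    also have "\<dots> \<le> 8 * (\<Sum>u\<in>null_words n. \<bar>l (lazy_value d u)\<bar>)"
      using pi_less_4 by (intro mult_right_mono sum_nonneg) auto
    finally show ?thesis .
  qed
  show ?thesis
    by (intro exI[of _ \<eta>] conjI \<eta> allI impI) (rule main; assumption)
qed

end

section \<open>Norms of quotients of lattices\<close>

definition supported :: "nat \<Rightarrow> (nat \<Rightarrow> int) \<Rightarrow> bool" where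
  "supported s b \<longleftrightarrow> (\<forall>i\<ge>s. b i = 0)"

lemma additive_scale:
  fixes l :: "(nat \<Rightarrow> int) \<Rightarrow> int"
  assumes add: "\<And>b c. l (\<lambda>i. b i + c i) = l b + l c"
  shows "l (\<lambda>i. k * b i) = k * l b"
proof -
  have 0: "l (\<lambda>i. 0) = 0" using add[of "\<lambda>_. 0" "\<lambda>_. 0"] by simp
  have nat: "l (\<lambda>i. int n * b i) = int n * l b" for n b
    by (induction n) (simp_all add: 0 add distrib_right)
  show ?thesis
  proof (cases k rule: int_cases2)
    case (nonneg n) then show ?thesis using nat by simp
  next
    case (nonpos n)
    have "l (\<lambda>i. k * b i + int n * b i) = l (\<lambda>i. 0)" using nonpos by simp
    then show ?thesis using nonpos add[of "\<lambda>i. k * b i" "\<lambda>i. int n * b i"] nat[of n b] 0 by simp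
  qed
qed

text \<open>The last clause carries the content: every coset has a representative whose size the
  functionals control. \<open>\<Lambda>\<close> stays fixed while \<open>s\<close> grows in the
  induction, hence the restriction to vectors supported below \<open>s\<close>.\<close>

definition norm_functionals :: "(nat \<Rightarrow> int) set \<Rightarrow> nat \<Rightarrow> int \<Rightarrow> (nat \<Rightarrow> (nat \<Rightarrow> int) \<Rightarrow> int) \<Rightarrow> bool" where
  "norm_functionals \<Lambda> s C l \<longleftrightarrow> (\<forall>i b c. l i (\<lambda>k. b k + c k) = l i b + l i c) \<and>
    (\<forall>i. \<forall>b\<in>\<Lambda>. supported s b \<longrightarrow> l i b = 0) \<and>
    (\<forall>b. supported s b \<longrightarrow> (\<exists>b'. supported s b' \<and> (\<lambda>i. b i - b' i) \<in> \<Lambda> \<and>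
      (\<Sum>i<s. \<bar>b' i\<bar>) \<le> C * (1 + (\<Sum>i<s. \<bar>l i b\<bar>))))"

text \<open>The functionals compute, up to bounded error, the distance of an integer vector from the
  subgroup \<open>\<Lambda>\<close>, that is, the word norm in the quotient of \<open>\<int>\<^sup>s\<close> by \<open>\<Lambda>\<close>.\<close>
lemma quotient_norm_functionals:
  fixes \<Lambda> :: "(nat \<Rightarrow> int) set"
  assumes diff: "\<And>b c. b \<in> \<Lambda> \<Longrightarrow> c \<in> \<Lambda> \<Longrightarrow> (\<lambda>i. b i - c i) \<in> \<Lambda>" and zero: "(\<lambda>_. 0) \<in> \<Lambda>"
  shows "\<exists>C\<ge>0. \<exists>l. norm_functionals \<Lambda> s C l"
proof (induction s)
  case 0
  have "norm_functionals \<Lambda> 0 0 (\<lambda>_ _. 0)" using zero unfolding norm_functionals_def by auto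
  then show ?case by (intro exI[of _ "0::int"]) auto
next
  case (Suc s)
  then obtain C l where C: "0 \<le> C" and l: "norm_functionals \<Lambda> s C l" by blast
  note l = l[unfolded norm_functionals_def]
  note add = l[THEN conjunct1, rule_format]
  note van = l[THEN conjunct2, THEN conjunct1, rule_format]
  note red = l[THEN conjunct2, THEN conjunct2, rule_format]
  have sum: "(\<lambda>i. b i + c i) \<in> \<Lambda>" if "b \<in> \<Lambda>" "c \<in> \<Lambda>" for b c
    using diff[OF that(1) diff[OF zero that(2)]] by simp
  have scale: "(\<lambda>i. k * b i) \<in> \<Lambda>" if b: "b \<in> \<Lambda>" for k b
  proof -
    have nat: "(\<lambda>i. int n * b i) \<in> \<Lambda>" for n
      by (induction n) (use zero sum[OF b] in \<open>simp_all add: distrib_right\<close>)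
    show ?thesis
    proof (cases k rule: int_cases2)
      case (nonneg n) then show ?thesis using nat by simp
    next
      case (nonpos n) then show ?thesis using diff[OF zero nat[of n]] by simp
    qed
  qed
  show ?case
  \<comment> \<open>If \<open>\<Lambda>\<close> has a vector with nonzero last entry
    \<open>m\<close>, the last coordinate can be reduced to a remainder bounded by \<open>m\<close>
    and yields no functional; otherwise it is itself a functional.\<close>
  proof (cases "\<exists>b\<in>\<Lambda>. supported (Suc s) b \<and> b s \<noteq> 0")
    case True
    then obtain a where a: "a \<in> \<Lambda>" "supported (Suc s) a" "a s \<noteq> 0" by blast
    define m where "m = a s"
    \<comment> \<open>\<open>m * b - b s * a\<close> is additive in \<open>b\<close> and has last
      entry zero: the coordinate is eliminated without dividing.\<close>
    define l' where "l' i b = (if i < s then l i (\<lambda>k. m * b k - b s * a k) else 0)" for i and b :: "nat \<Rightarrow> int"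
    \<comment> \<open>What a remainder of one in the last coordinate adds to the
      functionals.\<close>
    define g where "g i = l i (\<lambda>k. m * (if k = s then 1 else 0) - a k)" for i
    define C' where "C' = C * (1 + \<bar>m\<bar> * (\<Sum>i<s. \<bar>g i\<bar>)) + \<bar>m\<bar>"
    have C': "0 \<le> C'" using C by (simp add: C'_def sum_nonneg)
    have l'_add: "l' i (\<lambda>k. b k + c k) = l' i b + l' i c" for i b c
      using add[of i "\<lambda>k. m * b k - b s * a k" "\<lambda>k. m * c k - c s * a k"]
      by (simp add: l'_def algebra_simps)
    have l'_van: "l' i b = 0" if "b \<in> \<Lambda>" "supported (Suc s) b" for i b
    proof -
      have "supported s (\<lambda>k. m * b k - b s * a k)" unfolding supported_def
      proof (intro allI impI)
        fix k assume "s \<le> k"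
        then show "m * b k - b s * a k = 0" using that(2) a(2)
          by (cases "k = s") (auto simp: m_def supported_def)
      qed
      then show ?thesis using van diff[OF scale[OF that(1)] scale[OF a(1)]] by (simp add: l'_def)
    qed
    have l'_red: "\<exists>b'. supported (Suc s) b' \<and> (\<lambda>i. b i - b' i) \<in> \<Lambda> \<and>
      (\<Sum>i<Suc s. \<bar>b' i\<bar>) \<le> C' * (1 + (\<Sum>i<Suc s. \<bar>l' i b\<bar>))" if b: "supported (Suc s) b" for b
    proof -
      define p where "p = b s div m"
      define \<beta> where "\<beta> = b s mod m"
      have m0: "m \<noteq> 0" using a by (simp add: m_def)
      have bs: "b s = m * p + \<beta>" by (simp add: p_def \<beta>_def)
      have \<beta>: "\<bar>\<beta>\<bar> \<le> \<bar>m\<bar>" using abs_mod_less[OF m0, of "b s"] by (simp add: \<beta>_def)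
      define b2 where "b2 k = (if k = s then 0 else b k - p * a k)" for k
      have "supported s b2" using b a(2) by (auto simp: supported_def b2_def)
      from red[OF this] obtain b3 where b3: "supported s b3" "(\<lambda>i. b2 i - b3 i) \<in> \<Lambda>"
        "(\<Sum>i<s. \<bar>b3 i\<bar>) \<le> C * (1 + (\<Sum>i<s. \<bar>l i b2\<bar>))" by blast
      define b' where "b' k = b3 k + (if k = s then \<beta> else 0)" for k
      have b3s: "b3 s = 0" using b3 by (simp add: supported_def)
      have "supported (Suc s) b'" using b3(1) by (auto simp: supported_def b'_def)
      moreover have "(\<lambda>k. b k - b' k) \<in> \<Lambda>"
      proof -
        have "(\<lambda>k. b k - b' k) = (\<lambda>k. p * a k + (b2 k - b3 k))"
          by (auto simp: b'_def b2_def bs m_def b3s fun_eq_iff)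
        then show ?thesis using sum[OF scale[OF a(1), of p] b3(2)] by simp
      qed
      moreover have "(\<Sum>i<Suc s. \<bar>b' i\<bar>) \<le> C' * (1 + (\<Sum>i<Suc s. \<bar>l' i b\<bar>))"
      proof -
        have lb: "\<bar>l i b2\<bar> \<le> \<bar>l' i b\<bar> + \<bar>m\<bar> * \<bar>g i\<bar>" if "i < s" for i
        proof -
          have "(\<lambda>k. m * b k - b s * a k) = (\<lambda>k. m * b2 k + \<beta> * (m * (if k = s then 1 else 0) - a k))"
            by (auto simp: b2_def bs m_def fun_eq_iff algebra_simps)
          then have "l' i b = l i (\<lambda>k. m * b2 k) + l i (\<lambda>k. \<beta> * (m * (if k = s then 1 else 0) - a k))"
            using that add by (simp add: l'_def)
          then have "l' i b = m * l i b2 + \<beta> * g i"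
            unfolding g_def using additive_scale[of "l i", OF add] by simp
          then have "\<bar>m\<bar> * \<bar>l i b2\<bar> \<le> \<bar>l' i b\<bar> + \<bar>\<beta>\<bar> * \<bar>g i\<bar>"
            by (metis abs_mult abs_triangle_ineq4 add_diff_cancel_right')
          moreover have "\<bar>\<beta>\<bar> * \<bar>g i\<bar> \<le> \<bar>m\<bar> * \<bar>g i\<bar>" using \<beta> by (intro mult_right_mono) auto
          moreover have "1 * \<bar>l i b2\<bar> \<le> \<bar>m\<bar> * \<bar>l i b2\<bar>" using m0 by (intro mult_right_mono) auto
          ultimately show ?thesis by linarith
        qed
        have "(\<Sum>i<s. \<bar>l i b2\<bar>) \<le> (\<Sum>i<s. \<bar>l' i b\<bar> + \<bar>m\<bar> * \<bar>g i\<bar>)" by (intro sum_mono lb) simp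
        also have "\<dots> = (\<Sum>i<s. \<bar>l' i b\<bar>) + \<bar>m\<bar> * (\<Sum>i<s. \<bar>g i\<bar>)" by (simp add: sum.distrib sum_distrib_left)
        finally have S: "(\<Sum>i<s. \<bar>l i b2\<bar>) \<le> (\<Sum>i<s. \<bar>l' i b\<bar>) + \<bar>m\<bar> * (\<Sum>i<s. \<bar>g i\<bar>)" .
        let ?T = "\<Sum>i<s. \<bar>l' i b\<bar>" and ?g = "\<bar>m\<bar> * (\<Sum>i<s. \<bar>g i\<bar>)"
        have T: "0 \<le> ?T" "0 \<le> ?g" by (simp_all add: sum_nonneg)
        have "(\<Sum>i<Suc s. \<bar>b' i\<bar>) = (\<Sum>i<s. \<bar>b3 i\<bar>) + \<bar>\<beta>\<bar>"
          using b3s by (simp add: b'_def)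
        also have "\<dots> \<le> C * (1 + (?T + ?g)) + \<bar>m\<bar>"
          using b3(3) S C \<beta> mult_left_mono[of "1 + (\<Sum>i<s. \<bar>l i b2\<bar>)" "1 + (?T + ?g)" C] by linarith
        also have "\<dots> \<le> C' * (1 + ?T)"
        proof -
          have "0 \<le> C * (?g * ?T)" "0 \<le> \<bar>m\<bar> * ?T" using C T by simp_all
          then show ?thesis unfolding C'_def by (simp add: algebra_simps)
        qed
        finally show ?thesis by (simp add: l'_def)
      qed
      ultimately show ?thesis by blast
    qed
    have "norm_functionals \<Lambda> (Suc s) (C') l'" unfolding norm_functionals_def
      by (intro conjI allI ballI impI) (rule l'_add, rule l'_van, assumption+, rule l'_red, assumption)
    then show ?thesis using C' by (intro exI[of _ "C'"]) auto
  next
    case False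
    \<comment> \<open>Among the new values only \<open>i = s\<close> enters the sum;
      \<open>b s\<close> vanishes on the supported vectors of \<open>\<Lambda>\<close> by the case
      assumption.\<close>
    define l' where "l' i b = (if i < s then l i (\<lambda>k. if k = s then 0 else b k) else b s)" for i and b :: "nat \<Rightarrow> int"
    have l'_add: "l' i (\<lambda>k. b k + c k) = l' i b + l' i c" for i b c
    proof -
      have "(\<lambda>k. if k = s then 0 else b k + c k) = (\<lambda>k. (if k = s then 0 else b k) + (if k = s then 0 else c k))" by auto
      then show ?thesis using add by (simp add: l'_def)
    qed
    have l'_van: "l' i b = 0" if "b \<in> \<Lambda>" "supported (Suc s) b" for i b
    proof -
      have "b s = 0" using False that by blast
      then have "(\<lambda>k. if k = s then 0 else b k) = b" by auto
      moreover have "supported s b" unfolding supported_def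
      proof (intro allI impI)
        fix k assume "s \<le> k"
        then show "b k = 0" using that(2) \<open>b s = 0\<close> by (cases "k = s") (auto simp: supported_def)
      qed
      ultimately show ?thesis using van that \<open>b s = 0\<close> by (simp add: l'_def)
    qed
    have l'_red: "\<exists>b'. supported (Suc s) b' \<and> (\<lambda>i. b i - b' i) \<in> \<Lambda> \<and>
      (\<Sum>i<Suc s. \<bar>b' i\<bar>) \<le> (C + 1) * (1 + (\<Sum>i<Suc s. \<bar>l' i b\<bar>))" if b: "supported (Suc s) b" for b
    proof -
      define b2 where "b2 k = (if k = s then 0 else b k)" for k
      have "supported s b2" using b by (auto simp: supported_def b2_def)
      from red[OF this] obtain b3 where b3: "supported s b3" "(\<lambda>i. b2 i - b3 i) \<in> \<Lambda>"
        "(\<Sum>i<s. \<bar>b3 i\<bar>) \<le> C * (1 + (\<Sum>i<s. \<bar>l i b2\<bar>))" by blast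
      define b' where "b' k = b3 k + (if k = s then b s else 0)" for k
      have b3s: "b3 s = 0" using b3 by (simp add: supported_def)
      have "supported (Suc s) b'" using b3(1) by (auto simp: supported_def b'_def)
      moreover have "(\<lambda>k. b k - b' k) = (\<lambda>k. b2 k - b3 k)"
        by (auto simp: b'_def b2_def b3s fun_eq_iff)
      then have "(\<lambda>k. b k - b' k) \<in> \<Lambda>" using b3(2) by simp
      moreover have "(\<Sum>i<Suc s. \<bar>b' i\<bar>) \<le> (C + 1) * (1 + (\<Sum>i<Suc s. \<bar>l' i b\<bar>))"
      proof -
        let ?T = "\<Sum>i<s. \<bar>l i b2\<bar>"
        have T: "(\<Sum>i<Suc s. \<bar>l' i b\<bar>) = ?T + \<bar>b s\<bar>" by (simp add: l'_def b2_def[abs_def])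
        have "(\<Sum>i<Suc s. \<bar>b' i\<bar>) = (\<Sum>i<s. \<bar>b3 i\<bar>) + \<bar>b s\<bar>" using b3s by (simp add: b'_def)
        moreover have "C * (1 + ?T) + \<bar>b s\<bar> \<le> (C + 1) * (1 + (?T + \<bar>b s\<bar>))"
        proof -
          have "0 \<le> ?T" "0 \<le> C * \<bar>b s\<bar>" using C by (simp_all add: sum_nonneg)
          then show ?thesis by (simp add: algebra_simps)
        qed
        ultimately show ?thesis unfolding T using b3(3) by linarith
      qed
      ultimately show ?thesis by blast
    qed
    have "norm_functionals \<Lambda> (Suc s) (C + 1) l'" unfolding norm_functionals_def
      by (intro conjI allI ballI impI) (rule l'_add, rule l'_van, assumption+, rule l'_red, assumption)
    then show ?thesis using C by (intro exI[of _ "C + 1"]) auto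
  qed
qed

section \<open>Invariant functionals on the relation subgroup\<close>

context group
begin

lemma normal_closure_normal:
  assumes "A \<subseteq> carrier G"
  shows "normal_closure G A \<lhd> G" "A \<subseteq> normal_closure G A"
proof -
  let ?F = "{N. N \<lhd> G \<and> A \<subseteq> N}"
  have ne: "?F \<noteq> {}" using normal_carrier assms by blast
  show "A \<subseteq> normal_closure G A" by (auto simp: normal_closure_def)
  show "normal_closure G A \<lhd> G" unfolding normal_closure_def
  proof (rule normal_invI)
    show "subgroup (\<Inter> ?F) G" using ne by (intro subgroups_Inter) (auto simp: normal_imp_subgroup)
    fix x h assume x: "x \<in> carrier G" and h: "h \<in> \<Inter> ?F"
    show "x \<otimes> h \<otimes> inv x \<in> \<Inter> ?F"
    proof
      fix N assume N: "N \<in> ?F"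
      then have "h \<in> N" using h by blast
      then show "x \<otimes> h \<otimes> inv x \<in> N" using normal_conj(1)[of N x h] N x by simp
    qed
  qed
qed

lemma normal_closure_least: "N \<lhd> G \<Longrightarrow> A \<subseteq> N \<Longrightarrow> normal_closure G A \<subseteq> N"
  by (auto simp: normal_closure_def)

end

text \<open>For a normal subgroup \<open>R\<close> these are the homomorphisms from \<open>R\<close>
  to the integers that are trivial on all commutators of \<open>R\<close> with
  \<open>G\<close>.\<close>

definition inv_hom :: "('a, 'b) monoid_scheme \<Rightarrow> 'a set \<Rightarrow> ('a \<Rightarrow> int) \<Rightarrow> bool" where
  "inv_hom G R l \<longleftrightarrow> (\<forall>u\<in>R. \<forall>v\<in>R. l (u \<otimes>\<^bsub>G\<^esub> v) = l u + l v) \<and>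
    (\<forall>u\<in>R. \<forall>g\<in>carrier G. l (g \<otimes>\<^bsub>G\<^esub> u \<otimes>\<^bsub>G\<^esub> inv\<^bsub>G\<^esub> g) = l u)"

text \<open>Modulo \<open>[R, F]\<close> every element of \<open>R\<close> is a product of powers of
  relators, so the centralized area is the norm in the quotient of the exponent vectors by those
  whose product lies in \<open>[R, F]\<close>. The functionals of that quotient descend to
  \<open>R\<close>.\<close>

lemma centralized_area_functionals:
  assumes rs: "set rs \<subseteq> carrier (free_group d)"
  shows "\<exists>C\<ge>0. \<exists>l :: nat \<Rightarrow> gen_word \<Rightarrow> int. (\<forall>i. inv_hom (free_group d) (relation_subgroup d rs) (l i)) \<and>
    (\<forall>w\<in>relation_subgroup d rs. int (centralized_area d rs w) \<le> C * (1 + (\<Sum>i<length rs. \<bar>l i w\<bar>)))"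
proof -
  let ?F = "free_group d" and ?R = "relation_subgroup d rs" and ?s = "length rs"
  interpret F: group ?F by (rule group_free_group)
  define N where "N = commutator_subgroup ?F ?R (carrier ?F)"
  have R: "?R \<lhd> ?F" "set rs \<subseteq> ?R"
    using F.normal_closure_normal[OF rs] unfolding relation_subgroup_def by auto
  have N: "N \<lhd> ?F" unfolding N_def by (rule F.normal_commutator_subgroup[OF R(1)])
  have Rc: "?R \<subseteq> carrier ?F" using F.normal_subset R by blast
  have Rsub: "subgroup ?R ?F" using R normal_imp_subgroup by blast
  have cen: "commut ?F x y \<in> N" if "x \<in> ?R" "y \<in> carrier ?F" for x y
    using that unfolding N_def F.commut_subgroup_eq by (auto intro!: generate.incl)
  define \<pi> where "\<pi> b = product_list ?F (map (\<lambda>i. (rs ! i) [^]\<^bsub>?F\<^esub> (b i :: int)) [0..<?s])" for b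
  have rsc: "rs ! i \<in> carrier ?F" if "i < ?s" for i using rs nth_mem[OF that] by blast
  have rsi: "(rs ! i) [^]\<^bsub>?F\<^esub> (k::int) \<in> ?R" if "i < ?s" for i k
    by (rule F.subgroup_int_pow_closed[OF Rsub]) (use that R in auto)
  have \<pi>R: "\<pi> b \<in> ?R" for b unfolding \<pi>_def by (rule F.product_list_subgroup[OF Rsub]) (use rsi in auto)
  have \<pi>c: "\<pi> b \<in> carrier ?F" for b using \<pi>R Rc by blast
  have \<pi>_add: "coset_eq ?F N (\<pi> (\<lambda>i. b i + c i)) (\<pi> b \<otimes>\<^bsub>?F\<^esub> \<pi> c)" for b c
  proof -
    have "\<pi> (\<lambda>i. b i + c i) = product_list ?F (map (\<lambda>i. (rs ! i) [^]\<^bsub>?F\<^esub> b i \<otimes>\<^bsub>?F\<^esub> (rs ! i) [^]\<^bsub>?F\<^esub> c i) [0..<?s])"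
      unfolding \<pi>_def using rsc by (intro arg_cong[of _ _ "product_list ?F"] map_cong) (auto simp: F.int_pow_mult)
    also have "coset_eq ?F N \<dots> (\<pi> b \<otimes>\<^bsub>?F\<^esub> \<pi> c)" unfolding \<pi>_def
      by (rule F.product_list_mult_central[OF N]) (use rsi Rc cen in auto)
    finally show ?thesis .
  qed
  have \<pi>_0: "\<pi> (\<lambda>_. 0) = \<one>\<^bsub>?F\<^esub>"
  proof -
    have "product_list ?F (map (\<lambda>i. \<one>\<^bsub>?F\<^esub>) xs) = \<one>\<^bsub>?F\<^esub>" for xs :: "nat list" by (induction xs) auto
    then show ?thesis by (simp add: \<pi>_def)
  qed
  have \<pi>_neg: "coset_eq ?F N (\<pi> (\<lambda>i. - b i)) (inv\<^bsub>?F\<^esub> \<pi> b)" for b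
  proof -
    have "coset_eq ?F N \<one>\<^bsub>?F\<^esub> (\<pi> (\<lambda>i. - b i) \<otimes>\<^bsub>?F\<^esub> \<pi> b)"
      using \<pi>_add[of "\<lambda>i. - b i" b] by (simp add: \<pi>_0)
    from F.coset_eq_mult[OF N this F.coset_eq_refl[OF N, of "inv\<^bsub>?F\<^esub> \<pi> b"]]
    have "coset_eq ?F N (inv\<^bsub>?F\<^esub> \<pi> b) (\<pi> (\<lambda>i. - b i))" using \<pi>c by (simp add: F.m_assoc)
    then show ?thesis by (rule F.coset_eq_sym[OF N])
  qed
  define \<Lambda> where "\<Lambda> = {b. \<pi> b \<in> N}"
  have eq\<Lambda>: "(\<lambda>i. b i - c i) \<in> \<Lambda>" if "coset_eq ?F N (\<pi> b) (\<pi> c)" for b c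
  proof -
    have "coset_eq ?F N (\<pi> (\<lambda>i. b i - c i)) (\<pi> b \<otimes>\<^bsub>?F\<^esub> \<pi> (\<lambda>i. - c i))"
      using \<pi>_add[of b "\<lambda>i. - c i"] by simp
    from F.coset_eq_trans[OF this F.coset_eq_mult[OF N that \<pi>_neg] N]
    have "coset_eq ?F N (\<pi> (\<lambda>i. b i - c i)) \<one>\<^bsub>?F\<^esub>" using \<pi>c by simp
    from F.coset_eq_memD[OF N F.coset_eq_sym[OF N this] _ subset_refl]
    show ?thesis using N normal_imp_subgroup subgroup.one_closed unfolding \<Lambda>_def by blast
  qed
  have \<Lambda>N: "coset_eq ?F N (\<pi> b) \<one>\<^bsub>?F\<^esub>" if "b \<in> \<Lambda>" for b
    using that \<pi>c subgroup.m_inv_closed[OF normal_imp_subgroup[OF N]] by (simp add: coset_eq_def \<Lambda>_def)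
  have \<Lambda>_diff: "(\<lambda>i. b i - c i) \<in> \<Lambda>" if "b \<in> \<Lambda>" "c \<in> \<Lambda>" for b c
    by (rule eq\<Lambda>[OF F.coset_eq_trans[OF \<Lambda>N[OF that(1)] F.coset_eq_sym[OF N \<Lambda>N[OF that(2)]] N]])
  have "(\<lambda>_. 0) \<in> \<Lambda>"
    using \<pi>_0 subgroup.one_closed[OF normal_imp_subgroup[OF N]] by (simp add: \<Lambda>_def)
  from quotient_norm_functionals[OF \<Lambda>_diff this, of ?s]
  obtain C l where C: "0 \<le> C" and l: "norm_functionals \<Lambda> ?s C l" by blast
  note l = l[unfolded norm_functionals_def]
  note add = l[THEN conjunct1, rule_format]
  note van = l[THEN conjunct2, THEN conjunct1, rule_format]
  note red = l[THEN conjunct2, THEN conjunct2, rule_format]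
  define rep where "rep w b \<longleftrightarrow> supported ?s b \<and> coset_eq ?F N (\<pi> b) w" for w b
  have rep_mult: "rep (u \<otimes>\<^bsub>?F\<^esub> v) (\<lambda>i. b i + c i)" if "rep u b" "rep v c" for u v b c
    using that F.coset_eq_trans[OF \<pi>_add F.coset_eq_mult[OF N] N] by (auto simp: rep_def supported_def)
  have rep_conj: "rep (g \<otimes>\<^bsub>?F\<^esub> u \<otimes>\<^bsub>?F\<^esub> inv\<^bsub>?F\<^esub> g) b" if u: "rep u b" and g: "g \<in> carrier ?F" for u g b
  proof -
    have "commut ?F g (\<pi> b) \<in> N"
      using cen[OF \<pi>R g] F.inv_commut[OF \<pi>c g] subgroup.m_inv_closed[OF normal_imp_subgroup[OF N]] by metis
    from F.coset_eq_sym[OF N F.coset_eq_conj[OF N this g \<pi>c]]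
    have 1: "coset_eq ?F N (\<pi> b) (g \<otimes>\<^bsub>?F\<^esub> \<pi> b \<otimes>\<^bsub>?F\<^esub> inv\<^bsub>?F\<^esub> g)" .
    have 2: "coset_eq ?F N (g \<otimes>\<^bsub>?F\<^esub> \<pi> b \<otimes>\<^bsub>?F\<^esub> inv\<^bsub>?F\<^esub> g) (g \<otimes>\<^bsub>?F\<^esub> u \<otimes>\<^bsub>?F\<^esub> inv\<^bsub>?F\<^esub> g)"
      using u g by (intro F.coset_eq_mult[OF N] F.coset_eq_refl[OF N]) (auto simp: rep_def)
    show ?thesis using u F.coset_eq_trans[OF 1 2 N] unfolding rep_def by blast
  qed
  have ex_rep: "\<exists>b. rep w b" if "w \<in> ?R" for w
  proof -
    \<comment> \<open>The elements with an exponent vector form a normal subgroup that contains the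
      relators, hence all of \<open>R\<close>.\<close>
    define W where "W = {w \<in> carrier ?F. \<exists>b. rep w b}"
    have "W \<lhd> ?F"
    proof (rule F.normal_invI)
      show "subgroup W ?F"
      proof (rule F.subgroupI)
        show "W \<subseteq> carrier ?F" by (auto simp: W_def)
        have "rep \<one>\<^bsub>?F\<^esub> (\<lambda>_. 0)" using \<pi>_0 F.coset_eq_refl[OF N F.one_closed] by (simp add: rep_def supported_def)
        then show "W \<noteq> {}" by (auto simp: W_def)
        fix u assume u: "u \<in> W"
        then obtain b where b: "rep u b" by (auto simp: W_def)
        have "rep (inv\<^bsub>?F\<^esub> u) (\<lambda>i. - b i)"
          using b F.coset_eq_trans[OF \<pi>_neg F.coset_eq_inv[OF N] N] by (auto simp: rep_def supported_def)
        then show "inv\<^bsub>?F\<^esub> u \<in> W" using u by (auto simp: W_def)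
        fix v assume "v \<in> W"
        then obtain c where "rep v c" "v \<in> carrier ?F" by (auto simp: W_def)
        then show "u \<otimes>\<^bsub>?F\<^esub> v \<in> W" using u rep_mult[OF b] by (auto simp: W_def)
      qed
      fix x h assume x: "x \<in> carrier ?F" and h: "h \<in> W"
      then obtain b where "rep h b" "h \<in> carrier ?F" by (auto simp: W_def)
      then show "x \<otimes>\<^bsub>?F\<^esub> h \<otimes>\<^bsub>?F\<^esub> inv\<^bsub>?F\<^esub> x \<in> W" using rep_conj[OF _ x, of h b] x by (auto simp: W_def)
    qed
    moreover have "set rs \<subseteq> W"
    proof
      fix r assume "r \<in> set rs"
      then obtain i where i: "i < ?s" "r = rs ! i" by (metis in_set_conv_nth)
      have rc: "r \<in> carrier ?F" using rs \<open>r \<in> set rs\<close> by blast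
      have "product_list ?F (map (\<lambda>j. (rs ! j) [^]\<^bsub>?F\<^esub> (if j = i then 1 else 0 :: int)) xs) = (if i \<in> set xs then r else \<one>\<^bsub>?F\<^esub>)"
        if "distinct xs" for xs
        using that by (induction xs) (auto simp: i(2)[symmetric] rc)
      from this[of "[0..<?s]"] have "\<pi> (\<lambda>j. if j = i then 1 else 0) = r" unfolding \<pi>_def using i by simp
      then have "rep r (\<lambda>j. if j = i then 1 else 0)"
        using i F.coset_eq_refl[OF N rc] by (auto simp: rep_def supported_def)
      then show "r \<in> W" using rc by (auto simp: W_def)
    qed
    ultimately have "?R \<subseteq> W" unfolding relation_subgroup_def by (rule F.normal_closure_least)
    then show ?thesis using that by (auto simp: W_def)
  qed
  \<comment> \<open>The choice does not matter: two exponent vectors of \<open>w\<close> differ by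
    an element of \<open>\<Lambda>\<close>, on which \<open>l i\<close> vanishes.\<close>
  define L where "L i w = l i (SOME b. rep w b)" for i w
  have diff_eq: "l i b = l i c" if "(\<lambda>k. b k - c k) \<in> \<Lambda>" "supported ?s b" "supported ?s c" for i b c
  proof -
    have "l i (\<lambda>k. b k - c k) = 0" using van that by (auto simp: supported_def)
    then show ?thesis using add[of i "\<lambda>k. b k - c k" c] by simp
  qed
  have L_eq: "L i w = l i b" if b: "rep w b" for i w b
  proof -
    have "rep w (SOME b. rep w b)" using b by (rule someI[of "rep w"])
    then show ?thesis unfolding L_def using b F.coset_eq_trans[OF _ F.coset_eq_sym[OF N] N]
      unfolding rep_def by (intro diff_eq eq\<Lambda>) blast+
  qed
  have "inv_hom ?F ?R (L i)" for i
    unfolding inv_hom_def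
  proof (intro conjI ballI)
    fix u v assume "u \<in> ?R" "v \<in> ?R"
    then obtain b c where b: "rep u b" and c: "rep v c" using ex_rep by blast
    show "L i (u \<otimes>\<^bsub>?F\<^esub> v) = L i u + L i v"
      using L_eq[OF b] L_eq[OF c] L_eq[OF rep_mult[OF b c]] add by simp
  next
    fix u g assume "u \<in> ?R" and g: "g \<in> carrier ?F"
    then obtain b where b: "rep u b" using ex_rep by blast
    show "L i (g \<otimes>\<^bsub>?F\<^esub> u \<otimes>\<^bsub>?F\<^esub> inv\<^bsub>?F\<^esub> g) = L i u"
      using L_eq[OF b] L_eq[OF rep_conj[OF b g]] by simp
  qed
  moreover have "int (centralized_area d rs w) \<le> C * (1 + (\<Sum>i<?s. \<bar>L i w\<bar>))" if w: "w \<in> ?R" for w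
  proof -
    obtain b where b: "rep w b" using ex_rep[OF w] by blast
    obtain b' where b': "supported ?s b'" "(\<lambda>i. b i - b' i) \<in> \<Lambda>"
      "(\<Sum>i<?s. \<bar>b' i\<bar>) \<le> C * (1 + (\<Sum>i<?s. \<bar>l i b\<bar>))" using red b by (auto simp: rep_def)
    have "coset_eq ?F N (\<pi> b) (\<pi> (\<lambda>i. b i - b' i) \<otimes>\<^bsub>?F\<^esub> \<pi> b')"
      using \<pi>_add[of "\<lambda>i. b i - b' i" b'] by simp
    from F.coset_eq_trans[OF this F.coset_eq_mult[OF N \<Lambda>N[OF b'(2)] F.coset_eq_refl[OF N \<pi>c]] N]
    have eq: "coset_eq ?F N (\<pi> b) (\<pi> b')" using \<pi>c by simp
    have "coset_eq ?F N (\<pi> b) w" using b by (simp add: rep_def)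
    then have b'w: "coset_eq ?F N (\<pi> b') w" by (rule F.coset_eq_trans[OF F.coset_eq_sym[OF N eq] _ N])
    have "w = \<pi> b' \<otimes>\<^bsub>?F\<^esub> (inv\<^bsub>?F\<^esub> \<pi> b' \<otimes>\<^bsub>?F\<^esub> w)"
      using b'w by (simp add: coset_eq_def F.word_simps)
    then have "w \<in> \<pi> b' <#\<^bsub>?F\<^esub> N"
      using b'w unfolding coset_eq_def l_coset_def by blast
    then have "centralized_area d rs w \<le> (\<Sum>i<?s. nat \<bar>b' i\<bar>)"
      unfolding centralized_area_def \<pi>_def N_def by (intro Least_le exI[of _ b']) auto
    then have "int (centralized_area d rs w) \<le> (\<Sum>i<?s. \<bar>b' i\<bar>)"
    proof -
      have "int (\<Sum>i<?s. nat \<bar>b' i\<bar>) = (\<Sum>i<?s. \<bar>b' i\<bar>)" by simp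
      moreover assume "centralized_area d rs w \<le> (\<Sum>i<?s. nat \<bar>b' i\<bar>)"
      then have "int (centralized_area d rs w) \<le> int (\<Sum>i<?s. nat \<bar>b' i\<bar>)" by (simp only: of_nat_le_iff)
      ultimately show ?thesis by simp
    qed
    then show ?thesis using b'(3) L_eq[OF b] by simp
  qed
  ultimately show ?thesis using C by blast
qed

section \<open>The averaged Dehn function\<close>

definition letter_ext :: "('a, 'b) monoid_scheme \<Rightarrow> (nat \<Rightarrow> 'a) \<Rightarrow> letter \<Rightarrow> 'a" where
  "letter_ext G f x = (if snd x then f (fst x) else inv\<^bsub>G\<^esub> f (fst x))"

definition free_ext :: "('a, 'b) monoid_scheme \<Rightarrow> (nat \<Rightarrow> 'a) \<Rightarrow> gen_word \<Rightarrow> 'a" where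
  "free_ext G f w = product_list G (map (letter_ext G f) w)"

section \<open>The universal property of free groups and lifts between presentations\<close>

context group
begin

lemma letter_ext_closed: "(\<And>i. i < d \<Longrightarrow> f i \<in> carrier G) \<Longrightarrow> x \<in> letters d \<Longrightarrow> letter_ext G f x \<in> carrier G"
  by (cases x) (auto simp: letter_ext_def letters_def)

lemma free_ext_closed:
  assumes "\<And>i. i < d \<Longrightarrow> f i \<in> carrier G" "set w \<subseteq> letters d"
  shows "free_ext G f w \<in> carrier G"
proof -
  have "letter_ext G f x \<in> carrier G" if "x \<in> set w" for x
    using letter_ext_closed[of d f x] assms that by blast
  then show ?thesis unfolding free_ext_def by (intro product_list_closed) auto
qed

lemma free_ext_cons_reduce:
  assumes f: "\<And>i. i < d \<Longrightarrow> f i \<in> carrier G" and x: "x \<in> letters d" and w: "set w \<subseteq> letters d"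
  shows "free_ext G f (cons_reduce x w) = letter_ext G f x \<otimes> free_ext G f w"
proof (cases w)
  case Nil then show ?thesis by (simp add: free_ext_def)
next
  case (Cons y v)
  have c: "letter_ext G f x \<in> carrier G" "free_ext G f v \<in> carrier G"
    using letter_ext_closed[of d f x] free_ext_closed[of d f v] f x w Cons by auto
  have "letter_ext G f (inv_letter x) = inv letter_ext G f x"
    using f[of "fst x"] x by (cases x) (auto simp: letter_ext_def inv_letter_def letters_def)
  then show ?thesis using Cons c by (auto simp: free_ext_def mult_inv_cancel)
qed

lemma free_ext_reduce:
  assumes f: "\<And>i. i < d \<Longrightarrow> f i \<in> carrier G"
  shows "set w \<subseteq> letters d \<Longrightarrow> free_ext G f (reduce w) = free_ext G f w"
proof (induction w)
  case (Cons x w)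
  have "w \<in> lists (letters d)" using Cons.prems by auto
  then have "reduce w \<in> lists (letters d)" by (rule reduce_lists)
  then have "set (reduce w) \<subseteq> letters d" by auto
  then have "free_ext G f (cons_reduce x (reduce w)) = letter_ext G f x \<otimes> free_ext G f (reduce w)"
    using Cons.prems by (intro free_ext_cons_reduce f) auto
  then show ?case using Cons by (simp add: reduce_def free_ext_def)
qed (simp add: reduce_def)

lemma free_ext_hom:
  assumes f: "\<And>i. i < d \<Longrightarrow> f i \<in> carrier G"
  shows "free_ext G f \<in> hom (free_group d) G"
proof (rule homI)
  fix u v assume "u \<in> carrier (free_group d)" "v \<in> carrier (free_group d)"
  then have uv: "set u \<subseteq> letters d" "set v \<subseteq> letters d" by (auto simp: free_group_carrier)
  then show "free_ext G f u \<in> carrier G" using free_ext_closed f by blast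
  have "free_ext G f (reduce (u @ v)) = free_ext G f (u @ v)" using uv by (intro free_ext_reduce[OF f]) auto
  also have "\<dots> = free_ext G f u \<otimes> free_ext G f v" unfolding free_ext_def map_append
    using letter_ext_closed[of d f, OF f] uv by (intro product_list_append) auto
  finally show "free_ext G f (u \<otimes>\<^bsub>free_group d\<^esub> v) = free_ext G f u \<otimes> free_ext G f v"
    by (simp add: free_group_def)
qed

lemma hom_eq_product_letters:
  assumes "p \<in> hom (free_group d) G" "w \<in> carrier (free_group d)"
  shows "p w = product_list G (map (\<lambda>x. p [x]) w)"
proof -
  have gh: "group_hom (free_group d) G p"
    using assms(1) by (intro group_hom.intro group_hom_axioms.intro group_free_group is_group)
  have w: "set w \<subseteq> letters d" "reduced_word w" using assms(2) by (auto simp: free_group_carrier)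
  then have "set (map (\<lambda>x. [x]) w) \<subseteq> carrier (free_group d)" using free_group_letter by auto
  from product_list_hom[OF gh this] w show ?thesis
    by (simp add: product_list_letters reduce_reduced o_def)
qed

lemma hom_eqI:
  assumes p: "p \<in> hom (free_group d) G" and p': "p' \<in> hom (free_group d) G"
    and eq: "\<And>i. i < d \<Longrightarrow> p [(i, True)] = p' [(i, True)]" and w: "w \<in> carrier (free_group d)"
  shows "p w = p' w"
proof -
  have "p [x] = p' [x]" if x: "x \<in> letters d" for x
  proof (cases x)
    case (Pair i b)
    then have i: "i < d" "(i, True) \<in> letters d" using x by (auto simp: letters_def)
    have inv: "r [(i, False)] = inv (r [(i, True)])" if "r \<in> hom (free_group d) G" for r
    proof -
      interpret group_hom "free_group d" G r
        using that by (intro group_hom.intro group_hom_axioms.intro group_free_group is_group)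
      show ?thesis using hom_inv[OF free_group_letter[OF i(2)]] free_group_inv_letter[OF i(2)]
        by (simp add: inv_letter_def)
    qed
    show ?thesis using eq[OF i(1)] inv[OF p] inv[OF p'] Pair by (cases b) auto
  qed
  then have eqm: "map (\<lambda>x. p [x]) w = map (\<lambda>x. p' [x]) w" using w by (auto simp: free_group_carrier)
  show ?thesis unfolding hom_eq_product_letters[OF p w] hom_eq_product_letters[OF p' w] eqm ..
qed

text \<open>Free groups are projective: preimages of the images of the generators determine the
  lift, and homomorphisms that agree on the generators are equal.\<close>

lemma free_group_lift:
  assumes p: "p \<in> hom (free_group d) G" and p': "p' \<in> hom (free_group d') G"
    and surj: "p' ` carrier (free_group d') = carrier G"
  shows "\<exists>\<phi>\<in>hom (free_group d) (free_group d'). \<forall>w\<in>carrier (free_group d). p' (\<phi> w) = p w"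
proof -
  interpret F': group "free_group d'" by (rule group_free_group)
  have "\<exists>g. g \<in> carrier (free_group d') \<and> p' g = p [(i, True)]" if "i < d" for i
  proof -
    have "[(i, True)] \<in> carrier (free_group d)" using that by (intro free_group_letter) (simp add: letters_def)
    then have "p [(i, True)] \<in> p' ` carrier (free_group d')" using p surj by (simp add: hom_in_carrier)
    then show ?thesis by auto
  qed
  then obtain f where f: "\<And>i. i < d \<Longrightarrow> f i \<in> carrier (free_group d')" "\<And>i. i < d \<Longrightarrow> p' (f i) = p [(i, True)]"
    by metis
  let ?\<phi> = "free_ext (free_group d') f"
  have \<phi>: "?\<phi> \<in> hom (free_group d) (free_group d')" by (rule F'.free_ext_hom[OF f(1)])
  have "p' (?\<phi> w) = p w" if "w \<in> carrier (free_group d)" for w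
  proof -
    have "(p' \<circ> ?\<phi>) w = p w"
    proof (rule hom_eqI[OF _ p _ that])
      show "p' \<circ> ?\<phi> \<in> hom (free_group d) G" using Group.hom_compose[OF \<phi> p'] .
      fix i assume "i < d"
      then show "(p' \<circ> ?\<phi>) [(i, True)] = p [(i, True)]" using f by (simp add: free_ext_def letter_ext_def)
    qed
    then show ?thesis by simp
  qed
  then show ?thesis using \<phi> by blast
qed

lemma presentation_hom:
  assumes "finite_presentation G d rs"
  shows "\<exists>p\<in>hom (free_group d) G. p ` carrier (free_group d) = carrier G \<and>
    kernel (free_group d) G p = relation_subgroup d rs"
proof -
  let ?F = "free_group d" and ?R = "relation_subgroup d rs"
  interpret F: group ?F by (rule group_free_group)
  have rs: "set rs \<subseteq> carrier ?F" and "presented_group d rs \<cong> G"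
    using assms by (auto simp: finite_presentation_def)
  then obtain h where h: "h \<in> iso (?F Mod ?R) G" by (auto simp: is_iso_def presented_group_def)
  have R: "?R \<lhd> ?F" using F.normal_closure_normal[OF rs] by (simp add: relation_subgroup_def)
  interpret R: normal ?R ?F by (rule R)
  have hh: "h \<in> hom (?F Mod ?R) G" and bij: "bij_betw h (carrier (?F Mod ?R)) (carrier G)"
    using h by (auto simp: iso_def)
  have qh: "(\<lambda>a. ?R #>\<^bsub>?F\<^esub> a) \<in> hom ?F (?F Mod ?R)" by (rule R.r_coset_hom_Mod)
  let ?p = "h \<circ> (\<lambda>a. ?R #>\<^bsub>?F\<^esub> a)"
  have cM: "carrier (?F Mod ?R) = (\<lambda>a. ?R #>\<^bsub>?F\<^esub> a) ` carrier ?F"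
    by (auto simp: FactGroup_def RCOSETS_def)
  have "?p \<in> hom ?F G" using Group.hom_compose[OF qh hh] .
  moreover have "?p ` carrier ?F = carrier G"
    unfolding image_comp[symmetric] cM[symmetric] using bij by (simp add: bij_betw_def)
  moreover have "kernel ?F G ?p = ?R"
  proof -
    have "?p w = \<one> \<longleftrightarrow> w \<in> ?R" if w: "w \<in> carrier ?F" for w
    proof -
      have one: "\<one>\<^bsub>?F Mod ?R\<^esub> = ?R" by (simp add: FactGroup_def)
      have "h \<one>\<^bsub>?F Mod ?R\<^esub> = \<one>" using hom_one[OF hh R.factorgroup_is_group is_group] .
      then have "?p w = \<one> \<longleftrightarrow> h (?R #>\<^bsub>?F\<^esub> w) = h \<one>\<^bsub>?F Mod ?R\<^esub>" by simp
      also have "\<dots> \<longleftrightarrow> ?R #>\<^bsub>?F\<^esub> w = \<one>\<^bsub>?F Mod ?R\<^esub>"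
      proof (rule inj_on_eq_iff)
        show "inj_on h (carrier (?F Mod ?R))" using bij by (simp add: bij_betw_def)
        show "?R #>\<^bsub>?F\<^esub> w \<in> carrier (?F Mod ?R)" unfolding cM using w by (rule imageI)
        show "\<one>\<^bsub>?F Mod ?R\<^esub> \<in> carrier (?F Mod ?R)"
          by (rule monoid.one_closed[OF group.is_monoid[OF R.factorgroup_is_group]])
      qed
      also have "\<dots> \<longleftrightarrow> w \<in> ?R" unfolding one
        using F.coset_join1[OF _ w R.subgroup_axioms] F.coset_join2[OF w R.subgroup_axioms] by blast
      finally show ?thesis .
    qed
    then show ?thesis using R.subset by (auto simp: kernel_def)
  qed
  ultimately show ?thesis by blast
qed

end

text \<open>The products of relator conjugates form a normal subgroup that contains the relators.
  Hence the minimum in \<open>filling_area\<close> is attained, and a bound for all such products is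
  one for the area.\<close>

lemma relation_subgroup_product:
  assumes rs: "set rs \<subseteq> carrier (free_group d)" and u: "u \<in> relation_subgroup d rs"
  shows "\<exists>cs\<in>lists (relator_conjugates d rs). u = product_list (free_group d) cs"
proof -
  let ?F = "free_group d" and ?C = "relator_conjugates d rs"
  interpret F: group ?F by (rule group_free_group)
  have CE: "\<exists>g r. c = inv\<^bsub>?F\<^esub> g \<otimes>\<^bsub>?F\<^esub> r \<otimes>\<^bsub>?F\<^esub> g \<and> g \<in> carrier ?F \<and> r \<in> carrier ?F \<and>
     (r \<in> set rs \<or> r \<in> m_inv ?F ` set rs)" if "c \<in> ?C" for c
    using that rs unfolding relator_conjugates_def by blast
  have CI: "inv\<^bsub>?F\<^esub> g \<otimes>\<^bsub>?F\<^esub> r \<otimes>\<^bsub>?F\<^esub> g \<in> ?C" if "g \<in> carrier ?F" "r \<in> set rs \<or> r \<in> m_inv ?F ` set rs" for g r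
    using that unfolding relator_conjugates_def by blast
  have Cc: "?C \<subseteq> carrier ?F"
  proof
    fix c assume "c \<in> ?C"
    from CE[OF this] show "c \<in> carrier ?F" by auto
  qed
  have Cinv: "inv\<^bsub>?F\<^esub> c \<in> ?C" if c: "c \<in> ?C" for c
  proof -
    obtain g r where gr: "c = inv\<^bsub>?F\<^esub> g \<otimes>\<^bsub>?F\<^esub> r \<otimes>\<^bsub>?F\<^esub> g" "g \<in> carrier ?F" "r \<in> carrier ?F"
      "r \<in> set rs \<or> r \<in> m_inv ?F ` set rs" using CE[OF c] by blast
    have "inv\<^bsub>?F\<^esub> c = inv\<^bsub>?F\<^esub> g \<otimes>\<^bsub>?F\<^esub> inv\<^bsub>?F\<^esub> r \<otimes>\<^bsub>?F\<^esub> g"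
      using gr by (simp add: F.word_simps)
    moreover have "inv\<^bsub>?F\<^esub> r \<in> set rs \<or> inv\<^bsub>?F\<^esub> r \<in> m_inv ?F ` set rs" using gr(4) rs by auto
    ultimately show ?thesis using CI gr(2) by simp
  qed
  have Cconj: "x \<otimes>\<^bsub>?F\<^esub> c \<otimes>\<^bsub>?F\<^esub> inv\<^bsub>?F\<^esub> x \<in> ?C" if c: "c \<in> ?C" and x: "x \<in> carrier ?F" for c x
  proof -
    obtain g r where gr: "c = inv\<^bsub>?F\<^esub> g \<otimes>\<^bsub>?F\<^esub> r \<otimes>\<^bsub>?F\<^esub> g" "g \<in> carrier ?F" "r \<in> carrier ?F"
      "r \<in> set rs \<or> r \<in> m_inv ?F ` set rs" using CE[OF c] by blast
    have "x \<otimes>\<^bsub>?F\<^esub> c \<otimes>\<^bsub>?F\<^esub> inv\<^bsub>?F\<^esub> x = inv\<^bsub>?F\<^esub> (g \<otimes>\<^bsub>?F\<^esub> inv\<^bsub>?F\<^esub> x) \<otimes>\<^bsub>?F\<^esub> r \<otimes>\<^bsub>?F\<^esub> (g \<otimes>\<^bsub>?F\<^esub> inv\<^bsub>?F\<^esub> x)"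
      using gr x by (simp add: F.word_simps)
    then show ?thesis using CI[OF _ gr(4), of "g \<otimes>\<^bsub>?F\<^esub> inv\<^bsub>?F\<^esub> x"] gr(2) x by simp
  qed
  define W where "W = {u. \<exists>cs. set cs \<subseteq> ?C \<and> u = product_list ?F cs}"
  have WI: "product_list ?F cs \<in> W" if "set cs \<subseteq> ?C" for cs using that unfolding W_def by blast
  have "W \<lhd> ?F"
  proof (rule F.normal_invI)
    show "subgroup W ?F"
    proof (rule F.subgroupI)
      show "W \<subseteq> carrier ?F" using Cc F.product_list_closed unfolding W_def by (blast intro: subset_trans)
      show "W \<noteq> {}" using WI[of "[]"] by auto
      fix a assume "a \<in> W"
      then obtain as where as: "set as \<subseteq> ?C" "a = product_list ?F as" unfolding W_def by blast
      have asc: "set as \<subseteq> carrier ?F" using as Cc by blast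
      have "inv\<^bsub>?F\<^esub> a = product_list ?F (rev (map (m_inv ?F) as))"
        using F.product_list_rev_inv[OF asc] as by simp
      moreover have "set (rev (map (m_inv ?F) as)) \<subseteq> ?C" using as Cinv by auto
      ultimately show "inv\<^bsub>?F\<^esub> a \<in> W" using WI by metis
      fix b assume "b \<in> W"
      then obtain bs where bs: "set bs \<subseteq> ?C" "b = product_list ?F bs" unfolding W_def by blast
      have bsc: "set bs \<subseteq> carrier ?F" using bs Cc by blast
      have "a \<otimes>\<^bsub>?F\<^esub> b = product_list ?F (as @ bs)"
        using F.product_list_append[OF asc bsc] as bs by simp
      then show "a \<otimes>\<^bsub>?F\<^esub> b \<in> W" using WI[of "as @ bs"] as bs by simp
    qed
    fix x h assume x: "x \<in> carrier ?F" and "h \<in> W"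
    then obtain hs where hs: "set hs \<subseteq> ?C" "h = product_list ?F hs" unfolding W_def by blast
    have "x \<otimes>\<^bsub>?F\<^esub> product_list ?F hs \<otimes>\<^bsub>?F\<^esub> inv\<^bsub>?F\<^esub> x = product_list ?F (map (\<lambda>c. x \<otimes>\<^bsub>?F\<^esub> c \<otimes>\<^bsub>?F\<^esub> inv\<^bsub>?F\<^esub> x) hs)"
      using hs(1)
    proof (induction hs)
      case Nil then show ?case using x by simp
    next
      case (Cons c hs)
      have cc: "c \<in> carrier ?F" "product_list ?F hs \<in> carrier ?F"
        using Cons.prems Cc F.product_list_closed[of hs] by auto
      have "x \<otimes>\<^bsub>?F\<^esub> product_list ?F (c # hs) \<otimes>\<^bsub>?F\<^esub> inv\<^bsub>?F\<^esub> x =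
         (x \<otimes>\<^bsub>?F\<^esub> c \<otimes>\<^bsub>?F\<^esub> inv\<^bsub>?F\<^esub> x) \<otimes>\<^bsub>?F\<^esub> (x \<otimes>\<^bsub>?F\<^esub> product_list ?F hs \<otimes>\<^bsub>?F\<^esub> inv\<^bsub>?F\<^esub> x)"
        using cc x by (simp add: F.word_simps)
      then show ?case using Cons by simp
    qed
    moreover have "set (map (\<lambda>c. x \<otimes>\<^bsub>?F\<^esub> c \<otimes>\<^bsub>?F\<^esub> inv\<^bsub>?F\<^esub> x) hs) \<subseteq> ?C" using hs Cconj x by auto
    ultimately show "x \<otimes>\<^bsub>?F\<^esub> h \<otimes>\<^bsub>?F\<^esub> inv\<^bsub>?F\<^esub> x \<in> W" using WI hs(2) by metis
  qed
  moreover have "set rs \<subseteq> W"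
  proof
    fix r assume r: "r \<in> set rs"
    then have "r \<in> carrier ?F" using rs by blast
    then have "r \<in> ?C" using CI[of "\<one>\<^bsub>?F\<^esub>" r] r by simp
    then show "r \<in> W" using WI[of "[r]"] \<open>r \<in> carrier ?F\<close> by simp
  qed
  ultimately have "relation_subgroup d rs \<subseteq> W" unfolding relation_subgroup_def by (rule F.normal_closure_least)
  then obtain cs where "set cs \<subseteq> ?C" "u = product_list ?F cs" using u unfolding W_def by blast
  then show ?thesis by (intro bexI[of _ cs]) auto
qed

text \<open>By invariance a conjugate of a relator or of its inverse has the value of the relator up
  to sign, so every factor of a filling contributes a bounded amount.\<close>

lemma filling_area_lower:
  assumes rs: "set rs \<subseteq> carrier (free_group d)" and l: "inv_hom (free_group d) (relation_subgroup d rs) l"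
    and u: "u \<in> relation_subgroup d rs"
  shows "\<bar>l u\<bar> \<le> (\<Sum>r\<in>set rs. \<bar>l r\<bar>) * int (filling_area d rs u)"
proof -
  let ?F = "free_group d" and ?R = "relation_subgroup d rs" and ?K = "\<Sum>r\<in>set rs. \<bar>l r\<bar>"
  interpret F: group ?F by (rule group_free_group)
  have R: "?R \<lhd> ?F" "set rs \<subseteq> ?R" using F.normal_closure_normal[OF rs] by (auto simp: relation_subgroup_def)
  have Rsub: "subgroup ?R ?F" using R normal_imp_subgroup by blast
  have Rc: "?R \<subseteq> carrier ?F" using F.normal_subset R by blast
  have add: "l (a \<otimes>\<^bsub>?F\<^esub> b) = l a + l b" if "a \<in> ?R" "b \<in> ?R" for a b using l that by (simp add: inv_hom_def)
  have one: "l \<one>\<^bsub>?F\<^esub> = 0" using add[of "\<one>\<^bsub>?F\<^esub>" "\<one>\<^bsub>?F\<^esub>"] subgroup.one_closed[OF Rsub] by simp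
  have bound: "c \<in> ?R \<and> \<bar>l c\<bar> \<le> ?K" if "c \<in> relator_conjugates d rs" for c
  proof -
    obtain g r where gr: "c = inv\<^bsub>?F\<^esub> g \<otimes>\<^bsub>?F\<^esub> r \<otimes>\<^bsub>?F\<^esub> g" "g \<in> carrier ?F"
      "r \<in> set rs \<or> r \<in> m_inv ?F ` set rs" using \<open>c \<in> _\<close> unfolding relator_conjugates_def by blast
    have rR: "r \<in> ?R \<and> \<bar>l r\<bar> \<le> ?K"
    proof -
      have *: "\<bar>l t\<bar> \<le> ?K" if "t \<in> set rs" for t using that by (intro member_le_sum) auto
      from gr(3) show ?thesis
      proof
        assume "r \<in> set rs" then show ?thesis using * R by blast
      next
        assume "r \<in> m_inv ?F ` set rs"
        then obtain t where t: "t \<in> set rs" "r = inv\<^bsub>?F\<^esub> t" by blast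
        then have tR: "t \<in> ?R" "r \<in> ?R" "t \<in> carrier ?F" using R(2) subgroup.m_inv_closed[OF Rsub] Rc by auto
        then have "l t + l r = 0" using add[of t r] t one by simp
        then show ?thesis using tR *[OF t(1)] by simp
      qed
    qed
    have "l (inv\<^bsub>?F\<^esub> g \<otimes>\<^bsub>?F\<^esub> r \<otimes>\<^bsub>?F\<^esub> inv\<^bsub>?F\<^esub> (inv\<^bsub>?F\<^esub> g)) = l r"
      using l rR gr(2) unfolding inv_hom_def by (meson F.inv_closed)
    then have "l c = l r" using gr by simp
    moreover have "c \<in> ?R" using F.normal_conj(2)[OF R(1) gr(2)] rR gr(1) by simp
    ultimately show ?thesis using rR by simp
  qed
  define Q where "Q k \<longleftrightarrow> (\<exists>cs\<in>lists (relator_conjugates d rs). length cs = k \<and> u = product_list ?F cs)" for k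
  have "\<exists>k. Q k" using relation_subgroup_product[OF rs u] unfolding Q_def by blast
  then have "Q (filling_area d rs u)" unfolding filling_area_def Q_def[symmetric] by (rule LeastI_ex)
  then obtain cs where cs: "set cs \<subseteq> relator_conjugates d rs" "length cs = filling_area d rs u" "u = product_list ?F cs"
    unfolding Q_def by auto
  have "product_list ?F cs \<in> ?R \<and> \<bar>l (product_list ?F cs)\<bar> \<le> ?K * int (length cs)"
    using cs(1)
  proof (induction cs)
    case Nil then show ?case using one subgroup.one_closed[OF Rsub] by simp
  next
    case (Cons c cs)
    then have c: "c \<in> ?R" "\<bar>l c\<bar> \<le> ?K" and IH: "product_list ?F cs \<in> ?R" "\<bar>l (product_list ?F cs)\<bar> \<le> ?K * int (length cs)"
      using bound[of c] by auto
    have "\<bar>l (c \<otimes>\<^bsub>?F\<^esub> product_list ?F cs)\<bar> \<le> ?K + ?K * int (length cs)"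
      using add[OF c(1) IH(1)] c(2) IH(2) by linarith
    then show ?case using subgroup.m_closed[OF Rsub c(1) IH(1)] by (simp add: algebra_simps)
  qed
  then show ?thesis using cs by simp
qed

section \<open>Averages over null words and the comparison of growth rates\<close>

lemma null_lazy_words_eq:
  assumes "set rs \<subseteq> carrier (free_group d)"
  shows "null_lazy_words d rs n = {w \<in> lazy_words d n. lazy_value d w \<in> relation_subgroup d rs}"
proof -
  let ?F = "free_group d" and ?R = "relation_subgroup d rs"
  interpret F: group ?F by (rule group_free_group)
  have R: "?R \<lhd> ?F" using F.normal_closure_normal[OF assms] by (simp add: relation_subgroup_def)
  interpret R: normal ?R ?F by (rule R)
  have "?R #>\<^bsub>?F\<^esub> lazy_value d w = \<one>\<^bsub>presented_group d rs\<^esub> \<longleftrightarrow> lazy_value d w \<in> ?R" if w: "w \<in> lazy_words d n" for w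
  proof -
    have "case_option \<one>\<^bsub>?F\<^esub> (\<lambda>x. [x]) a \<in> carrier ?F" if "a \<in> set w" for a
      using w that free_group_letter by (auto simp: lazy_words_def split: option.split)
    then have c: "lazy_value d w \<in> carrier ?F" unfolding lazy_value_def by (intro F.product_list_closed) auto
    have "\<one>\<^bsub>presented_group d rs\<^esub> = ?R" by (simp add: presented_group_def FactGroup_def)
    then show ?thesis using F.coset_join1[OF _ c R.subgroup_axioms] F.coset_join2[OF c R.subgroup_axioms] by auto
  qed
  then show ?thesis by (auto simp: null_lazy_words_def)
qed

lemma averaged_dehn_eq:
  assumes "finite (null_lazy_words d rs n)" "null_lazy_words d rs n \<noteq> {}"
  shows "card (null_lazy_words d rs n) * averaged_dehn d rs n =
    (\<Sum>w\<in>null_lazy_words d rs n. real (filling_area d rs (lazy_value d w)))"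
proof -
  have "averaged_dehn d rs n =
    (\<Sum>w\<in>null_lazy_words d rs n. real (filling_area d rs (lazy_value d w)) / card (null_lazy_words d rs n))"
    unfolding averaged_dehn_def using assms by (intro sum.cong) (auto simp: pmf_of_set)
  then show ?thesis using assms by (simp add: sum_divide_distrib[symmetric])
qed

text \<open>The ball is finite and contains the identity, so the maximum is attained.\<close>

lemma large_centralized_area:
  assumes rs: "set rs \<subseteq> carrier (free_group d)"
  shows "\<exists>w\<in>relation_subgroup d rs \<inter> free_ball d n. centralized_area d rs w = centralized_isoperimetric d rs n"
proof -
  interpret F: group "free_group d" by (rule group_free_group)
  have "free_ball d n = (\<lambda>w. product_list (free_group d) (map (\<lambda>x. [x]) w)) ` {w. set w \<subseteq> letters d \<and> length w \<le> n}"
    by (auto simp: free_ball_def)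
  then have "finite (free_ball d n)" using finite_lists_length_le[of "letters d" n] by (simp add: letters_def)
  moreover have "\<one>\<^bsub>free_group d\<^esub> \<in> relation_subgroup d rs \<inter> free_ball d n"
  proof
    show "\<one>\<^bsub>free_group d\<^esub> \<in> free_ball d n" unfolding free_ball_def by (rule CollectI, rule exI[of _ "[]"]) simp
    show "\<one>\<^bsub>free_group d\<^esub> \<in> relation_subgroup d rs"
      using F.normal_closure_normal(1)[OF rs] normal_imp_subgroup subgroup.one_closed
      unfolding relation_subgroup_def by blast
  qed
  ultimately have "centralized_isoperimetric d rs n \<in> centralized_area d rs ` (relation_subgroup d rs \<inter> free_ball d n)"
    unfolding centralized_isoperimetric_def by (intro Max_in) auto
  then show ?thesis by auto
qed

text \<open>Growth of order at least two beats the linear term: from \<open>x >= 4 * E / c\<close>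
  on, \<open>E * (1 + x) <= 2 * E * x\<close> is at most half of
  \<open>c * x powr k\<close>.\<close>

lemma square_growth_cancel:
  fixes c E x k :: real
  assumes "0 < c" "0 < E" "2 \<le> k" "1 \<le> x" "4 * E / c \<le> x" "c * x powr k \<le> E * (1 + x + a)"
  shows "c / (2 * E) * x powr k \<le> a"
proof -
  have "x powr 2 \<le> x powr k" using assms by (intro powr_mono) auto
  then have "x * x \<le> x powr k" using assms by (simp add: power2_eq_square)
  have "4 * E \<le> c * x" using assms by (simp add: divide_le_eq mult.commute)
  then have "4 * E * x \<le> c * x * x" using assms by (intro mult_right_mono) auto
  also have "\<dots> \<le> c * x powr k" using assms \<open>x * x \<le> _\<close> by (simp add: mult.assoc)
  finally have "4 * E * x \<le> c * x powr k" .
  moreover have "E * (1 + x) \<le> E * (2 * x)" using assms by (intro mult_left_mono) auto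
  moreover have "E * (1 + x + a) = E * (1 + x) + E * a" by (simp add: algebra_simps)
  ultimately have "c * x powr k / 2 \<le> E * a" using assms(6) by linarith
  then show ?thesis using assms by (simp add: field_simps)
qed

theorem theorem2:
  fixes G :: "('a, 'b) monoid_scheme"
    and k :: real
    and d :: nat
    and rs :: "gen_word list"
  assumes "finitely_generated_group G"
    and "nilpotent_group G"
    and "k \<ge> 2"
    and "finite_presentation G d rs"
    and "(\<lambda>n. real (centralized_isoperimetric d rs n)) \<in> \<Omega>(\<lambda>n. real n powr k)"
  shows "\<forall>d' rs'. finite_presentation G d' rs' \<longrightarrow>
    (\<lambda>n. averaged_dehn d' rs' n) \<in> \<Omega>(\<lambda>n. real n powr (k / 2))"
proof (intro allI impI)
  fix d' rs' assume fp': "finite_presentation G d' rs'"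
  interpret G: group G using assms(2) by (simp add: nilpotent_group_def)
  let ?F = "free_group d" and ?F' = "free_group d'"
  let ?R = "relation_subgroup d rs" and ?R' = "relation_subgroup d' rs'"
  interpret F: group ?F by (rule group_free_group)
  interpret F': group ?F' by (rule group_free_group)
  have rs: "set rs \<subseteq> carrier ?F" and rs': "set rs' \<subseteq> carrier ?F'"
    using assms(4) fp' by (auto simp: finite_presentation_def)
  obtain p where p: "p \<in> hom ?F G" "p ` carrier ?F = carrier G" "kernel ?F G p = ?R"
    using G.presentation_hom[OF assms(4)] by blast
  obtain p' where p': "p' \<in> hom ?F' G" "p' ` carrier ?F' = carrier G" "kernel ?F' G p' = ?R'"
    using G.presentation_hom[OF fp'] by blast
  \<comment> \<open>Lifts of the identity of \<open>G\<close> in both directions: loops are carried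
    to \<open>?F'\<close> and functionals back from \<open>?F\<close>.\<close>
  obtain \<phi> where \<phi>: "\<phi> \<in> hom ?F ?F'" "\<And>w. w \<in> carrier ?F \<Longrightarrow> p' (\<phi> w) = p w"
    using G.free_group_lift[OF p(1) p'(1,2)] by blast
  obtain \<psi> where \<psi>: "\<psi> \<in> hom ?F' ?F" "\<And>w. w \<in> carrier ?F' \<Longrightarrow> p (\<psi> w) = p' w"
    using G.free_group_lift[OF p'(1) p(1,2)] by blast
  interpret p: group_hom ?F G p
    by (intro group_hom.intro group_hom_axioms.intro group_free_group G.is_group p(1))
  interpret \<phi>: group_hom ?F ?F' \<phi>
    by (intro group_hom.intro group_hom_axioms.intro group_free_group \<phi>(1))
  interpret \<psi>: group_hom ?F' ?F \<psi>
    by (intro group_hom.intro group_hom_axioms.intro group_free_group \<psi>(1))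
  interpret P: plain_model G d' p'
    by (intro plain_model.intro twisted_model.intro twisted_model_axioms.intro plain_model_axioms.intro
        G.is_group p'(1,2) assms(2)) auto
  have R_iff: "w \<in> ?R \<longleftrightarrow> w \<in> carrier ?F \<and> p w = \<one>\<^bsub>G\<^esub>" for w using p(3) by (auto simp: kernel_def)
  have R'_iff: "w \<in> ?R' \<longleftrightarrow> w \<in> carrier ?F' \<and> p' w = \<one>\<^bsub>G\<^esub>" for w using p'(3) by (auto simp: kernel_def)
  have \<psi>R: "\<psi> v \<in> ?R" if "v \<in> ?R'" for v using that \<psi>(2) by (simp add: R_iff R'_iff)
  let ?s = "length rs"
  obtain C l where C: "0 \<le> C" and l: "\<And>i. inv_hom ?F ?R (l i)"
    and area: "\<And>w. w \<in> ?R \<Longrightarrow> int (centralized_area d rs w) \<le> C * (1 + (\<Sum>i<?s. \<bar>l i w\<bar>))"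
    using centralized_area_functionals[OF rs] by blast
  have l_mult: "l i (u \<otimes>\<^bsub>?F\<^esub> v) = l i u + l i v" if "u \<in> ?R" "v \<in> ?R" for i u v
    using l[of i] that by (simp add: inv_hom_def)
  have l_conj: "l i (g \<otimes>\<^bsub>?F\<^esub> u \<otimes>\<^bsub>?F\<^esub> inv\<^bsub>?F\<^esub> g) = l i u" if "u \<in> ?R" "g \<in> carrier ?F" for i u g
    using l[of i] that by (simp add: inv_hom_def)
  define l' where "l' i v = l i (\<psi> v)" for i v
  have l': "inv_hom ?F' ?R' (l' i)" for i
    unfolding inv_hom_def
  proof (intro conjI ballI)
    fix u v assume uv: "u \<in> ?R'" "v \<in> ?R'"
    then have "\<psi> (u \<otimes>\<^bsub>?F'\<^esub> v) = \<psi> u \<otimes>\<^bsub>?F\<^esub> \<psi> v" by (simp add: R'_iff)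
    then show "l' i (u \<otimes>\<^bsub>?F'\<^esub> v) = l' i u + l' i v" using l_mult \<psi>R uv by (simp add: l'_def)
  next
    fix u g assume ug: "u \<in> ?R'" "g \<in> carrier ?F'"
    then have "\<psi> (g \<otimes>\<^bsub>?F'\<^esub> u \<otimes>\<^bsub>?F'\<^esub> inv\<^bsub>?F'\<^esub> g) = \<psi> g \<otimes>\<^bsub>?F\<^esub> \<psi> u \<otimes>\<^bsub>?F\<^esub> inv\<^bsub>?F\<^esub> \<psi> g"
      by (simp add: R'_iff)
    then show "l' i (g \<otimes>\<^bsub>?F'\<^esub> u \<otimes>\<^bsub>?F'\<^esub> inv\<^bsub>?F'\<^esub> g) = l' i u"
      using l_conj[OF \<psi>R[OF ug(1)], where g = "\<psi> g"] ug by (simp add: l'_def)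
  qed
  \<comment> \<open>\<open>\<psi> o \<phi>\<close> covers the identity of \<open>G\<close>, so the
    argument of \<open>l i\<close> lies in \<open>?R\<close>. As \<open>l i\<close> is invariant
    under conjugation, \<open>\<kappa> i\<close> is a homomorphism on all of \<open>?F\<close> and
    hence grows at most linearly with the word length.\<close>
  define \<kappa> where "\<kappa> i w = l i (\<psi> (\<phi> w) \<otimes>\<^bsub>?F\<^esub> inv\<^bsub>?F\<^esub> w)" for i w
  have \<kappa>R: "\<psi> (\<phi> w) \<otimes>\<^bsub>?F\<^esub> inv\<^bsub>?F\<^esub> w \<in> ?R" if "w \<in> carrier ?F" for w
    using that \<phi>(2) \<psi>(2) by (simp add: R_iff)
  have \<kappa>_mult: "\<kappa> i (u \<otimes>\<^bsub>?F\<^esub> v) = \<kappa> i u + \<kappa> i v" if uv: "u \<in> carrier ?F" "v \<in> carrier ?F" for i u v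
  proof -
    let ?a = "\<psi> (\<phi> u)" and ?y = "\<psi> (\<phi> v) \<otimes>\<^bsub>?F\<^esub> inv\<^bsub>?F\<^esub> v"
    have a: "?a \<in> carrier ?F" using uv by simp
    have "\<psi> (\<phi> (u \<otimes>\<^bsub>?F\<^esub> v)) \<otimes>\<^bsub>?F\<^esub> inv\<^bsub>?F\<^esub> (u \<otimes>\<^bsub>?F\<^esub> v)
      = (?a \<otimes>\<^bsub>?F\<^esub> ?y \<otimes>\<^bsub>?F\<^esub> inv\<^bsub>?F\<^esub> ?a) \<otimes>\<^bsub>?F\<^esub> (?a \<otimes>\<^bsub>?F\<^esub> inv\<^bsub>?F\<^esub> u)"
      using uv by (simp add: F.word_simps)
    moreover have "?a \<otimes>\<^bsub>?F\<^esub> ?y \<otimes>\<^bsub>?F\<^esub> inv\<^bsub>?F\<^esub> ?a \<in> ?R"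
      using \<kappa>R[OF uv(2)] a by (simp add: R_iff)
    ultimately show ?thesis
      using l_mult[OF _ \<kappa>R[OF uv(1)], where i = i and u = "?a \<otimes>\<^bsub>?F\<^esub> ?y \<otimes>\<^bsub>?F\<^esub> inv\<^bsub>?F\<^esub> ?a"] l_conj[OF \<kappa>R[OF uv(2)] a, where i = i]
      by (simp add: \<kappa>_def)
  qed
  have \<kappa>_one: "\<kappa> i \<one>\<^bsub>?F\<^esub> = 0" for i using \<kappa>_mult[OF F.one_closed F.one_closed, where i = i] by simp
  have l'\<phi>: "l' i (\<phi> w) = \<kappa> i w + l i w" if w: "w \<in> ?R" for i w
  proof -
    have wc: "w \<in> carrier ?F" using w by (simp add: R_iff)
    then have "\<psi> (\<phi> w) = (\<psi> (\<phi> w) \<otimes>\<^bsub>?F\<^esub> inv\<^bsub>?F\<^esub> w) \<otimes>\<^bsub>?F\<^esub> w" by (simp add: F.word_simps)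
    then show ?thesis unfolding l'_def \<kappa>_def
      by (rule trans[OF arg_cong[of _ _ "l i"] l_mult[OF \<kappa>R[OF wc] w]])
  qed
  let ?w = "\<lambda>w0. product_list ?F (map (\<lambda>x. [x]) w0)"
  have wc: "?w w0 \<in> carrier ?F" if "set w0 \<subseteq> letters d" for w0
    using that free_group_letter by (intro F.product_list_closed) auto
  have fin_letters: "finite (letters d)" by (simp add: letters_def)
  define A where "A = (\<Sum>i<?s. \<Sum>x\<in>letters d. \<bar>\<kappa> i [x]\<bar>)"
  have A: "\<bar>\<kappa> i [x]\<bar> \<le> A" if "i < ?s" "x \<in> letters d" for i x
  proof -
    have "\<bar>\<kappa> i [x]\<bar> \<le> (\<Sum>x\<in>letters d. \<bar>\<kappa> i [x]\<bar>)" using that fin_letters by (intro member_le_sum) auto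
    moreover have "(\<Sum>x\<in>letters d. \<bar>\<kappa> i [x]\<bar>) \<le> A" unfolding A_def
      using that by (intro member_le_sum[of i "{..<?s}" "\<lambda>i. \<Sum>x\<in>letters d. \<bar>\<kappa> i [x]\<bar>"]) (auto simp: sum_nonneg)
    ultimately show ?thesis by (rule order_trans)
  qed
  have A0: "0 \<le> A" by (simp add: A_def sum_nonneg)
  have \<kappa>_bound: "\<bar>\<kappa> i (?w w0)\<bar> \<le> A * int (length w0)" if "i < ?s" "set w0 \<subseteq> letters d" for i w0
    using that(2)
  proof (induction w0)
    case Nil then show ?case by (simp add: \<kappa>_one)
  next
    case (Cons x w0)
    have "\<kappa> i (?w (x # w0)) = \<kappa> i [x] + \<kappa> i (?w w0)"
      using \<kappa>_mult[where i = i and u = "[x]" and v = "?w w0"] free_group_letter[of x d] wc[of w0] Cons.prems by simp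
    moreover have "\<bar>\<kappa> i [x]\<bar> \<le> A" using A[OF that(1)] Cons.prems by simp
    ultimately have "\<bar>\<kappa> i (?w (x # w0))\<bar> \<le> A + A * int (length w0)" using Cons by simp
    then show ?case by (simp add: algebra_simps)
  qed
  \<comment> \<open>A Lipschitz constant of \<open>\<phi>\<close>, from its values on letters;
    \<open>Suc\<close> keeps it positive as a denominator.\<close>
  define L where "L = Suc (\<Sum>x\<in>letters d. length (\<phi> [x]))"
  have lazy: "\<exists>v. set v \<subseteq> P.Letters \<and> lazy_value d' v = \<phi> (?w w0) \<and> length v \<le> L * length w0"
    if "set w0 \<subseteq> letters d" for w0
    using that
  proof (induction w0)
    case Nil then show ?case by (intro exI[of _ "[]"]) (simp add: P.lazy_value_eq)
  next
    case (Cons x w0)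
    then obtain v where v: "set v \<subseteq> P.Letters" "lazy_value d' v = \<phi> (?w w0)" "length v \<le> L * length w0" by auto
    have x: "x \<in> letters d" using Cons.prems by simp
    let ?u = "\<phi> [x]"
    have u: "?u \<in> carrier ?F'" using free_group_letter[OF x] by simp
    then have u': "set ?u \<subseteq> letters d'" "reduced_word ?u" by (auto simp: free_group_carrier)
    have uL: "set (map Some ?u) \<subseteq> P.Letters" using u' by (auto simp: P.Letters_def)
    have lw: "set (map P.letter_word v) \<subseteq> carrier ?F'" if "set v \<subseteq> P.Letters" for v
      using that P.letter_word_carrier by auto
    have "map P.letter_word (map Some ?u) = map (\<lambda>x. [x]) ?u" by (simp add: P.letter_word_def)
    then have "lazy_value d' (map Some ?u) = ?u"
      using u' by (simp only: P.lazy_value_eq product_list_letters reduce_reduced)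
    then have "lazy_value d' (map Some ?u @ v) = ?u \<otimes>\<^bsub>?F'\<^esub> \<phi> (?w w0)"
      unfolding P.lazy_value_eq map_append using F'.product_list_append[OF lw[OF uL] lw[OF v(1)]] v(2)
      by (simp only: P.lazy_value_eq map_append)
    also have "\<dots> = \<phi> (?w (x # w0))" using free_group_letter[OF x] wc[of w0] Cons.prems by simp
    finally have "lazy_value d' (map Some ?u @ v) = \<phi> (?w (x # w0))" .
    moreover have "length (map Some ?u @ v) \<le> L * length (x # w0)"
    proof -
      have "length ?u \<le> (\<Sum>x\<in>letters d. length (\<phi> [x]))" using x fin_letters by (intro member_le_sum) auto
      then show ?thesis using v(3) by (simp add: L_def)
    qed
    ultimately show ?case using uL v(1) by (intro exI[of _ "map Some ?u @ v"]) auto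
  qed
  obtain \<eta> where \<eta>: "0 < \<eta>" and avg0: "\<forall>n\<ge>8. \<forall>l :: gen_word \<Rightarrow> real. \<forall>w.
    (\<forall>u\<in>P.Ker. \<forall>v\<in>P.Ker. l (u \<otimes>\<^bsub>?F'\<^esub> v) = l u + l v) \<longrightarrow>
    (\<forall>u\<in>P.Ker. \<forall>g\<in>carrier ?F'. l (g \<otimes>\<^bsub>?F'\<^esub> u \<otimes>\<^bsub>?F'\<^esub> inv\<^bsub>?F'\<^esub> g) = l u) \<longrightarrow>
    set w \<subseteq> P.Letters \<longrightarrow> p' (lazy_value d' w) = \<one>\<^bsub>G\<^esub> \<longrightarrow> (real (length w))\<^sup>2 \<le> \<eta> * real n \<longrightarrow>
    card (P.null_words n) * \<bar>l (lazy_value d' w)\<bar> \<le> 8 * (\<Sum>u\<in>P.null_words n. \<bar>l (lazy_value d' u)\<bar>)"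
    using P.average_lower_bound by blast
  have null_eq: "P.null_words n = null_lazy_words d' rs' n" for n
  proof -
    have "lazy_value d' w \<in> carrier ?F'" if "w \<in> lazy_words d' n" for w
      using that P.lazy_value_carrier unfolding P.words_eq[symmetric] P.words_def by blast
    then show ?thesis unfolding P.null_words_def null_lazy_words_eq[OF rs'] by (auto simp: R'_iff)
  qed
  have fin: "finite (null_lazy_words d' rs' n)" for n using P.finite_null_words[of n] by (simp add: null_eq)
  have ne: "null_lazy_words d' rs' n \<noteq> {}" for n
  proof -
    have "product_list ?F' (map P.letter_word (replicate n None)) = \<one>\<^bsub>?F'\<^esub>"
      by (induction n) (auto simp: P.letter_word_def)
    then have "lazy_value d' (replicate n None) = \<one>\<^bsub>?F'\<^esub>" by (simp only: P.lazy_value_eq)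
    moreover have "replicate n None \<in> lazy_words d' n" by (auto simp: lazy_words_def)
    ultimately have "replicate n None \<in> P.null_words n" by (simp add: P.null_words_def)
    then show ?thesis using null_eq by blast
  qed
  let ?avg = "averaged_dehn d' rs'"
  \<comment> \<open>The sum dominates the constants that \<open>filling_area_lower\<close> gives for
    the single functionals.\<close>
  define D where "D = (\<Sum>i<?s. \<Sum>r\<in>set rs'. \<bar>l' i r\<bar>)"
  have D0: "0 \<le> D" by (simp add: D_def sum_nonneg)
  have avg: "real_of_int \<bar>l' i (lazy_value d' v)\<bar> \<le> 8 * real_of_int D * ?avg n"
    if n: "8 \<le> n" and v: "set v \<subseteq> P.Letters" "p' (lazy_value d' v) = \<one>\<^bsub>G\<^esub>" "(real (length v))\<^sup>2 \<le> \<eta> * real n"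
      and i: "i < ?s" for n v i
  proof -
    let ?N = "null_lazy_words d' rs' n"
    have hom: "\<forall>u\<in>P.Ker. \<forall>v\<in>P.Ker. real_of_int (l' i (u \<otimes>\<^bsub>?F'\<^esub> v)) = real_of_int (l' i u) + real_of_int (l' i v)"
      "\<forall>u\<in>P.Ker. \<forall>g\<in>carrier ?F'. real_of_int (l' i (g \<otimes>\<^bsub>?F'\<^esub> u \<otimes>\<^bsub>?F'\<^esub> inv\<^bsub>?F'\<^esub> g)) = real_of_int (l' i u)"
      using l'[of i] unfolding p'(3) inv_hom_def by simp_all
    have "card ?N * \<bar>real_of_int (l' i (lazy_value d' v))\<bar> \<le> 8 * (\<Sum>u\<in>?N. \<bar>real_of_int (l' i (lazy_value d' u))\<bar>)"
      using avg0[rule_format, OF n, of "\<lambda>u. real_of_int (l' i u)" v] hom v unfolding null_eq by simp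
    also have "\<dots> \<le> 8 * (\<Sum>u\<in>?N. real_of_int D * real (filling_area d' rs' (lazy_value d' u)))"
    proof (intro mult_left_mono sum_mono)
      fix u assume "u \<in> ?N"
      then have u: "lazy_value d' u \<in> ?R'" by (simp add: null_lazy_words_eq[OF rs'])
      have "\<bar>l' i (lazy_value d' u)\<bar> \<le> (\<Sum>r\<in>set rs'. \<bar>l' i r\<bar>) * int (filling_area d' rs' (lazy_value d' u))"
        by (rule filling_area_lower[OF rs' l' u])
      moreover have "(\<Sum>r\<in>set rs'. \<bar>l' i r\<bar>) \<le> D" unfolding D_def
        using i by (intro member_le_sum[of i "{..<?s}" "\<lambda>i. \<Sum>r\<in>set rs'. \<bar>l' i r\<bar>"]) (auto simp: sum_nonneg)
      then have "(\<Sum>r\<in>set rs'. \<bar>l' i r\<bar>) * int (filling_area d' rs' (lazy_value d' u)) \<le> D * int (filling_area d' rs' (lazy_value d' u))"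
        by (intro mult_right_mono) auto
      ultimately have "\<bar>l' i (lazy_value d' u)\<bar> \<le> D * int (filling_area d' rs' (lazy_value d' u))" by (rule order_trans)
      then have "real_of_int \<bar>l' i (lazy_value d' u)\<bar> \<le> real_of_int (D * int (filling_area d' rs' (lazy_value d' u)))"
        by (simp only: of_int_le_iff)
      then show "\<bar>real_of_int (l' i (lazy_value d' u))\<bar> \<le> real_of_int D * real (filling_area d' rs' (lazy_value d' u))" by simp
    qed simp
    also have "\<dots> = card ?N * (8 * real_of_int D * ?avg n)"
      using averaged_dehn_eq[OF fin ne, of n] by (simp add: sum_distrib_left[symmetric] mult_ac)
    finally show ?thesis using fin ne by (simp add: card_gt_0_iff)
  qed
  have avg_nonneg: "0 \<le> ?avg n" for n
    unfolding averaged_dehn_def by (intro sum_nonneg mult_nonneg_nonneg) auto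
  obtain c where c: "0 < c" and "\<forall>\<^sub>F n in sequentially. norm (real (centralized_isoperimetric d rs n)) \<ge> c * norm (real n powr k)"
    using landau_omega.bigE[OF assms(5)] by blast
  then obtain N1 where N1: "\<And>n. N1 \<le> n \<Longrightarrow> c * real n powr k \<le> real (centralized_isoperimetric d rs n)"
    by (auto simp: eventually_sequentially)
  define bd where "bd = real ?s * (8 * real_of_int D)"
  define bk where "bk = real ?s * real_of_int A"
  \<comment> \<open>One constant for the additive error of the area bound, the average with its
    factor \<open>bd\<close> and the linear term from \<open>\<kappa>\<close> with its factor
    \<open>bk\<close>; the last \<open>1\<close> makes it positive.\<close>
  define E where "E = real_of_int C * (1 + bd + bk) + 1"
  have bdk: "0 \<le> bd" "0 \<le> bk" "0 \<le> real_of_int C" using D0 A0 C by (auto simp: bd_def bk_def)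
  have E: "0 < E" using bdk by (simp add: E_def add_nonneg_pos)
  have main: "c * real m powr k \<le> E * (1 + real m + ?avg n)"
    if m: "N1 \<le> m" and n: "8 \<le> n" and mn: "(real (L * m))\<^sup>2 \<le> \<eta> * real n" for m n
  proof -
    obtain w where w: "w \<in> ?R" "w \<in> free_ball d m" "centralized_area d rs w = centralized_isoperimetric d rs m"
      using large_centralized_area[OF rs, of m] by blast
    obtain w0 where w0: "w = ?w w0" "set w0 \<subseteq> letters d" "length w0 \<le> m"
      using w(2) unfolding free_ball_def by auto
    obtain v where v: "set v \<subseteq> P.Letters" "lazy_value d' v = \<phi> w" "length v \<le> L * length w0"
      using lazy[OF w0(2)] w0(1) by blast
    have "length v \<le> L * m" using v(3) w0(3) by (meson mult_le_mono2 order_trans)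
    then have "real (length v) \<le> real (L * m)" by (simp only: of_nat_le_iff)
    then have "(real (length v))\<^sup>2 \<le> (real (L * m))\<^sup>2" by (rule power_mono) simp
    then have len: "(real (length v))\<^sup>2 \<le> \<eta> * real n" using mn by linarith
    have pv: "p' (lazy_value d' v) = \<one>\<^bsub>G\<^esub>" using v(2) \<phi>(2) w(1) by (simp add: R_iff)
    have li: "real_of_int \<bar>l i w\<bar> \<le> 8 * real_of_int D * ?avg n + real_of_int A * real m" if i: "i < ?s" for i
    proof -
      have "\<bar>\<kappa> i w\<bar> \<le> A * int (length w0)" using \<kappa>_bound[OF i w0(2)] w0(1) by simp
      moreover have "A * int (length w0) \<le> A * int m" using A0 w0(3) by (intro mult_left_mono) auto
      ultimately have "\<bar>\<kappa> i w\<bar> \<le> A * int m" by (rule order_trans)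
      then have "real_of_int \<bar>\<kappa> i w\<bar> \<le> real_of_int (A * int m)" by (simp only: of_int_le_iff)
      moreover have "real_of_int \<bar>l' i (\<phi> w)\<bar> \<le> 8 * real_of_int D * ?avg n"
        using avg[OF n v(1) pv len i] v(2) by simp
      moreover have "real_of_int \<bar>l i w\<bar> \<le> real_of_int \<bar>l' i (\<phi> w)\<bar> + real_of_int \<bar>\<kappa> i w\<bar>"
        using l'\<phi>[OF w(1), where i = i] by simp
      ultimately show ?thesis by simp
    qed
    have "(\<Sum>i<?s. real_of_int \<bar>l i w\<bar>) \<le> (\<Sum>i<?s. 8 * real_of_int D * ?avg n + real_of_int A * real m)"
      by (intro sum_mono li) simp
    also have "\<dots> = bd * ?avg n + bk * real m" by (simp add: bd_def bk_def distrib_left)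
    finally have S: "(\<Sum>i<?s. real_of_int \<bar>l i w\<bar>) \<le> bd * ?avg n + bk * real m" .
    have "real_of_int (int (centralized_area d rs w)) \<le> real_of_int (C * (1 + (\<Sum>i<?s. \<bar>l i w\<bar>)))"
      using area[OF w(1)] by (simp only: of_int_le_iff)
    then have "real (centralized_area d rs w) \<le> real_of_int C * (1 + (\<Sum>i<?s. real_of_int \<bar>l i w\<bar>))" by simp
    also have "\<dots> \<le> real_of_int C * ((1 + bd + bk) * (1 + real m + ?avg n))"
    proof (intro mult_left_mono bdk)
      have expand: "(1 + bd + bk) * (1 + real m + ?avg n) =
        1 + bd + bk + real m + ?avg n + bd * real m + bk * ?avg n + bk * real m + bd * ?avg n"
        by (simp add: algebra_simps)
      have "0 \<le> bd * real m" "0 \<le> bk * ?avg n" using bdk avg_nonneg by simp_all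
      then show "1 + (\<Sum>i<?s. real_of_int \<bar>l i w\<bar>) \<le> (1 + bd + bk) * (1 + real m + ?avg n)"
        using S bdk(1,2) avg_nonneg[of n] expand by linarith
    qed
    also have "\<dots> \<le> E * (1 + real m + ?avg n)"
    proof -
      have "E * (1 + real m + ?avg n) = real_of_int C * ((1 + bd + bk) * (1 + real m + ?avg n)) + (1 + real m + ?avg n)"
        unfolding E_def by (simp only: distrib_right mult.assoc mult_1)
      then show ?thesis using avg_nonneg[of n] by linarith
    qed
    finally show ?thesis using N1[OF m] w(3) by simp
  qed
  \<comment> \<open>The length \<open>m\<close> chosen below is the largest with
    \<open>(L * m) ^ 2 <= \<eta> * n\<close>; rounding down loses at most half, whence the two in
    the denominator.\<close>
  define \<beta> where "\<beta> = sqrt \<eta> / (2 * real L)"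
  have L0: "0 < real L" unfolding L_def by (simp only: of_nat_0_less_iff zero_less_Suc)
  have \<beta>: "0 < \<beta>" using \<eta> L0 by (simp add: \<beta>_def)
  \<comment> \<open>Lengths from \<open>T\<close> on meet the threshold of the hypothesis, the
    condition of \<open>square_growth_cancel\<close> and \<open>m >= 1\<close>.\<close>
  define T where "T = max (max (real N1) (4 * E / c)) 1"
  have bound: "c / (2 * E) * \<beta> powr k * real n powr (k / 2) \<le> ?avg n" if n: "8 \<le> n" "(T / \<beta>)\<^sup>2 \<le> real n" for n
  proof -
    define y where "y = sqrt (\<eta> * real n) / real L"
    define m where "m = nat \<lfloor>y\<rfloor>"
    have y2: "y / 2 = \<beta> * sqrt (real n)" by (simp add: y_def \<beta>_def real_sqrt_mult)
    have "T / \<beta> \<le> sqrt (real n)" using n(2) by (rule real_le_rsqrt)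
    then have yT: "T \<le> y / 2" unfolding y2 using \<beta> by (simp add: divide_le_eq mult.commute)
    then have y1: "2 \<le> y" by (simp add: T_def)
    then have my: "real m \<le> y" "y / 2 \<le> real m" unfolding m_def by linarith+
    have mT: "real N1 \<le> real m" "4 * E / c \<le> real m" "1 \<le> real m" using yT my(2) by (auto simp: T_def)
    have "real (L * m) \<le> sqrt (\<eta> * real n)" using my(1) L0 by (simp add: y_def le_divide_eq mult.commute)
    then have "(real (L * m))\<^sup>2 \<le> (sqrt (\<eta> * real n))\<^sup>2" by (rule power_mono) simp
    also have "\<dots> = \<eta> * real n" using \<eta> by simp
    finally have "(real (L * m))\<^sup>2 \<le> \<eta> * real n" .
    then have "c * real m powr k \<le> E * (1 + real m + ?avg n)" using main[of m n] mT n by simp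
    from square_growth_cancel[OF c E assms(3) mT(3,2) this]
    have fin: "c / (2 * E) * real m powr k \<le> ?avg n" .
    have "\<beta> powr k * real n powr (k / 2) = (\<beta> * sqrt (real n)) powr k"
      using \<beta> by (simp add: powr_mult powr_powr flip: powr_half_sqrt)
    also have "\<dots> \<le> real m powr k" using my(2) \<beta> assms(3) unfolding y2 by (intro powr_mono2) auto
    finally have "c / (2 * E) * (\<beta> powr k * real n powr (k / 2)) \<le> c / (2 * E) * real m powr k"
      using c E by (intro mult_left_mono) auto
    then show ?thesis using fin by (simp add: mult.assoc)
  qed
  show "(\<lambda>n. averaged_dehn d' rs' n) \<in> \<Omega>(\<lambda>n. real n powr (k / 2))"
  proof (rule landau_omega.bigI)
    show "0 < c / (2 * E) * \<beta> powr k" using c E \<beta> by simp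
    have "\<forall>\<^sub>F n in sequentially. 8 \<le> n \<and> nat \<lceil>(T / \<beta>)\<^sup>2\<rceil> \<le> n"
      by (intro eventually_conj eventually_ge_at_top)
    then show "\<forall>\<^sub>F n in sequentially. c / (2 * E) * \<beta> powr k * norm (real n powr (k / 2)) \<le> norm (?avg n)"
    proof (rule eventually_mono)
      fix n assume n: "8 \<le> n \<and> nat \<lceil>(T / \<beta>)\<^sup>2\<rceil> \<le> n"
      then have "(T / \<beta>)\<^sup>2 \<le> real n" by linarith
      then show "c / (2 * E) * \<beta> powr k * norm (real n powr (k / 2)) \<le> norm (?avg n)"
        using bound[of n] n avg_nonneg[of n] by simp
    qed
  qed
qed

end
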